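(* Let $A\in\mathbb{R}^{n\times n}$, $B,\tilde B\in\mathbb{R}^{n\times m}$, $C\in\mathbb{R}^{m\times n}$ with $\det(CB)\ne0$, let $\Phi:\Delta\to\mathbb{R}^{n\times n}$, $\Delta=\{(t,\tau)\in\mathbb{R}\times\mathbb{R}:t\ge\tau\}$, be measurable and locally essentially bounded, and let $\gamma\in L^\infty(\mathbb{R};\mathbb{R}^m)$, $p\in L^\infty(\mathbb{R};\mathbb{R}^n)$, $t^0\in\mathbb{R}$. Consider the closed-loop system $$\dot x(t)=Ax(t)+B(u(t)+\gamma(t))+p(t)+\int_{t^0}^t\Phi(t,\tau)\tilde B(u(\tau)+\gamma(\tau))\,d\tau,\quad t>t^0,$$ $$y(t)=Cx(t),\qquad u(t)=-\rho(CB)^{-1}\frac{y(t)}{\|y(t)\|_P},\qquad \rho>0.$$ Suppose $CA=\Lambda C$ with $\Lambda\in\mathbb{R}^{m\times m}$ such that $$\Lambda^\top P+P\Lambda\preceq0,\qquad 0\prec P=P^\top\in\mathbb{R}^{m\times m},$$ and that for some constants $M$ and $\delta>0$ $$\operatorname*{ess\,sup}_{t\ge t^0}\int_{t^0}^t\|C\Phi(t,\tau)\tilde B(CB)^{-1}\|_P\,d\tau\le M<1,$$ $$\rho\ge\frac{\|C(B\gamma(t)+p(t))\|_P+\int_{t^0}^t\|C\Phi(t,\tau)\tilde B\gamma(\tau)\|_P\,d\tau+\delta}{1-M}\quad\text{for almost all }t\ge t^0.$$ Then any Filippov solution of the closed-loop system (for any initial condition $x(t^0)=x^0\in\mathbb{R}^n$)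 exists and is defined for all $t\ge t^0$. Moreover, $\frac{d}{dt}\|y(t)\|_P\le-\delta$ for almost all $t\ge t^0$ with $\|y(t)\|_P\ne0$, and there exists $T\in[t^0,\,t^0+\|Cx(t^0)\|_P/\delta]$ such that $$y(t)=Cx(t)=0,\qquad\forall t\ge T.$$
   Context: $\|y\|_P=\sqrt{y^\top Py}$ for $y\in\mathbb{R}^m$, and $\|Q\|_P=\sup_{y\ne0}\|Qy\|_P/\|y\|_P$ for $Q\in\mathbb{R}^{m\times m}$. $\mathcal{B}(r)\subset\mathbb{R}^n$ is the open ball of radius $r$ centered at $0$. A function is locally essentially bounded on a set if its norm has finite essential supremum over every compact subset of that set. Filippov regularization of a function $g$ of $(t,x)$: $K[g](t,x)=\bigcap_{\delta>0}\bigcap_{\mu(N)=0}\overline{\mathrm{co}}\,g(t,x+\mathcal{B}(\delta)\setminus N)$, where $\overline{\mathrm{co}}$ is the convex closure and the intersections are over all $\delta>0$ and all $N\subset\mathbb{R}^n$ of Lebesgue measure zero (so the value of the feedback at $Cx=0$ is irrelevant). Filippov solution of the closed-loop system with $x(t^0)=x^0$ on an interval $\mathcal{I}$ starting at $t^0$: an absolutely continuous $x:\mathcal{I}\to\mathbb{R}^n$ with $x(t^0)=x^0$ such that for almost all $t\in\mathcal{I}$, $\dot x(t)\in K[f](t,x(t))+\int_{t^0}^t\Phi(t,\tau)K[\tilde f](\tau,x(\tau))\,d\tau$ (Aumann integral), where $f(t,x)=Ax+B(\hat u(x)+\gamma(t))+p(t)$, $\tilde f(t,x)=\tilde B(\hat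 u(x)+\gamma(t))$ and $\hat u(x)=-\rho(CB)^{-1}Cx/\|Cx\|_P$. *)

theory Defs
  imports "HOL-Analysis.Analysis" "HOL-Probability.Essential_Supremum"
begin

definition pos_definite :: "real ^ 'm ^ 'm \<Rightarrow> bool" where
  "pos_definite P \<longleftrightarrow> transpose P = P \<and> (\<forall>y. y \<noteq> 0 \<longrightarrow> y \<bullet> (P *v y) > 0)"

definition neg_semidefinite :: "real ^ 'm ^ 'm \<Rightarrow> bool" where
  "neg_semidefinite Q \<longleftrightarrow> transpose Q = Q \<and> (\<forall>y. y \<bullet> (Q *v y) \<le> 0)"

definition wnorm :: "real ^ 'm ^ 'm \<Rightarrow> real ^ 'm \<Rightarrow> real" where
  "wnorm P y = sqrt (y \<bullet> (P *v y))"

definition wopnorm :: "real ^ 'm ^ 'm \<Rightarrow> real ^ 'm ^ 'm \<Rightarrow> real" where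
  "wopnorm P Q = (SUP y\<in>-{0}. wnorm P (Q *v y) / wnorm P y)"

definition L_infinity :: "(real \<Rightarrow> 'a::euclidean_space) \<Rightarrow> bool" where
  "L_infinity g \<longleftrightarrow>
     g \<in> borel_measurable lebesgue \<and> esssup lebesgue (\<lambda>t. ereal (norm (g t))) < \<infinity>"

definition locally_ess_bounded_on ::
    "'a::euclidean_space set \<Rightarrow> ('a \<Rightarrow> 'b::euclidean_space) \<Rightarrow> bool" where
  "locally_ess_bounded_on S g \<longleftrightarrow>
     (\<forall>K. compact K \<and> K \<subseteq> S \<longrightarrow> esssup (lebesgue_on K) (\<lambda>z. ereal (norm (g z))) < \<infinity>)"

definition kernel_domain :: "(real \<times> real) set" where
  "kernel_domain = {(t, \<tau>). t \<ge> \<tau>}"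

text \<open>The finite families of non-overlapping subintervals \<open>[a i, b i]\<close> of \<open>S\<close> may contain
  degenerate intervals, which contribute nothing to either sum.\<close>

definition abs_continuous_on :: "real set \<Rightarrow> (real \<Rightarrow> 'a::real_normed_vector) \<Rightarrow> bool" where
  "abs_continuous_on S x \<longleftrightarrow>
     (\<forall>\<epsilon>>0. \<exists>\<eta>>0. \<forall>(k::nat) a b.
        (\<forall>i<k. a i \<le> b i \<and> {a i..b i} \<subseteq> S) \<and>
        disjoint_family_on (\<lambda>i. {a i<..<b i}) {..<k} \<and>
        (\<Sum>i<k. b i - a i) < \<eta> \<longrightarrow>
        (\<Sum>i<k. norm (x (b i) - x (a i))) < \<epsilon>)"

definition filippov_reg ::
    "(real \<Rightarrow> 'a::euclidean_space \<Rightarrow> 'b::euclidean_space) \<Rightarrow> real \<Rightarrow> 'a \<Rightarrow> 'b set" where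
  "filippov_reg g t x =
     (\<Inter>\<eta>\<in>{0<..}. \<Inter>N\<in>null_sets lebesgue. closure (convex hull (g t ` (ball x \<eta> - N))))"

definition aumann_integral :: "real set \<Rightarrow> (real \<Rightarrow> 'a::euclidean_space set) \<Rightarrow> 'a set" where
  "aumann_integral S F =
     {(LINT \<tau>:S|lebesgue. w \<tau>) | w.
        set_integrable lebesgue S w \<and> (AE \<tau> in lebesgue. \<tau> \<in> S \<longrightarrow> w \<tau> \<in> F \<tau>)}"

text \<open>On a non-compact interval such as \<open>[t0, \<infinity>)\<close>, absolute continuity is understood on every
  compact subinterval.\<close>

definition filippov_solution ::
    "(real \<Rightarrow> real ^ 'n \<Rightarrow> real ^ 'n) \<Rightarrow> (real \<Rightarrow> real ^ 'n \<Rightarrow> real ^ 'n) \<Rightarrow>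
     (real \<Rightarrow> real \<Rightarrow> real ^ 'n ^ 'n) \<Rightarrow> real \<Rightarrow> real ^ 'n \<Rightarrow> real set \<Rightarrow>
     (real \<Rightarrow> real ^ 'n) \<Rightarrow> bool" where
  "filippov_solution f ft \<Phi> t0 x0 I x \<longleftrightarrow>
     is_interval I \<and> t0 \<in> I \<and> I \<subseteq> {t0..} \<and>
     (\<forall>a b. {a..b} \<subseteq> I \<longrightarrow> abs_continuous_on {a..b} x) \<and>
     x t0 = x0 \<and>
     (AE t in lebesgue. t \<in> I \<longrightarrow>
        (\<exists>v w. v \<in> filippov_reg f t (x t) \<and>
               w \<in> aumann_integral {t0..t} (\<lambda>\<tau>. (*v) (\<Phi> t \<tau>) ` filippov_reg ft \<tau> (x \<tau>)) \<and>
               (x has_vector_derivative v + w) (at t within I)))"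

text \<open>At points with \<open>C *v x = 0\<close> the value of the feedback is \<open>0\<close> since \<open>inverse 0 = 0\<close>;
  these points form a null set, so the regularization does not see this value.\<close>

definition feedback ::
    "real ^ 'm ^ 'n \<Rightarrow> real ^ 'n ^ 'm \<Rightarrow> real ^ 'm ^ 'm \<Rightarrow> real \<Rightarrow> real ^ 'n \<Rightarrow> real ^ 'm" where
  "feedback B C P \<rho> x = - \<rho> *\<^sub>R (matrix_inv (C ** B) *v ((C *v x) /\<^sub>R wnorm P (C *v x)))"

definition closed_loop_solution ::
    "real ^ 'n ^ 'n \<Rightarrow> real ^ 'm ^ 'n \<Rightarrow> real ^ 'm ^ 'n \<Rightarrow> real ^ 'n ^ 'm \<Rightarrow>
     (real \<Rightarrow> real \<Rightarrow> real ^ 'n ^ 'n) \<Rightarrow> (real \<Rightarrow> real ^ 'm) \<Rightarrow> (real \<Rightarrow> real ^ 'n) \<Rightarrow>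
     real ^ 'm ^ 'm \<Rightarrow> real \<Rightarrow> real \<Rightarrow> real ^ 'n \<Rightarrow> real set \<Rightarrow> (real \<Rightarrow> real ^ 'n) \<Rightarrow> bool" where
  "closed_loop_solution A B Bt C \<Phi> \<gamma> p P \<rho> =
     filippov_solution
       (\<lambda>t x. A *v x + B *v (feedback B C P \<rho> x + \<gamma> t) + p t)
       (\<lambda>t x. Bt *v (feedback B C P \<rho> x + \<gamma> t))
       \<Phi>"

end

theory Submission
  imports Defs "HOL-Complex_Analysis.Great_Picard"
begin

text \<open>
  Write \<open>y = C x\<close> for the output and \<open>|.|\<close> for the norm given by \<open>P\<close>. Away from the surface \<open>y = 0\<close> the
  feedback is continuous, so its regularization is single valued. There the output satisfies
  \<open>y' = L y - \<rho> y / |y| + e + C w\<close>, where \<open>e = C (B \<gamma> + p)\<close> and \<open>w\<close> is an element of the memory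
  integral. Every velocity remembered in \<open>w\<close> comes from a control \<open>- \<rho> (C B)\<^sup>-\<^sup>1 q + \<gamma>\<close> with \<open>|q| \<le> 1\<close>,
  whatever selection is made; hence \<open>|C w|\<close> is at most \<open>\<rho> M\<close> plus the integral of \<open>|C \<Phi> Bt \<gamma>|\<close>, and the
  assumption on \<open>\<rho>\<close> becomes \<open>|C w| + |e| \<le> \<rho> - \<delta>\<close> (\<open>control_margin\<close>). As \<open>L\<close> is dissipative for the
  inner product of \<open>P\<close>, the derivative of \<open>|y|\<close> is at most \<open>- \<delta>\<close> (\<open>output_decay\<close>). Since \<open>|y|\<close> is
  absolutely continuous, it reaches \<open>0\<close> no later than \<open>t0 + |y t0| / \<delta>\<close>, and it cannot leave \<open>0\<close>, as it
  would have to decrease from there (\<open>output_vanishes\<close>).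

  Existence rests on the freedom to select the present and the remembered value of the control
  independently of each other. The remembered control is always taken to be the feedback itself, with
  the value \<open>0\<close> on the surface, which is admissible because the regularized feedback is a symmetric
  convex set there. While a trajectory slides on the surface, the memory is therefore a known function of time. The
  present control is then the one that gives \<open>y' = L y\<close>, and \<open>control_margin\<close> is exactly what makes
  it admissible (\<open>sliding_phase\<close>). Away from the surface a trajectory solves an integro-differential
  equation whose right-hand side is continuous in the state. It is solved by delaying the state by a
  small time \<open>d\<close> and letting \<open>d\<close> tend to \<open>0\<close>: the limit solves the equation for as long as it stays at points
  of continuity of the feedback, and so until it meets the surface (\<open>delayed_peano\<close>, \<open>regular_phase\<close>).

  A regular phase followed by a sliding phase continues any trajectory by a length of time that depends
  only on \<open>A\<close> and \<open>L\<close>. Repeating this reaches every time (\<open>trajectory_extend\<close>). A solution on a bounded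
  interval fits into this scheme because its speed grows at most linearly with the state; so it is
  Lipschitz and extends to the closed interval (\<open>solution_lipschitz\<close>, \<open>solution_closure\<close>).

  Two facts about functions of one variable link derivatives that exist almost everywhere to the
  functions themselves: such a derivative bounds the increments of an absolutely continuous function
  (\<open>abs_continuous_on_increment_le\<close>), and an indefinite integral has its integrand as derivative almost
  everywhere (\<open>indefinite_integral_has_vector_derivative_AE\<close>).
\<close>

section \<open>Absolutely continuous functions\<close>

lemma abs_continuous_onE:
  assumes "abs_continuous_on S x" "\<epsilon> > 0"
  obtains \<eta> where "\<eta> > 0"
    "\<And>(n::nat) u v. (\<And>i. i < n \<Longrightarrow> u i \<le> v i \<and> {u i..v i} \<subseteq> S) \<Longrightarrow>
       disjoint_family_on (\<lambda>i. {u i<..<v i}) {..<n} \<Longrightarrow> (\<Sum>i<n. v i - u i) < \<eta> \<Longrightarrow>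
       (\<Sum>i<n. norm (x (v i) - x (u i))) < \<epsilon>"
  using assms(1)[unfolded abs_continuous_on_def, THEN spec, THEN mp, OF assms(2)] by (elim exE conjE) simp

text \<open>A gauge makes \<open>f\<close> almost linear around each point with a derivative. The remaining points form a null
  set, which is covered by an open set so short that absolute continuity makes the total increment over
  the intervals tagged there negligible. A division fine for this gauge then adds up to the claim.\<close>

lemma abs_continuous_on_increment_le:
  fixes f :: "real \<Rightarrow> real"
  assumes ab: "a \<le> b" and ac: "abs_continuous_on {a..b} f"
    and ae: "AE t in lebesgue. t \<in> {a..b} \<longrightarrow>
               (\<exists>D. (f has_real_derivative D) (at t within {a..b}) \<and> D \<le> k)"
  shows "f b - f a \<le> k * (b - a)"
proof -
  define good where "good t \<longleftrightarrow> (\<exists>D. (f has_real_derivative D) (at t within {a..b}) \<and> D \<le> k)" for t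
  define N where "N = {t \<in> {a..b}. \<not> good t}"
  have "negligible N"
  proof -
    obtain N0 where "negligible N0" "{x. \<not> (x \<in> {a..b} \<longrightarrow> good x)} \<subseteq> N0"
      using ae unfolding eventually_ae_filter_negligible good_def by blast
    then show ?thesis
      by (intro negligible_subset[of N0 N]) (auto simp: N_def)
  qed
  then have N0: "N \<in> null_sets lebesgue"
    using negligible_iff_null_sets by blast
  have key: "f b - f a \<le> k * (b - a) + e * (b - a) + 2 * e" if e: "e > 0" for e
  proof -
    obtain \<eta> where "\<eta> > 0" and \<eta>: "\<And>(n::nat) u v. (\<And>i. i < n \<Longrightarrow> u i \<le> v i \<and> {u i..v i} \<subseteq> {a..b}) \<Longrightarrow>
        disjoint_family_on (\<lambda>i. {u i<..<v i}) {..<n} \<Longrightarrow> (\<Sum>i<n. v i - u i) < \<eta> \<Longrightarrow>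
        (\<Sum>i<n. norm (f (v i) - f (u i))) < e"
      using abs_continuous_onE[OF ac e] by blast
    \<comment> \<open>The cover of the exceptional points must be short enough for absolute continuity, and
      also for the length missing from the other intervals to cost at most \<open>e\<close>.\<close>
    define \<eta>' where "\<eta>' = min \<eta> (e / (\<bar>k + e\<bar> + 1))"
    have \<eta>': "\<eta>' > 0" "\<eta>' \<le> \<eta>" "\<bar>k + e\<bar> * \<eta>' \<le> e"
    proof -
      show "\<eta>' > 0" "\<eta>' \<le> \<eta>" using \<open>\<eta> > 0\<close> e by (auto simp: \<eta>'_def)
      have "\<bar>k + e\<bar> * \<eta>' \<le> (\<bar>k + e\<bar> + 1) * (e / (\<bar>k + e\<bar> + 1))"
        using e \<open>\<eta>' > 0\<close> by (intro mult_mono) (auto simp: \<eta>'_def)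
      also have "\<dots> = e" by (simp add: add_nonneg_eq_0_iff)
      finally show "\<bar>k + e\<bar> * \<eta>' \<le> e" .
    qed
    obtain T where T: "open T" "N \<subseteq> T" "T - N \<in> lmeasurable" "emeasure lebesgue (T - N) < ennreal \<eta>'"
      using sets_lebesgue_outer_open[of N \<eta>'] N0 \<eta>' by blast
    have T_lm: "T \<in> lmeasurable" and T_le: "measure lebesgue T < \<eta>'"
    proof -
      have 1: "emeasure lebesgue T = emeasure lebesgue (T - N)"
        using N0 T(1) by (intro emeasure_Diff_null_set[symmetric]) auto
      then show "T \<in> lmeasurable"
        using T by (intro fmeasurableI) (auto intro: order.strict_trans)
      then show "measure lebesgue T < \<eta>'"
        using 1 T(4) \<eta>' by (metis emeasure_eq_measure2 ennreal_less_iff measure_nonneg)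
    qed
    have "\<exists>r>0. t \<in> {a..b} - N \<longrightarrow> (\<forall>u v. a \<le> u \<and> u \<le> t \<and> t \<le> v \<and> v \<le> b \<and> {u..v} \<subseteq> ball t r
              \<longrightarrow> f v - f u \<le> (k + e) * (v - u))" for t
    proof (cases "t \<in> {a..b} - N")
      case True
      then obtain D where D: "(f has_real_derivative D) (at t within {a..b})" "D \<le> k"
        by (auto simp: N_def good_def)
      then obtain r where r: "r > 0"
        "\<And>y. y \<in> {a..b} \<Longrightarrow> norm (y - t) < r \<Longrightarrow> norm (f y - f t - D * (y - t)) \<le> e * norm (y - t)"
        using e unfolding has_field_derivative_def has_derivative_within_alt by metis
      have "f v - f u \<le> (k + e) * (v - u)"
        if uv: "a \<le> u" "u \<le> t" "t \<le> v" "v \<le> b" "{u..v} \<subseteq> ball t r" for u v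
      proof -
        have "u \<in> {u..v}" "v \<in> {u..v}" using uv by auto
        then have "u \<in> ball t r" "v \<in> ball t r"
          using uv(5) by blast+
        then have 1: "norm (u - t) < r" "norm (v - t) < r"
          by (auto simp: dist_norm norm_minus_commute)
        have "f v - f t \<le> D * (v - t) + e * (v - t)"
          using r(2)[of v] 1 uv by auto
        moreover have "f t - f u \<le> D * (t - u) + e * (t - u)"
          using r(2)[of u] 1 uv by (auto simp: algebra_simps)
        ultimately have "f v - f u \<le> (D + e) * (v - u)"
          by (simp add: algebra_simps)
        also have "\<dots> \<le> (k + e) * (v - u)"
          using D(2) uv by (intro mult_right_mono) auto
        finally show ?thesis .
      qed
      then show ?thesis using r(1) by blast
    qed (auto intro: exI[of _ 1])
    then obtain r where r: "\<And>t. r t > 0" and rD: "\<And>t u v. t \<in> {a..b} - N \<Longrightarrow>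
        a \<le> u \<Longrightarrow> u \<le> t \<Longrightarrow> t \<le> v \<Longrightarrow> v \<le> b \<Longrightarrow> {u..v} \<subseteq> ball t (r t) \<Longrightarrow> f v - f u \<le> (k + e) * (v - u)"
      by metis
    define \<gamma> where "\<gamma> t = (if t \<in> N then T else ball t (r t))" for t
    have "gauge \<gamma>"
      using T(1,2) r by (auto simp: gauge_def \<gamma>_def)
    then obtain p where p: "p tagged_division_of {a..b}" and fine: "\<gamma> fine p"
      using fine_division_exists_real by blast
    note pD = tagged_division_ofD[OF p]
    have K: "K = {Inf K..Sup K} \<and> Inf K \<le> t \<and> t \<le> Sup K \<and> a \<le> Inf K \<and> Sup K \<le> b \<and> measure lborel K = Sup K - Inf K"
      if tK: "(t, K) \<in> p" for t K
    proof -
      obtain u v where uv: "K = cbox u v" using pD(4) tK by blast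
      have "t \<in> K" "K \<subseteq> {a..b}" using pD(2,3) tK by blast+
      then show ?thesis using uv by auto
    qed
    define p1 where "p1 = {q \<in> p. fst q \<in> N}"
    define p2 where "p2 = {q \<in> p. fst q \<notin> N}"
    have fin: "finite p" "finite p1" "finite p2" and pU: "p = p1 \<union> p2" "p1 \<inter> p2 = {}"
      using pD(1) by (auto simp: p1_def p2_def)
    let ?len = "\<lambda>q. Sup (snd q) - Inf (snd q :: real set)"
    let ?inc = "\<lambda>q. f (Sup (snd q)) - f (Inf (snd q))"
    obtain h where h: "bij_betw h {..<card p1} p1"
      using ex_bij_betw_nat_finite[OF fin(2)] by (auto simp: atLeast0LessThan)
    define u where "u i = Inf (snd (h i))" for i
    define v where "v i = Sup (snd (h i))" for i
    have hp: "h i \<in> p1" if "i < card p1" for i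
      using h that by (auto simp: bij_betw_def)
    have hK: "snd (h i) = {u i..v i} \<and> u i \<le> v i \<and> {u i..v i} \<subseteq> {a..b} \<and> {u i..v i} \<subseteq> T"
      if "i < card p1" for i
    proof -
      have hh: "(fst (h i), snd (h i)) \<in> p" "fst (h i) \<in> N"
        using hp[OF that] by (auto simp: p1_def)
      then have "snd (h i) \<subseteq> \<gamma> (fst (h i))" 
        using fine unfolding fine_def by blast
      moreover have "\<gamma> (fst (h i)) = T" using hh(2) by (simp add: \<gamma>_def)
      ultimately show ?thesis using K[OF hh(1)] pD(3)[OF hh(1)] unfolding u_def v_def by auto
    qed
    have disj: "disjoint_family_on (\<lambda>i. {u i<..<v i}) {..<card p1}"
      unfolding disjoint_family_on_def
    proof (intro ballI impI)
      fix i j assume ij: "i \<in> {..<card p1}" "j \<in> {..<card p1}" "i \<noteq> j"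
      have "h i \<noteq> h j" using h ij by (auto simp: bij_betw_def inj_on_def)
      moreover have "(fst (h i), snd (h i)) \<in> p" "(fst (h j), snd (h j)) \<in> p"
        using hp ij by (auto simp: p1_def)
      ultimately have "interior (snd (h i)) \<inter> interior (snd (h j)) = {}"
        using pD(5) by (metis prod.collapse)
      then show "{u i<..<v i} \<inter> {u j<..<v j} = {}"
        using hK ij by (auto simp: interior_atLeastAtMost_real)
    qed
    have lenT: "(\<Sum>i<card p1. v i - u i) \<le> measure lebesgue T"
    proof -
      have "(\<Sum>i<card p1. v i - u i) = (\<Sum>i<card p1. measure lebesgue {u i<..<v i})"
        using hK by (intro sum.cong) (auto simp: measure_completion)
      also have "\<dots> = measure lebesgue (\<Union>i<card p1. {u i<..<v i})"
        using disj by (intro measure_finite_Union[symmetric]) (auto dest!: hK)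
      also have "\<dots> \<le> measure lebesgue T"
      proof (rule measure_mono_fmeasurable)
        show "(\<Union>i<card p1. {u i<..<v i}) \<subseteq> T" using hK by force
      qed (use T_lm in auto)
      finally show ?thesis .
    qed
    have sum_h: "(\<Sum>i<card p1. F (h i)) = sum F p1" for F :: "_ \<Rightarrow> real"
      using sum.reindex_bij_betw[OF h] .
    have *: "(\<Sum>i<card p1. norm (f (v i) - f (u i))) < e"
      using hK disj lenT T_le \<eta>'(2) by (intro \<eta>) auto
    have inc1: "sum ?inc p1 \<le> e"
    proof -
      have "sum ?inc p1 \<le> (\<Sum>q\<in>p1. norm (?inc q))"
        by (rule sum_mono) simp
      also have "\<dots> \<le> e"
        using * sum_h[of "\<lambda>q. norm (?inc q)"] by (simp add: u_def v_def)
      finally show ?thesis .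
    qed
    have len1: "0 \<le> sum ?len p1" "sum ?len p1 \<le> \<eta>'"
    proof -
      show "sum ?len p1 \<le> \<eta>'"
        using sum_h[of ?len] lenT T_le by (auto simp: u_def v_def)
      show "0 \<le> sum ?len p1"
        using K by (intro sum_nonneg) (fastforce simp: p1_def)
    qed
    have inc2: "sum ?inc p2 \<le> (k + e) * sum ?len p2"
      unfolding sum_distrib_left
    proof (rule sum_mono)
      fix q assume q: "q \<in> p2"
      then have q': "(fst q, snd q) \<in> p" "fst q \<notin> N" by (auto simp: p2_def)
      moreover have "snd q \<subseteq> ball (fst q) (r (fst q))"
        using fine q' by (fastforce simp: fine_def \<gamma>_def)
      ultimately show "?inc q \<le> (k + e) * ?len q"
        using K[OF q'(1)] by (intro rD[of "fst q"]) auto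
    qed
    have tot: "f b - f a = sum ?inc p1 + sum ?inc p2" "b - a = sum ?len p1 + sum ?len p2"
    proof -
      have "(\<Sum>(x, K)\<in>p. F (Sup K) - F (Inf K)) = F b - F a" for F :: "real \<Rightarrow> real"
        using additive_tagged_division_1[OF ab p] .
      then have *: "sum (\<lambda>q. F (Sup (snd q)) - F (Inf (snd q))) p = F b - F a" for F :: "real \<Rightarrow> real"
        by (simp add: split_def)
      show "f b - f a = sum ?inc p1 + sum ?inc p2"
        using *[of f] sum.union_disjoint[OF fin(2,3) pU(2)] pU(1) by metis
      show "b - a = sum ?len p1 + sum ?len p2"
        using *[of "\<lambda>x. x"] sum.union_disjoint[OF fin(2,3) pU(2)] pU(1) by metis
    qed
    have "f b - f a \<le> e + (k + e) * (b - a - sum ?len p1)"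
      using inc1 inc2 tot by simp
    also have "\<dots> = e + (k + e) * (b - a) - (k + e) * sum ?len p1"
      by (simp add: algebra_simps)
    also have "- (k + e) * sum ?len p1 \<le> \<bar>k + e\<bar> * \<eta>'"
      using len1 by (intro mult_mono) auto
    then have "e + (k + e) * (b - a) - (k + e) * sum ?len p1 \<le> e + (k + e) * (b - a) + e"
      using \<eta>'(3) by (simp add: algebra_simps)
    finally show ?thesis by (simp add: algebra_simps)
  qed
  have "((\<lambda>e. k * (b - a) + e * (b - a) + 2 * e) \<longlongrightarrow> k * (b - a) + 0 * (b - a) + 2 * 0) (at_right 0)"
    by (intro tendsto_intros)
  moreover have "eventually (\<lambda>e. f b - f a \<le> k * (b - a) + e * (b - a) + 2 * e) (at_right 0)"
    using key by (auto simp: eventually_at_right_less intro: eventually_mono[OF eventually_at_right_less])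
  ultimately show ?thesis
    using tendsto_lowerbound[of _ _ "at_right (0::real)"] by fastforce
qed

lemma lipschitz_imp_abs_continuous_on:
  assumes x: "K-lipschitz_on S x"
  shows "abs_continuous_on S x"
  unfolding abs_continuous_on_def
proof (intro allI impI)
  fix \<epsilon> :: real assume "\<epsilon> > 0"
  have K: "0 \<le> K" using x by (rule lipschitz_on_nonneg)
  show "\<exists>\<eta>>0. \<forall>(k::nat) a b. (\<forall>i<k. a i \<le> b i \<and> {a i..b i} \<subseteq> S) \<and>
        disjoint_family_on (\<lambda>i. {a i<..<b i}) {..<k} \<and> (\<Sum>i<k. b i - a i) < \<eta> \<longrightarrow>
        (\<Sum>i<k. norm (x (b i) - x (a i))) < \<epsilon>"
  proof (intro exI[of _ "\<epsilon> / (K + 1)"] conjI allI impI; (elim conjE)?)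
    show "0 < \<epsilon> / (K + 1)" using K \<open>\<epsilon> > 0\<close> by simp
    fix k :: nat and a b :: "nat \<Rightarrow> real"
    assume ab: "\<forall>i<k. a i \<le> b i \<and> {a i..b i} \<subseteq> S" and sum: "(\<Sum>i<k. b i - a i) < \<epsilon> / (K + 1)"
    have "(\<Sum>i<k. norm (x (b i) - x (a i))) \<le> (\<Sum>i<k. (K + 1) * (b i - a i))"
    proof (rule sum_mono)
      fix i assume "i \<in> {..<k}"
      then have "a i \<le> b i" "{a i..b i} \<subseteq> S" using ab by auto
      then have i: "a i \<le> b i" "a i \<in> S" "b i \<in> S" by auto
      have "norm (x (b i) - x (a i)) \<le> K * (b i - a i)"
        using lipschitz_onD[OF x i(3,2)] i(1) by (simp add: dist_norm)
      then show "norm (x (b i) - x (a i)) \<le> (K + 1) * (b i - a i)"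
        using i(1) by (simp add: algebra_simps)
    qed
    also have "\<dots> = (K + 1) * (\<Sum>i<k. b i - a i)" by (simp add: sum_distrib_left)
    also have "\<dots> < \<epsilon>" using sum K by (simp add: field_simps)
    finally show "(\<Sum>i<k. norm (x (b i) - x (a i))) < \<epsilon>" .
  qed
qed

lemma abs_continuous_on_lipschitz_image:
  assumes x: "abs_continuous_on S x" and f: "\<And>s t. s \<in> S \<Longrightarrow> t \<in> S \<Longrightarrow> norm (f s - f t) \<le> c * norm (x s - x t)"
  shows "abs_continuous_on S f"
  unfolding abs_continuous_on_def
proof (intro allI impI)
  fix \<epsilon> :: real assume \<epsilon>: "\<epsilon> > 0"
  define d where "d = \<bar>c\<bar> + 1"
  have d: "d > 0" "c \<le> d" by (auto simp: d_def)
  have "\<epsilon> / d > 0" using \<epsilon> d by simp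
  then obtain \<eta> where "\<eta> > 0" and \<eta>: "\<And>(n::nat) u v. (\<And>i. i < n \<Longrightarrow> u i \<le> v i \<and> {u i..v i} \<subseteq> S) \<Longrightarrow>
       disjoint_family_on (\<lambda>i. {u i<..<v i}) {..<n} \<Longrightarrow> (\<Sum>i<n. v i - u i) < \<eta> \<Longrightarrow>
       (\<Sum>i<n. norm (x (v i) - x (u i))) < \<epsilon> / d"
    using abs_continuous_onE[OF x] by blast
  show "\<exists>\<eta>>0. \<forall>(k::nat) a b. (\<forall>i<k. a i \<le> b i \<and> {a i..b i} \<subseteq> S) \<and>
        disjoint_family_on (\<lambda>i. {a i<..<b i}) {..<k} \<and> (\<Sum>i<k. b i - a i) < \<eta> \<longrightarrow>
        (\<Sum>i<k. norm (f (b i) - f (a i))) < \<epsilon>"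
  proof (intro exI[of _ \<eta>] conjI allI impI)
    fix k :: nat and a b :: "nat \<Rightarrow> real"
    assume asm: "(\<forall>i<k. a i \<le> b i \<and> {a i..b i} \<subseteq> S) \<and>
        disjoint_family_on (\<lambda>i. {a i<..<b i}) {..<k} \<and> (\<Sum>i<k. b i - a i) < \<eta>"
    have "(\<Sum>i<k. norm (f (b i) - f (a i))) \<le> (\<Sum>i<k. d * norm (x (b i) - x (a i)))"
    proof (rule sum_mono)
      fix i assume "i \<in> {..<k}"
      then have "a i \<le> b i" "{a i..b i} \<subseteq> S" using asm by auto
      then have "a i \<in> S" "b i \<in> S" by auto
      then show "norm (f (b i) - f (a i)) \<le> d * norm (x (b i) - x (a i))"
        using f[of "b i" "a i"] mult_right_mono[OF d(2) norm_ge_zero] by (meson order_trans)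
    qed
    also have "\<dots> = d * (\<Sum>i<k. norm (x (b i) - x (a i)))" by (simp add: sum_distrib_left)
    also have "\<dots> < d * (\<epsilon> / d)"
      using asm d(1) by (intro mult_strict_left_mono \<eta>) auto
    finally show "(\<Sum>i<k. norm (f (b i) - f (a i))) < \<epsilon>" using d by simp
  qed fact
qed

lemma abs_continuous_on_imp_continuous_on:
  fixes x :: "real \<Rightarrow> 'a::real_normed_vector"
  assumes x: "abs_continuous_on {a..b} x"
  shows "continuous_on {a..b} x"
  unfolding continuous_on_iff
proof (intro ballI allI impI)
  fix t e :: real assume t: "t \<in> {a..b}" and "0 < e"
  obtain \<eta> where "\<eta> > 0" and \<eta>: "\<And>(n::nat) u v. (\<And>i. i < n \<Longrightarrow> u i \<le> v i \<and> {u i..v i} \<subseteq> {a..b}) \<Longrightarrow>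
       disjoint_family_on (\<lambda>i. {u i<..<v i}) {..<n} \<Longrightarrow> (\<Sum>i<n. v i - u i) < \<eta> \<Longrightarrow>
       (\<Sum>i<n. norm (x (v i) - x (u i))) < e"
    using abs_continuous_onE[OF x \<open>0 < e\<close>] by blast
  have "dist (x s) (x t) < e" if "s \<in> {a..b}" "dist s t < \<eta>" for s
  proof -
    have "(\<Sum>i<1::nat. norm (x (max s t) - x (min s t))) < e"
      using that t by (intro \<eta>) (auto simp: disjoint_family_on_def dist_real_def)
    then show ?thesis by (cases "s \<le> t") (auto simp: dist_norm norm_minus_commute min_def max_def)
  qed
  then show "\<exists>d>0. \<forall>s\<in>{a..b}. dist s t < d \<longrightarrow> dist (x s) (x t) < e"
    using \<open>\<eta> > 0\<close> by blast
qed

lemma AE_lebesgue_neq: "AE t in lebesgue. t \<noteq> (a :: real)"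
  unfolding AE_completion_iff by (rule AE_lborel_singleton)

text \<open>Projecting on the direction of the increment \<open>x b - x a\<close> reduces this to real functions.\<close>

lemma abs_continuous_norm_increment_le:
  fixes x :: "real \<Rightarrow> 'a::euclidean_space"
  assumes ab: "a \<le> b" and ac: "abs_continuous_on {a..b} x"
    and ae: "AE t in lebesgue. t \<in> {a<..<b} \<longrightarrow> (\<exists>D. (x has_vector_derivative D) (at t) \<and> norm D \<le> k)"
  shows "norm (x b - x a) \<le> k * (b - a)"
proof -
  \<comment> \<open>If \<open>x b = x a\<close>, then \<open>e = 0\<close> and the claim below is trivial.\<close>
  define e where "e = sgn (x b - x a)"
  have e: "norm e \<le> 1" by (simp add: e_def norm_sgn)
  have le: "e \<bullet> y \<le> norm y" for y
    using norm_cauchy_schwarz[of e y] mult_right_mono[OF e norm_ge_zero[of y]] by simp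
  have "e \<bullet> x b - e \<bullet> x a \<le> k * (b - a)"
  proof (rule abs_continuous_on_increment_le[OF ab])
    show "abs_continuous_on {a..b} (\<lambda>t. e \<bullet> x t)"
    proof (rule abs_continuous_on_lipschitz_image[OF ac, where c = 1])
      show "norm (e \<bullet> x s - e \<bullet> x t) \<le> 1 * norm (x s - x t)" for s t
        using Cauchy_Schwarz_ineq2[of e "x s - x t"] mult_right_mono[OF e norm_ge_zero[of "x s - x t"]]
        by (simp add: inner_diff_right)
    qed
    have "AE t in lebesgue. t \<noteq> a \<and> t \<noteq> b"
      using AE_lebesgue_neq[of a] AE_lebesgue_neq[of b] by eventually_elim simp
    with ae show "AE t in lebesgue. t \<in> {a..b} \<longrightarrow>
        (\<exists>D. ((\<lambda>t. e \<bullet> x t) has_real_derivative D) (at t within {a..b}) \<and> D \<le> k)"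
    proof eventually_elim
      case (elim t)
      show ?case
      proof
        assume "t \<in> {a..b}"
        then obtain D where D: "(x has_vector_derivative D) (at t)" "norm D \<le> k" using elim by auto
        have "((\<lambda>t. e \<bullet> x t) has_vector_derivative e \<bullet> D) (at t within {a..b})"
          using bounded_linear.has_vector_derivative[OF bounded_linear_inner_right has_vector_derivative_at_within[OF D(1)]] .
        then show "\<exists>D. ((\<lambda>t. e \<bullet> x t) has_real_derivative D) (at t within {a..b}) \<and> D \<le> k"
          using le[of D] D(2) by (auto simp: has_real_derivative_iff_has_vector_derivative)
      qed
    qed
  qed
  moreover have "e \<bullet> (x b - x a) = norm (x b - x a)"
    by (cases "x b = x a") (auto simp: e_def sgn_div_norm dot_square_norm power2_eq_square)
  ultimately show ?thesis by (simp add: inner_diff_right)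
qed

section \<open>Differentiation of indefinite integrals\<close>

text \<open>By Henstock's lemma the errors \<open>|K| g x - \<integral>\<^sub>K g\<close> of a fine enough partial division of \<open>{a..b}\<close>
  have an arbitrarily small sum. A point at which the difference quotients do not converge to \<open>g\<close> is an
  endpoint of arbitrarily short intervals whose error is at least \<open>e\<close> times their length. Vitali's
  theorem selects disjoint intervals among these that cover almost all such points, and Henstock's lemma
  makes their total length small.\<close>

lemma indefinite_integral_has_vector_derivative_AE:
  fixes g :: "real \<Rightarrow> 'a::euclidean_space"
  assumes g: "g integrable_on {a..b}"
  shows "AE t in lebesgue. t \<in> {a<..<b} \<longrightarrow>
           ((\<lambda>u. integral {a..u} g) has_vector_derivative g t) (at t)"
proof -
  define F where "F u = integral {a..u} g" for u
  define E where "E e = {x \<in> {a<..<b}. \<forall>d>0. \<exists>y\<in>{a..b}. y \<noteq> x \<and> \<bar>y - x\<bar> < d \<and>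
      norm (F y - F x - (y - x) *\<^sub>R g x) > e * \<bar>y - x\<bar>}" for e
  have neg: "negligible (E e)" if e: "e > 0" for e
    unfolding negligible_outer_le
  proof (intro allI impI)
    fix \<eta> :: real assume \<eta>: "\<eta> > 0"
    obtain \<gamma> where \<gamma>: "gauge \<gamma>" and hen: "\<And>p. p tagged_partial_division_of (cbox a b) \<Longrightarrow> \<gamma> fine p \<Longrightarrow>
        (\<Sum>(x,k)\<in>p. norm (measure lborel k *\<^sub>R g x - integral k g)) < e * \<eta>"
      using Henstock_lemma[of g a b "e * \<eta>"] g e \<eta> by auto
    \<comment> \<open>An index \<open>(x, y)\<close> stands for the interval between \<open>x\<close> and \<open>y\<close>, written as a ball around its midpoint.\<close>
    define I where "I = {(x, y). x \<in> E e \<and> y \<in> {a..b} \<and> y \<noteq> x \<and> {min x y..max x y} \<subseteq> \<gamma> x \<and>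
       norm (F y - F x - (y - x) *\<^sub>R g x) > e * \<bar>y - x\<bar>}"
    define cen where "cen = (\<lambda>(x, y). (x + y) / 2 :: real)"
    define rad where "rad = (\<lambda>(x, y). \<bar>y - x\<bar> / 2 :: real)"
    define J where "J i = {min (fst i) (snd i)..max (fst i) (snd i :: real)}" for i
    have J: "cball (cen i) (rad i) = J i" for i
      by (auto simp: J_def cen_def rad_def cball_eq_atLeastAtMost min_def max_def field_simps split: prod.splits)
    have rad: "0 < rad i" if "i \<in> I" for i
      using that by (auto simp: I_def rad_def)
    have cover: "\<exists>i. i \<in> I \<and> x \<in> cball (cen i) (rad i) \<and> rad i < d" if x: "x \<in> E e" and d: "d > 0" for x d
    proof -
      obtain \<epsilon> where \<epsilon>: "\<epsilon> > 0" "ball x \<epsilon> \<subseteq> \<gamma> x"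
        using \<gamma> open_contains_ball unfolding gauge_def by metis
      obtain y where y: "y \<in> {a..b}" "y \<noteq> x" "\<bar>y - x\<bar> < min d \<epsilon>" "norm (F y - F x - (y - x) *\<^sub>R g x) > e * \<bar>y - x\<bar>"
        using x d \<epsilon>(1) unfolding E_def by (smt (verit) mem_Collect_eq)
      have "{min x y..max x y} \<subseteq> ball x \<epsilon>"
        using y by (auto simp: dist_real_def)
      then have "(x, y) \<in> I" using x y \<epsilon> by (auto simp: I_def)
      moreover have "x \<in> J (x, y)" "rad (x, y) < d"
        using y d by (auto simp: J_def rad_def)
      ultimately show ?thesis using J by blast
    qed
    obtain C where C: "countable C" "C \<subseteq> I"
        "pairwise (\<lambda>i j. disjnt (cball (cen i) (rad i)) (cball (cen j) (rad j))) C"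
        "negligible (E e - (\<Union>i\<in>C. cball (cen i) (rad i)))"
      using Vitali_covering_theorem_cballs[of I rad "E e" cen] rad cover by blast
    have fin: "measure lebesgue (\<Union>(J ` D)) \<le> \<eta>" if D: "D \<subseteq> C" "finite D" for D
    proof -
      define p where "p = (\<lambda>i. (fst i, J i)) ` D"
      have DI: "\<And>i. i \<in> D \<Longrightarrow> i \<in> I" using D C by blast
      have Jab: "J i \<subseteq> cbox a b" "fst i \<in> J i" if "i \<in> D" for i
        using DI[OF that] by (auto simp: I_def J_def E_def)
      have dis: "disjnt (J i) (J j)" if "i \<in> D" "j \<in> D" "i \<noteq> j" for i j
        using C(3) D that unfolding J pairwise_def by blast
      have inj: "inj_on (\<lambda>i. (fst i, J i)) D"
      proof (rule inj_onI)
        fix i j assume "i \<in> D" "j \<in> D" "(fst i, J i) = (fst j, J j)"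
        then show "i = j" using dis[of i j] Jab(2)[of i] by (auto simp: disjnt_def)
      qed
      have p: "p tagged_partial_division_of cbox a b"
        unfolding tagged_partial_division_of_def
      proof (intro conjI allI impI)
        show "finite p" using D by (simp add: p_def)
        fix x K assume "(x, K) \<in> p"
        then show "x \<in> K" "K \<subseteq> cbox a b" "\<exists>a b. K = cbox a b"
          using Jab by (auto simp: p_def J_def simp flip: box_real)
      next
        fix x1 K1 x2 K2 assume "(x1, K1) \<in> p \<and> (x2, K2) \<in> p \<and> (x1, K1) \<noteq> (x2, K2)"
        then obtain i j where ij: "i \<in> D" "j \<in> D" "K1 = J i" "K2 = J j" "i \<noteq> j"
          by (auto simp: p_def)
        then have "J i \<inter> J j = {}" using dis by (auto simp: disjnt_def)
        then show "interior K1 \<inter> interior K2 = {}"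
          using ij interior_subset by blast
      qed
      have fine: "\<gamma> fine p"
      proof (rule fineI)
        fix x K assume "(x, K) \<in> p"
        then obtain i where "i \<in> D" "x = fst i" "K = J i" by (auto simp: p_def)
        then show "K \<subseteq> \<gamma> x"
          using DI[of i] unfolding I_def J_def by (cases i) simp
      qed
      have term_le: "e * measure lborel (J i) \<le> norm (measure lborel (J i) *\<^sub>R g (fst i) - integral (J i) g)"
        if "i \<in> D" for i
      proof -
        obtain x y where i: "i = (x, y)" by (cases i)
        have xy: "x \<in> {a<..<b}" "y \<in> {a..b}" "norm (F y - F x - (y - x) *\<^sub>R g x) > e * \<bar>y - x\<bar>"
          using DI[OF that] by (auto simp: i I_def E_def)
        have int: "integral {u..v} g = F v - F u" if "a \<le> u" "u \<le> v" "v \<le> b" for u v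
        proof -
          have "g integrable_on {a..v}"
            using that g by (auto intro: integrable_on_subinterval)
          then show ?thesis
            using Henstock_Kurzweil_Integration.integral_combine[of a u v g] that
            by (simp add: F_def algebra_simps)
        qed
        show ?thesis
        proof (cases "x \<le> y")
          case True
          then have "J i = {x..y}" by (auto simp: J_def i)
          moreover have "integral {x..y} g = F y - F x" using int[of x y] xy True by auto
          ultimately show ?thesis using xy(3) True by (simp add: i norm_minus_commute)
        next
          case False
          then have Ji: "J i = {y..x}" by (auto simp: J_def i)
          have in1: "integral {y..x} g = F x - F y" using int[of y x] xy False by auto
          have eq: "(x - y) *\<^sub>R g x - (F x - F y) = F y - F x - (y - x) *\<^sub>R g x"
            by (simp add: algebra_simps)
          have m: "measure lborel (J i) = x - y" using False Ji by simp
          have n: "norm ((x - y) *\<^sub>R g x - integral (J (x, y)) g) = norm (F y - F x - (y - x) *\<^sub>R g x)"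
            by (simp only: Ji[unfolded i] in1 eq)
          show ?thesis using xy(3) False n unfolding m unfolding i by simp
        qed
      qed
      have "e * (\<Sum>i\<in>D. measure lborel (J i)) \<le> (\<Sum>i\<in>D. norm (measure lborel (J i) *\<^sub>R g (fst i) - integral (J i) g))"
        unfolding sum_distrib_left using term_le by (rule sum_mono)
      also have "\<dots> = (\<Sum>(x,k)\<in>p. norm (measure lborel k *\<^sub>R g x - integral k g))"
        unfolding p_def by (subst sum.reindex[OF inj]) simp
      also have "\<dots> < e * \<eta>" using hen[OF p fine] .
      finally have "(\<Sum>i\<in>D. measure lborel (J i)) \<le> \<eta>" using e by simp
      moreover have "measure lebesgue (\<Union>(J ` D)) \<le> (\<Sum>i\<in>D. measure lebesgue (J i))"
        using D by (intro measure_UNION_le) (auto simp: J_def)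
      ultimately show ?thesis by (simp add: measure_completion J_def)
    qed
    have lm: "(\<Union>i\<in>C. J i) \<in> lmeasurable \<and> measure lebesgue (\<Union>i\<in>C. J i) \<le> \<eta>"
    proof -
      have "\<Union>D' \<in> lmeasurable \<and> measure lebesgue (\<Union>D') \<le> \<eta>" if "D' = J ` C" for D'
      proof -
        have "measure lebesgue (\<Union>\<F>) \<le> \<eta>" if "\<F> \<subseteq> J ` C" "finite \<F>" for \<F>
          using fin that finite_subset_image by metis
        moreover have "\<And>d. d \<in> J ` C \<Longrightarrow> d \<in> lmeasurable" by (auto simp: J_def)
        ultimately show ?thesis
          using fmeasurable_Union_bound[of "J ` C" lebesgue \<eta>] measure_Union_bound[of "J ` C" lebesgue \<eta>]
            C(1) that by auto
      qed
      then show ?thesis by blast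
    qed
    show "\<exists>T. E e \<subseteq> T \<and> T \<in> lmeasurable \<and> measure lebesgue T \<le> \<eta>"
    proof (intro exI conjI)
      let ?Z = "E e - (\<Union>i\<in>C. J i)"
      have Z: "negligible ?Z" using C(4) J by simp
      show "E e \<subseteq> (\<Union>i\<in>C. J i) \<union> ?Z" by auto
      show "(\<Union>i\<in>C. J i) \<union> ?Z \<in> lmeasurable"
        using lm Z negligible_imp_measurable by blast
      show "measure lebesgue ((\<Union>i\<in>C. J i) \<union> ?Z) \<le> \<eta>"
        using lm Z measure_Un_null_set[of "\<Union>i\<in>C. J i" lebesgue ?Z]
        unfolding negligible_iff_null_sets by (metis fmeasurableD)
    qed
  qed
  have "negligible (\<Union>n. E (1 / real (Suc n)))"
    using neg by (intro negligible_Union_nat) simp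
  moreover have "(F has_vector_derivative g t) (at t)"
    if t: "t \<in> {a<..<b}" "t \<notin> (\<Union>n. E (1 / real (Suc n)))" for t
    unfolding has_vector_derivative_def has_derivative_within_alt
  proof (intro conjI allI impI)
    show "bounded_linear (\<lambda>h. h *\<^sub>R g t)" by (rule bounded_linear_scaleR_left)
    fix e :: real assume e: "e > 0"
    then obtain n where n: "1 / real (Suc n) < e"
      by (metis inverse_eq_divide reals_Archimedean)
    have "t \<notin> E (1 / real (Suc n))" using t by blast
    then obtain d where d: "d > 0" "\<And>y. y \<in> {a..b} \<Longrightarrow> y \<noteq> t \<Longrightarrow> \<bar>y - t\<bar> < d \<Longrightarrow>
        norm (F y - F t - (y - t) *\<^sub>R g t) \<le> 1 / real (Suc n) * \<bar>y - t\<bar>"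
      using t(1) unfolding E_def by (smt (verit) mem_Collect_eq)
    have "norm (F y - F t - (y - t) *\<^sub>R g t) \<le> e * norm (y - t)"
      if "norm (y - t) < min d (min (t - a) (b - t))" for y
    proof (cases "y = t")
      case False
      have "norm (F y - F t - (y - t) *\<^sub>R g t) \<le> 1 / real (Suc n) * \<bar>y - t\<bar>"
        using that False by (intro d(2)) auto
      also have "\<dots> \<le> e * \<bar>y - t\<bar>" using n by (intro mult_right_mono) auto
      finally show ?thesis by simp
    qed simp
    moreover have "min d (min (t - a) (b - t)) > 0" using d t by auto
    ultimately show "\<exists>d>0. \<forall>y\<in>UNIV. norm (y - t) < d \<longrightarrow>
        norm (F y - F t - (y - t) *\<^sub>R g t) \<le> e * norm (y - t)" by blast
  qed
  ultimately show ?thesis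
    unfolding eventually_ae_filter_negligible F_def by blast
qed

section \<open>Volterra equations with a discontinuous right-hand side\<close>

lemma set_integrable_bounded_interval:
  fixes g :: "real \<Rightarrow> 'a::euclidean_space"
  assumes [measurable]: "g \<in> borel_measurable borel" and bd: "\<And>s. s \<in> {u..v} \<Longrightarrow> norm (g s) \<le> c"
  shows "set_integrable lborel {u..v} g"
  unfolding set_integrable_def
proof (rule Bochner_Integration.integrable_bound)
  show "integrable lborel (\<lambda>s. indicator {u..v} s *\<^sub>R c)"
    by (auto intro!: integrable_mult_left integrable_real_indicator emeasure_lborel_Icc_eq[THEN eq_refl, THEN order.strict_trans1])
qed (use bd in \<open>auto simp: indicator_def intro!: AE_I2 order_trans[OF bd]\<close>)

lemma norm_set_integral_interval_le:
  fixes g :: "real \<Rightarrow> 'a::euclidean_space"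
  assumes uv: "u \<le> v" and m: "g \<in> borel_measurable borel" and bd: "\<And>s. s \<in> {u..v} \<Longrightarrow> norm (g s) \<le> c"
  shows "norm (LINT s:{u..v}|lborel. g s) \<le> c * (v - u)"
proof -
  have "norm (LINT s:{u..v}|lborel. g s) \<le> (LINT s:{u..v}|lborel. norm (g s))"
    using set_integrable_bounded_interval[OF m bd]
    by (intro set_integral_norm_bound) auto
  also have "\<dots> \<le> (LINT s:{u..v}|lborel. c)"
    using bd set_integrable_bounded_interval[OF m bd] set_integrable_bounded_interval[of "\<lambda>_. c" u v c]
    by (intro set_integral_mono) (auto intro: set_integrable_norm set_integrable_bounded_interval)
  also have "\<dots> = c * (v - u)"
    using uv by (simp add: set_lebesgue_integral_def)
  finally show ?thesis .
qed

lemma set_integral_interval_combine: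
  fixes g :: "real \<Rightarrow> 'a::euclidean_space"
  assumes "u \<le> v" "v \<le> w" and int: "set_integrable lborel {u..w} g"
  shows "(LINT s:{u..w}|lborel. g s) = (LINT s:{u..v}|lborel. g s) + (LINT s:{v..w}|lborel. g s)"
proof -
  have i: "set_integrable lborel {u..v} g" "set_integrable lborel {v..w} g"
    using assms by (auto intro: set_integrable_subset[OF int])
  show ?thesis
    unfolding set_borel_integral_eq_integral(2)[OF i(1)] set_borel_integral_eq_integral(2)[OF i(2)]
      set_borel_integral_eq_integral(2)[OF int]
    using Henstock_Kurzweil_Integration.integral_combine[OF assms(1,2) set_borel_integral_eq_integral(1)[OF int]]
    by simp
qed

text \<open>Turning the moving endpoint into a factor of the integrand makes this an instance of the measurability
  part of Fubini's theorem.\<close>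

lemma borel_measurable_volterra_integral:
  fixes k :: "real \<Rightarrow> real \<Rightarrow> 'a::euclidean_space"
  assumes "case_prod k \<in> borel_measurable (borel \<Otimes>\<^sub>M borel)"
  shows "(\<lambda>s. LINT \<tau>:{a..s}|lborel. k s \<tau>) \<in> borel_measurable borel"
proof -
  have [measurable]: "case_prod k \<in> borel_measurable (borel \<Otimes>\<^sub>M lborel)"
    using assms by (simp cong: measurable_cong_sets)
  have "(\<lambda>s. \<integral>\<tau>. (if a \<le> \<tau> \<and> \<tau> \<le> s then k s \<tau> else 0) \<partial>lborel) \<in> borel_measurable borel"
  proof (rule lborel.borel_measurable_lebesgue_integral)
    have [measurable]: "{p \<in> space (borel \<Otimes>\<^sub>M lborel). a \<le> snd p \<and> snd p \<le> (fst p :: real)} \<in> sets (borel \<Otimes>\<^sub>M lborel)"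
      by measurable
    show "(\<lambda>(s, \<tau>). if a \<le> \<tau> \<and> \<tau> \<le> s then k s \<tau> else 0) \<in> borel_measurable (borel \<Otimes>\<^sub>M lborel)"
      unfolding split_def by measurable
  qed
  moreover have "(LINT \<tau>:{a..s}|lborel. k s \<tau>) = (\<integral>\<tau>. (if a \<le> \<tau> \<and> \<tau> \<le> s then k s \<tau> else 0) \<partial>lborel)" for s
    unfolding set_lebesgue_integral_def by (intro Bochner_Integration.integral_cong) (auto simp: indicator_def)
  ultimately show ?thesis by simp
qed

text \<open>The equation \<open>x' = f s (x s) + \<integral> k s \<tau> (x \<tau>) d\<tau>\<close>, \<open>\<tau>\<close> from \<open>a\<close> to \<open>s\<close>, whose coefficients are merely Borel in
  the state. The condition \<open>short\<close> gives an invariant ball without Gronwall's inequality, and the length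
  \<open>b - a\<close> it allows depends on the slope \<open>\<alpha>\<close> only, not on \<open>c\<close> or the initial value; this uniformity is
  what later lets trajectories be continued up to any time.\<close>

locale volterra =
  fixes f :: "real \<Rightarrow> 'v::euclidean_space \<Rightarrow> 'v" and k :: "real \<Rightarrow> real \<Rightarrow> 'v \<Rightarrow> 'v"
    and a b \<alpha> c :: real and x0 :: 'v
  assumes ab: "a \<le> b"
    and f_borel: "case_prod f \<in> borel_measurable (borel \<Otimes>\<^sub>M borel)"
    and k_borel: "(\<lambda>(s, \<tau>, v). k s \<tau> v) \<in> borel_measurable (borel \<Otimes>\<^sub>M borel \<Otimes>\<^sub>M borel)"
    and f_growth: "\<And>s v. norm (f s v) \<le> \<alpha> * norm v + c"
    and k_bound: "\<And>s \<tau> v. norm (k s \<tau> v) \<le> c"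
    and \<alpha>_nonneg: "0 \<le> \<alpha>" and short: "\<alpha> * (b - a) \<le> 1 / 2"
begin

lemma c_nonneg: "0 \<le> c"
  using order_trans[OF norm_ge_zero k_bound] .

text \<open>Here \<open>d\<close> is a delay; \<open>d = 0\<close> gives the equation itself.\<close>

definition field :: "real \<Rightarrow> (real \<Rightarrow> 'v) \<Rightarrow> real \<Rightarrow> 'v" where
  "field d w s = f s (w (s - d)) + (LINT \<tau>:{a..s}|lborel. k s \<tau> (w (\<tau> - d)))"

text \<open>The factor \<open>2\<close> absorbs the term \<open>\<alpha> * (b - a)\<close> times the radius, which \<open>short\<close> bounds by half the radius.\<close>

definition radius :: real where
  "radius = 2 * (norm x0 + (c + c * (b - a)) * (b - a))"

definition speed :: real where
  "speed = \<alpha> * radius + c + c * (b - a)"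

lemma radius_nonneg: "0 \<le> radius" and speed_nonneg: "0 \<le> speed"
proof -
  show *: "0 \<le> radius" using ab c_nonneg by (auto simp: radius_def)
  then show "0 \<le> speed" using ab c_nonneg \<alpha>_nonneg by (auto simp: speed_def)
qed

lemma speed_radius: "norm x0 + speed * (b - a) \<le> radius"
proof -
  have "\<alpha> * (b - a) * radius \<le> 1 / 2 * radius"
    using short radius_nonneg by (intro mult_right_mono) auto
  then have "norm x0 + speed * (b - a) \<le> norm x0 + radius / 2 + (c + c * (b - a)) * (b - a)"
    by (simp add: speed_def algebra_simps)
  also have "\<dots> = radius" by (simp add: radius_def)
  finally show ?thesis .
qed

lemma memory_borel:
  assumes [measurable]: "w \<in> borel_measurable borel"
  shows "(\<lambda>\<tau>. k s \<tau> (w (\<tau> - d))) \<in> borel_measurable borel"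
  using measurable_compose[OF _ k_borel, of "\<lambda>\<tau>. (s, \<tau>, w (\<tau> - d))" borel] by simp

lemma field_borel:
  assumes [measurable]: "w \<in> borel_measurable borel"
  shows "field d w \<in> borel_measurable borel"
proof -
  have [measurable]: "(\<lambda>s. f s (w (s - d))) \<in> borel_measurable borel"
    using measurable_compose[OF _ f_borel, of "\<lambda>s. (s, w (s - d))" borel] by simp
  have "(\<lambda>p. k (fst p) (snd p) (w (snd p - d))) \<in> borel_measurable (borel \<Otimes>\<^sub>M borel)"
    using measurable_compose[OF _ k_borel, of "\<lambda>p. (fst p, snd p, w (snd p - d))" "borel \<Otimes>\<^sub>M borel"] by simp
  then have [measurable]: "(\<lambda>s. LINT \<tau>:{a..s}|lborel. k s \<tau> (w (\<tau> - d))) \<in> borel_measurable borel"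
    by (intro borel_measurable_volterra_integral) (simp add: split_def)
  show ?thesis
    unfolding field_def[abs_def] by measurable
qed

lemma field_bound:
  assumes w: "w \<in> borel_measurable borel" "\<And>t. norm (w t) \<le> radius" and s: "s \<in> {a..b}"
  shows "norm (field d w s) \<le> speed"
proof -
  have "norm (f s (w (s - d))) \<le> \<alpha> * radius + c"
    using f_growth[of s "w (s - d)"] mult_left_mono[OF w(2)[of "s - d"] \<alpha>_nonneg] by linarith
  moreover have "norm (LINT \<tau>:{a..s}|lborel. k s \<tau> (w (\<tau> - d))) \<le> c * (s - a)"
    using s k_bound memory_borel[OF w(1)] by (intro norm_set_integral_interval_le) auto
  moreover have "c * (s - a) \<le> c * (b - a)"
    using s c_nonneg by (intro mult_left_mono) auto
  ultimately show ?thesis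
    using norm_triangle_ineq[of "f s (w (s - d))" "LINT \<tau>:{a..s}|lborel. k s \<tau> (w (\<tau> - d))"]
    unfolding field_def speed_def by linarith
qed

text \<open>The integration range is empty before \<open>a\<close> and stops at \<open>b\<close>. The iterates are thus constant outside
  \<open>{a..b}\<close>, and a delayed argument that leaves the interval is harmless.\<close>

definition step :: "real \<Rightarrow> (real \<Rightarrow> 'v) \<Rightarrow> real \<Rightarrow> 'v" where
  "step d w t = x0 + (LINT s:{a..min t b}|lborel. field d w s)"

lemma step_before: "t \<le> a \<Longrightarrow> step d w t = x0"
proof -
  assume "t \<le> a"
  have "AE s in lborel. indicator {a..min t b} s *\<^sub>R field d w s = 0"
    using AE_lborel_singleton[of a] 
  proof eventually_elim
    case (elim s)
    then have "s \<notin> {a..min t b}" using \<open>t \<le> a\<close> by (meson antisym atLeastAtMost_iff min.boundedE order_trans)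
    then show ?case by (simp only: indicator_simps(2)[OF \<open>s \<notin> {a..min t b}\<close>] scaleR_zero_left)
  qed
  then show ?thesis
    unfolding step_def set_lebesgue_integral_def by (simp only: integral_eq_zero_AE add_0_right)
qed

lemma step_after: "step d w t = step d w (max a (min t b))"
proof (cases "t \<le> a")
  case True
  moreover have "max a (min t b) = a" using True by simp
  ultimately show ?thesis by (simp add: step_before)
next
  case False
  then have "max a (min t b) = min t b" using ab by simp
  then show ?thesis by (simp add: step_def)
qed

lemma step_lipschitz:
  assumes w: "w \<in> borel_measurable borel" "\<And>t. norm (w t) \<le> radius"
  shows "norm (step d w t - step d w t') \<le> speed * \<bar>t - t'\<bar>"
proof -
  have *: "norm (step d w t' - step d w t) \<le> speed * (t' - t)" if "a \<le> t" "t \<le> t'" "t' \<le> b" for t t'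
  proof -
    have "set_integrable lborel {a..t'} (field d w)"
      using that by (intro set_integrable_bounded_interval[where c = speed] field_borel w field_bound) auto
    then have "step d w t' - step d w t = (LINT s:{t..t'}|lborel. field d w s)"
      using set_integral_interval_combine[of a t t' "field d w"] that by (simp add: step_def min_def)
    also have "norm \<dots> \<le> speed * (t' - t)"
      using that by (intro norm_set_integral_interval_le field_borel w field_bound) auto
    finally show ?thesis .
  qed
  define cl where "cl t = max a (min t b)" for t
  have cl: "a \<le> cl t" "cl t \<le> b" "\<bar>cl t - cl t'\<bar> \<le> \<bar>t - t'\<bar>" for t t'
    using ab by (auto simp: cl_def)
  have "norm (step d w (cl t) - step d w (cl t')) \<le> speed * \<bar>cl t - cl t'\<bar>"
    using *[of "cl t" "cl t'"] *[of "cl t'" "cl t"] cl by (cases "cl t \<le> cl t'") (auto simp: norm_minus_commute)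
  also have "\<dots> \<le> speed * \<bar>t - t'\<bar>"
    using cl speed_nonneg by (intro mult_left_mono) auto
  finally show ?thesis using step_after[of d w] by (metis cl_def)
qed

lemma step_bound:
  assumes w: "w \<in> borel_measurable borel" "\<And>t. norm (w t) \<le> radius"
  shows "norm (step d w t) \<le> radius"
proof -
  have "norm (step d w (max a (min t b)) - step d w a) \<le> speed * \<bar>max a (min t b) - a\<bar>"
    using step_lipschitz[OF w] .
  also have "\<dots> \<le> speed * (b - a)"
    using speed_nonneg ab by (intro mult_left_mono) auto
  finally have "norm (step d w t - x0) \<le> speed * (b - a)"
    using step_after[of d w t] step_before[of a d w] by simp
  then show ?thesis using speed_radius norm_triangle_sub[of "step d w t" x0] by linarith
qed

primrec iterate :: "real \<Rightarrow> nat \<Rightarrow> real \<Rightarrow> 'v" where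
  "iterate d 0 = (\<lambda>_. x0)"
| "iterate d (Suc n) = step d (iterate d n)"

lemma lipschitz_borel:
  fixes w :: "real \<Rightarrow> 'v"
  assumes "\<And>t t'. norm (w t - w t') \<le> K * \<bar>t - t'\<bar>"
  shows "w \<in> borel_measurable borel"
proof (rule borel_measurable_continuous_onI)
  have "0 \<le> K" using order_trans[OF norm_ge_zero assms[of 1 0]] by simp
  then have "K-lipschitz_on UNIV w"
    using assms by (intro lipschitz_onI) (auto simp: dist_norm)
  then show "continuous_on UNIV w" by (rule lipschitz_on_continuous_on)
qed

lemma iterate_props:
  "(\<forall>t t'. norm (iterate d n t - iterate d n t') \<le> speed * \<bar>t - t'\<bar>) \<and> (\<forall>t. norm (iterate d n t) \<le> radius)
    \<and> (\<forall>t. iterate d n t = iterate d n (max a (min t b))) \<and> iterate d n a = x0"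
proof (induction n)
  case 0
  have "norm x0 \<le> radius" using speed_radius speed_nonneg ab
    by (smt (verit) mult_nonneg_nonneg)
  then show ?case using speed_nonneg by auto
next
  case (Suc n)
  then have w: "iterate d n \<in> borel_measurable borel" "\<And>t. norm (iterate d n t) \<le> radius"
    using lipschitz_borel by blast+
  show ?case
    unfolding iterate.simps
    by (intro conjI allI; (rule step_lipschitz[OF w] | rule step_bound[OF w] | rule step_after | rule step_before[OF order_refl]))
qed

text \<open>With a delay \<open>d\<close> the new value at \<open>t\<close> depends on old values up to \<open>t - d\<close> only. Each iteration thus
  settles a further interval of length \<open>d\<close>, and finitely many of them solve the delayed equation exactly.\<close>

lemma iterate_stable:
  assumes "t \<le> a + real n * d"
  shows "iterate d (Suc n) t = iterate d n t"
  using assms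
proof (induction n arbitrary: t)
  case 0
  then show ?case using step_before by simp
next
  case (Suc n)
  have eq: "iterate d (Suc n) (s - d) = iterate d n (s - d)" if "s \<le> t" for s
    using that Suc.prems by (intro Suc.IH) (auto simp: algebra_simps)
  have "field d (iterate d (Suc n)) s = field d (iterate d n) s" if "s \<le> t" for s
    using that eq unfolding field_def
    by (intro arg_cong2[where f = "(+)"] set_lebesgue_integral_cong) auto
  then show ?case
    unfolding iterate.simps(2)[of _ "Suc n"] iterate.simps(2)[of _ n] step_def[of _ "step d (iterate d n)"]
      step_def[of _ "iterate d n" t]
    by (intro arg_cong2[where f = "(+)"] set_lebesgue_integral_cong) auto
qed

text \<open>The solutions of the delayed equations are equibounded and equi-Lipschitz, so a subsequence converges
  uniformly to some \<open>X\<close>. Where \<open>f\<close> and \<open>k\<close> are continuous at \<open>X\<close>, the right-hand sides converge as well and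
  dominated convergence passes to the limit in the integral equation. Continuity has to be assumed only
  along \<open>X\<close> and only up to a time \<open>T\<close> that may be chosen once \<open>X\<close> is known: in the application \<open>T\<close> is
  the time at which \<open>X\<close> first meets the surface where the feedback is discontinuous.\<close>

theorem delayed_peano:
  obtains X where "speed-lipschitz_on UNIV X" "X a = x0"
    "\<And>T. T \<le> b \<Longrightarrow> (\<And>s \<sigma>. s \<in> {a<..<T} \<Longrightarrow> isCont (f s) (X s) \<and> isCont (k \<sigma> s) (X s)) \<Longrightarrow>
       AE t in lebesgue. t \<in> {a<..<T} \<longrightarrow>
         (X has_vector_derivative (f t (X t) + (LINT \<tau>:{a..t}|lborel. k t \<tau> (X \<tau>)))) (at t)"
proof -
  define d where "d n = inverse (real (Suc n))" for n
  have d: "d n > 0" "d \<longlonglongrightarrow> 0" for n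
    unfolding d_def by (rule LIMSEQ_inverse_real_of_nat | simp)+
  \<comment> \<open>\<open>N n\<close> iterations settle the whole interval.\<close>
  define N where "N n = nat \<lceil>(b - a) / d n\<rceil>" for n
  define z where "z n = iterate (d n) (N n)" for n
  have zl: "norm (z n t - z n t') \<le> speed * \<bar>t - t'\<bar>" and zb: "norm (z n t) \<le> radius"
    and zc: "z n t = z n (max a (min t b))" and za: "z n a = x0" for n t t'
    using iterate_props[of "d n" "N n"] unfolding z_def by blast+
  have zm: "z n \<in> borel_measurable borel" for n
    using lipschitz_borel zl .
  have z_eq: "z n t = x0 + (LINT s:{a..t}|lborel. field (d n) (z n) s)" if "t \<in> {a..b}" for n t
  proof -
    have "(b - a) / d n \<le> real (N n)" unfolding N_def by linarith
    then have "t \<le> a + real (N n) * d n"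
      using that d(1)[of n] by (simp add: field_simps)
    from iterate_stable[OF this] show ?thesis
      using that by (simp add: z_def step_def)
  qed
  obtain g r where r: "strict_mono (r :: nat \<Rightarrow> nat)"
    and g: "\<And>e. 0 < e \<Longrightarrow> \<exists>N. \<forall>n x. n \<ge> N \<and> x \<in> {a..b} \<longrightarrow> norm (z (r n) x - g x) < e"
  proof (rule Arzela_Ascoli[of "{a..b}" z radius])
    fix x e :: real assume e: "0 < e"
    have "norm (z n x - z n y) < e" if "norm (x - y) < e / (speed + 1)" for n y
    proof -
      have "norm (z n x - z n y) \<le> (speed + 1) * norm (x - y)"
        using zl[of n x y] by (simp add: algebra_simps)
      also have "\<dots> < e"
        using that speed_nonneg by (simp add: field_simps)
      finally show ?thesis .
    qed
    then show "\<exists>d. 0 < d \<and> (\<forall>n y. y \<in> {a..b} \<and> norm (x - y) < d \<longrightarrow> norm (z n x - z n y) < e)"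
      using e speed_nonneg by (intro exI[of _ "e / (speed + 1)"]) auto
  qed (use zb in auto)
  define X where "X t = g (max a (min t b))" for t
  have lim: "(\<lambda>n. z (r n) t) \<longlonglongrightarrow> X t" for t
  proof (rule LIMSEQ_I)
    fix e :: real assume "0 < e"
    then obtain N where "\<forall>n x. n \<ge> N \<and> x \<in> {a..b} \<longrightarrow> norm (z (r n) x - g x) < e"
      using g by blast
    moreover have "max a (min t b) \<in> {a..b}" using ab by auto
    ultimately show "\<exists>N. \<forall>n\<ge>N. norm (z (r n) t - X t) < e"
      unfolding X_def using zc by metis
  qed
  have Xl: "norm (X t - X t') \<le> speed * \<bar>t - t'\<bar>" for t t'
    by (rule Lim_bounded[of "\<lambda>n. norm (z (r n) t - z (r n) t')" _ 0]) (auto intro!: tendsto_intros lim zl)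
  have Xb: "norm (X t) \<le> radius" for t
    by (rule Lim_bounded[of "\<lambda>n. norm (z (r n) t)" _ 0]) (auto intro!: tendsto_intros lim zb)
  have Xa: "X a = x0"
    using lim[of a] by (simp add: za LIMSEQ_const_iff)
  have Xm: "X \<in> borel_measurable borel"
    using lipschitz_borel Xl .
  have dr: "(\<lambda>n. d (r n)) \<longlonglongrightarrow> 0"
    using LIMSEQ_subseq_LIMSEQ[OF d(2) r] by (simp add: o_def)
  \<comment> \<open>The vanishing delay does not change the limit, by the common Lipschitz constant.\<close>
  have lim_delay: "(\<lambda>n. z (r n) (t - d (r n))) \<longlonglongrightarrow> X t" for t
  proof -
    have "(\<lambda>n. z (r n) (t - d (r n)) - z (r n) t) \<longlonglongrightarrow> 0"
    proof (rule Lim_null_comparison)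
      show "\<forall>\<^sub>F n in sequentially. norm (z (r n) (t - d (r n)) - z (r n) t) \<le> speed * \<bar>d (r n)\<bar>"
        using zl[of "r n" "t - d (r n)" t for n] by (intro always_eventually) simp
      show "(\<lambda>n. speed * \<bar>d (r n)\<bar>) \<longlonglongrightarrow> 0"
        using tendsto_mult[OF tendsto_const[of speed] tendsto_rabs[OF dr]] by simp
    qed
    from tendsto_add[OF this lim[of t]] show ?thesis by simp
  qed
  have X0: "field 0 X t = f t (X t) + (LINT \<tau>:{a..t}|lborel. k t \<tau> (X \<tau>))" for t
    by (simp add: field_def)
  have main: "AE t in lebesgue. t \<in> {a<..<T} \<longrightarrow> (X has_vector_derivative field 0 X t) (at t)"
    if T: "T \<le> b" and cont: "\<And>s \<sigma>. s \<in> {a<..<T} \<Longrightarrow> isCont (f s) (X s) \<and> isCont (k \<sigma> s) (X s)" for T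
  proof -
    have lim_field: "(\<lambda>n. field (d (r n)) (z (r n)) s) \<longlonglongrightarrow> field 0 X s" if s: "s \<in> {a<..<T}" for s
      unfolding field_def
    proof (rule tendsto_add)
      show "(\<lambda>n. f s (z (r n) (s - d (r n)))) \<longlonglongrightarrow> f s (X (s - 0))"
        using isCont_tendsto_compose[OF conjunct1[OF cont[OF s]] lim_delay[of s]] by simp
      show "(\<lambda>n. LINT \<tau>:{a..s}|lborel. k s \<tau> (z (r n) (\<tau> - d (r n)))) \<longlonglongrightarrow> (LINT \<tau>:{a..s}|lborel. k s \<tau> (X (\<tau> - 0)))"
        unfolding set_lebesgue_integral_def
      proof (rule integral_dominated_convergence[where w = "\<lambda>\<tau>. indicator {a..s} \<tau> *\<^sub>R c"])
        show "(\<lambda>\<tau>. indicator {a..s} \<tau> *\<^sub>R k s \<tau> (X (\<tau> - 0))) \<in> borel_measurable lborel"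
          using memory_borel[OF Xm, of s 0] by simp
        show "(\<lambda>\<tau>. indicator {a..s} \<tau> *\<^sub>R k s \<tau> (z (r n) (\<tau> - d (r n)))) \<in> borel_measurable lborel" for n
          using memory_borel[OF zm] by simp
        show "integrable lborel (\<lambda>\<tau>. indicator {a..s} \<tau> *\<^sub>R c)"
          using set_integrable_bounded_interval[of "\<lambda>_. c" a s c] c_nonneg by (simp add: set_integrable_def)
        show "AE \<tau> in lborel. norm (indicator {a..s} \<tau> *\<^sub>R k s \<tau> (z (r n) (\<tau> - d (r n)))) \<le> indicator {a..s} \<tau> *\<^sub>R c" for n
          using k_bound by (intro AE_I2) (auto simp: indicator_def)
        show "AE \<tau> in lborel. (\<lambda>n. indicator {a..s} \<tau> *\<^sub>R k s \<tau> (z (r n) (\<tau> - d (r n)))) \<longlonglongrightarrow> indicator {a..s} \<tau> *\<^sub>R k s \<tau> (X (\<tau> - 0))"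
        proof (rule AE_mp[OF AE_lborel_singleton[of a]], intro AE_I2 impI)
          fix \<tau> assume "\<tau> \<noteq> a"
          show "(\<lambda>n. indicator {a..s} \<tau> *\<^sub>R k s \<tau> (z (r n) (\<tau> - d (r n)))) \<longlonglongrightarrow> indicator {a..s} \<tau> *\<^sub>R k s \<tau> (X (\<tau> - 0))"
          proof (cases "\<tau> \<in> {a..s}")
            case True
            then have "\<tau> \<in> {a<..<T}" using \<open>\<tau> \<noteq> a\<close> s by auto
            then have "(\<lambda>n. k s \<tau> (z (r n) (\<tau> - d (r n)))) \<longlonglongrightarrow> k s \<tau> (X \<tau>)"
              using isCont_tendsto_compose[OF _ lim_delay[of \<tau>]] cont by blast
            then show ?thesis using True by simp
          qed simp
        qed
      qed
    qed
    have bnd: "norm (field 0 X s) \<le> speed" if "s \<in> {a..b}" for s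
      using field_bound[OF Xm Xb that] .
    have X_eq: "X t = x0 + (LINT s:{a..t}|lborel. field 0 X s)" if t: "t \<in> {a..T}" for t
    proof -
      have "(\<lambda>n. LINT s:{a..t}|lborel. field (d (r n)) (z (r n)) s) \<longlonglongrightarrow> (LINT s:{a..t}|lborel. field 0 X s)"
        unfolding set_lebesgue_integral_def
      proof (rule integral_dominated_convergence[where w = "\<lambda>s. indicator {a..t} s *\<^sub>R speed"])
        show "(\<lambda>s. indicator {a..t} s *\<^sub>R field 0 X s) \<in> borel_measurable lborel"
          using field_borel[OF Xm] by simp
        show "(\<lambda>s. indicator {a..t} s *\<^sub>R field (d (r n)) (z (r n)) s) \<in> borel_measurable lborel" for n
          using field_borel[OF zm] by simp
        show "integrable lborel (\<lambda>s. indicator {a..t} s *\<^sub>R speed)"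
          using set_integrable_bounded_interval[of "\<lambda>_. speed" a t speed] speed_nonneg by (simp add: set_integrable_def)
        show "AE s in lborel. norm (indicator {a..t} s *\<^sub>R field (d (r n)) (z (r n)) s) \<le> indicator {a..t} s *\<^sub>R speed" for n
          using field_bound[OF zm zb] t T by (intro AE_I2) (auto simp: indicator_def)
        show "AE s in lborel. (\<lambda>n. indicator {a..t} s *\<^sub>R field (d (r n)) (z (r n)) s) \<longlonglongrightarrow> indicator {a..t} s *\<^sub>R field 0 X s"
        proof (rule AE_mp[OF AE_lborel_singleton[of a]], rule AE_mp[OF AE_lborel_singleton[of T]], intro AE_I2 impI)
          fix s assume "s \<noteq> a" "s \<noteq> T"
          then show "(\<lambda>n. indicator {a..t} s *\<^sub>R field (d (r n)) (z (r n)) s) \<longlonglongrightarrow> indicator {a..t} s *\<^sub>R field 0 X s"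
            using lim_field[of s] t by (cases "s \<in> {a..t}") auto
        qed
      qed
      then have "(\<lambda>n. z (r n) t) \<longlonglongrightarrow> x0 + (LINT s:{a..t}|lborel. field 0 X s)"
        using z_eq[of t] t T by (auto intro!: tendsto_intros)
      then show ?thesis using lim LIMSEQ_unique by blast
    qed
    show ?thesis
    proof (cases "a \<le> T")
      case True
      have si: "set_integrable lborel {a..t} (field 0 X)" if "t \<in> {a..T}" for t
        using that T by (intro set_integrable_bounded_interval[where c = speed] field_borel Xm bnd) auto
      have X_eq': "X t = x0 + integral {a..t} (field 0 X)" if "t \<in> {a..T}" for t
        using X_eq[OF that] set_borel_integral_eq_integral(2)[OF si[OF that]] by simp
      have "field 0 X integrable_on {a..T}"
        using set_borel_integral_eq_integral(1)[OF si[of T]] True by simp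
      from indefinite_integral_has_vector_derivative_AE[OF this] show ?thesis
      proof (rule AE_mp, intro AE_I2 impI)
        fix t assume t: "t \<in> {a<..<T}" and "t \<in> {a<..<T} \<longrightarrow> ((\<lambda>u. integral {a..u} (field 0 X)) has_vector_derivative field 0 X t) (at t)"
        then have "((\<lambda>u. x0 + integral {a..u} (field 0 X)) has_vector_derivative field 0 X t) (at t)"
          by (auto intro!: derivative_eq_intros)
        then show "(X has_vector_derivative field 0 X t) (at t)"
          by (rule has_vector_derivative_transform_within_open[where S = "{a<..<T}"]) (use t X_eq' in auto)
      qed
    qed auto
  qed
  show ?thesis
  proof (rule that)
    show "speed-lipschitz_on UNIV X"
      using Xl speed_nonneg by (intro lipschitz_onI) (auto simp: dist_norm)
  qed (use Xa main in \<open>auto simp: X0\<close>)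
qed

end

section \<open>Matrix-vector products\<close>

lemma bounded_bilinear_matrix_vector: "bounded_bilinear ((*v) :: real ^ 'k ^ 'l \<Rightarrow> real ^ 'k \<Rightarrow> real ^ 'l)"
  unfolding bilinear_conv_bounded_bilinear[symmetric] bilinear_def
  by (auto intro!: linearI simp: matrix_vector_mult_add_rdistrib scaleR_matrix_vector_assoc
      matrix_vector_right_distrib matrix_vector_mult_scaleR)

lemma borel_measurable_matrix_vector [measurable (raw)]:
  fixes f :: "'a \<Rightarrow> real ^ 'k ^ 'l"
  assumes "f \<in> borel_measurable M" "g \<in> borel_measurable M"
  shows "(\<lambda>x. f x *v g x) \<in> borel_measurable M"
proof (rule borel_measurable_continuous_Pair[OF assms])
  show "continuous_on UNIV (\<lambda>x. fst x *v snd x :: real ^ 'l)"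
    by (intro bounded_bilinear.continuous_on[OF bounded_bilinear_matrix_vector] continuous_intros)
qed

lemma isCont_matrix_vector: "isCont f x \<Longrightarrow> isCont (\<lambda>x. (M :: real ^ 'k ^ 'l) *v f x) x"
  by (rule bounded_linear.continuous[OF matrix_vector_mul_bounded_linear])

section \<open>The norm of a positive definite matrix\<close>

locale weight =
  fixes P :: "real ^ 'm ^ 'm"
  assumes P: "pos_definite P"
begin

lemma form_sym: "y \<bullet> (P *v z) = z \<bullet> (P *v y)"
  using P by (metis dot_lmul_matrix inner_commute pos_definite_def transpose_matrix_vector)

lemma form_nonneg: "0 \<le> y \<bullet> (P *v y)"
  using P by (cases "y = 0") (auto simp: pos_definite_def intro: less_imp_le)

lemma wnorm_square: "(wnorm P y)\<^sup>2 = y \<bullet> (P *v y)"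
  using form_nonneg by (simp add: wnorm_def)

lemma wnorm_nonneg [simp]: "0 \<le> wnorm P y"
  using form_nonneg by (simp add: wnorm_def)

lemma wnorm_eq_0 [simp]: "wnorm P y = 0 \<longleftrightarrow> y = 0"
  using P by (auto simp: wnorm_def pos_definite_def)

lemma wnorm_zero [simp]: "wnorm P 0 = 0"
  by simp

lemma wnorm_pos: "y \<noteq> 0 \<Longrightarrow> 0 < wnorm P y"
  using wnorm_nonneg[of y] wnorm_eq_0[of y] by linarith

lemma wnorm_scaleR: "wnorm P (r *\<^sub>R y) = \<bar>r\<bar> * wnorm P y"
  by (simp add: wnorm_def matrix_vector_mult_scaleR real_sqrt_mult real_sqrt_abs2 flip: mult.assoc)

text \<open>The form is nonnegative at \<open>|z| y - |y| z\<close>.\<close>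

lemma wnorm_Cauchy_Schwarz: "y \<bullet> (P *v z) \<le> wnorm P y * wnorm P z"
proof (cases "y = 0 \<or> z = 0")
  case False
  let ?a = "wnorm P y" and ?b = "wnorm P z"
  have pos: "0 < ?a * ?b" using False by (simp add: wnorm_pos)
  have "0 \<le> (?b *\<^sub>R y - ?a *\<^sub>R z) \<bullet> (P *v (?b *\<^sub>R y - ?a *\<^sub>R z))"
    by (rule form_nonneg)
  also have "\<dots> = ?b * ?b * (y \<bullet> (P *v y)) + ?a * ?a * (z \<bullet> (P *v z)) - 2 * (?a * ?b) * (y \<bullet> (P *v z))"
    using form_sym[of z y]
    by (simp add: matrix_vector_mult_diff_distrib matrix_vector_mult_scaleR inner_diff_left inner_diff_right algebra_simps)
  also have "\<dots> = 2 * (?a * ?b) * (?a * ?b - y \<bullet> (P *v z))"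
    unfolding wnorm_square[symmetric] by (simp add: algebra_simps power2_eq_square)
  finally show ?thesis using pos by (simp add: zero_le_mult_iff)
qed auto

lemma wnorm_Cauchy_Schwarz_abs: "\<bar>y \<bullet> (P *v z)\<bar> \<le> wnorm P y * wnorm P z"
  using wnorm_Cauchy_Schwarz[of y z] wnorm_Cauchy_Schwarz[of "- y" z] wnorm_scaleR[of "-1" y] by auto

lemma wnorm_triangle: "wnorm P (y + z) \<le> wnorm P y + wnorm P z"
proof (rule power2_le_imp_le)
  have "(wnorm P (y + z))\<^sup>2 = y \<bullet> (P *v y) + 2 * (y \<bullet> (P *v z)) + z \<bullet> (P *v z)"
    unfolding wnorm_square using form_sym[of z y]
    by (simp add: matrix_vector_right_distrib inner_add_left inner_add_right)
  also have "\<dots> \<le> (wnorm P y + wnorm P z)\<^sup>2"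
    using wnorm_Cauchy_Schwarz[of y z] by (simp add: power2_sum flip: wnorm_square)
  finally show "(wnorm P (y + z))\<^sup>2 \<le> (wnorm P y + wnorm P z)\<^sup>2" .
qed simp

lemma continuous_wnorm: "continuous_on UNIV (wnorm P)"
  unfolding wnorm_def by (intro continuous_intros matrix_vector_mult_linear_continuous_on)

lemma wnorm_borel [measurable]: "wnorm P \<in> borel_measurable borel"
  by (rule borel_measurable_continuous_onI[OF continuous_wnorm])

lemma wnorm_le_norm: obtains \<kappa> where "\<kappa> > 0" "\<And>y. wnorm P y \<le> \<kappa> * norm y"
proof -
  have "compact (wnorm P ` sphere 0 1)"
    by (intro compact_continuous_image continuous_on_subset[OF continuous_wnorm]) auto
  then obtain K where "\<forall>v \<in> wnorm P ` sphere 0 1. norm v \<le> K"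
    using compact_imp_bounded bounded_iff by blast
  then have K: "wnorm P y \<le> K" if "norm y = 1" for y
    using that by force
  have "wnorm P y \<le> (\<bar>K\<bar> + 1) * norm y" for y
  proof (cases "y = 0")
    case False
    have "wnorm P y = norm y * wnorm P (y /\<^sub>R norm y)"
      using False by (simp add: wnorm_scaleR)
    also have "\<dots> \<le> norm y * (\<bar>K\<bar> + 1)"
      using K[of "y /\<^sub>R norm y"] False by (intro mult_left_mono) auto
    finally show ?thesis by (simp add: mult.commute)
  qed simp
  then show thesis by (intro that[of "\<bar>K\<bar> + 1"]) auto
qed

text \<open>The norm attains a positive minimum on the compact unit sphere.\<close>

lemma norm_le_wnorm: obtains \<mu> where "\<mu> > 0" "\<And>y. norm y \<le> \<mu> * wnorm P y"
proof -
  have "\<exists>y\<in>sphere 0 1. \<forall>z\<in>sphere 0 1. wnorm P y \<le> wnorm P (z :: real ^ 'm)"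
    by (intro continuous_attains_inf continuous_on_subset[OF continuous_wnorm]) auto
  then obtain y0 where y0: "norm y0 = 1" "\<And>z. norm z = 1 \<Longrightarrow> wnorm P y0 \<le> wnorm P z"
    by auto
  have pos: "0 < wnorm P y0" using y0(1) by (intro wnorm_pos) auto
  have "norm y \<le> (1 / wnorm P y0) * wnorm P y" for y
  proof (cases "y = 0")
    case False
    have "norm y * wnorm P y0 \<le> norm y * wnorm P (y /\<^sub>R norm y)"
      using y0(2)[of "y /\<^sub>R norm y"] False by (intro mult_left_mono) auto
    also have "\<dots> = wnorm P y"
      using False by (simp add: wnorm_scaleR)
    finally show ?thesis using pos by (simp add: field_simps)
  qed simp
  then show thesis using pos by (intro that[of "1 / wnorm P y0"]) auto
qed

lemma compact_wball: "compact {q. wnorm P q \<le> 1}"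
proof -
  obtain \<mu> where "\<mu> > 0" "\<And>y. norm y \<le> \<mu> * wnorm P y" by (rule norm_le_wnorm) blast
  then have "norm q \<le> \<mu>" if "wnorm P q \<le> 1" for q
    using that by (metis mult.right_neutral mult_left_mono less_imp_le order_trans)
  then have "bounded {q. wnorm P q \<le> 1}" by (auto simp: bounded_iff)
  moreover have "closed {q. wnorm P q \<le> 1}"
    using closed_Collect_le[OF continuous_wnorm continuous_on_const] .
  ultimately show ?thesis by (simp add: compact_eq_bounded_closed)
qed

lemma convex_wball: "convex {q. wnorm P q \<le> 1}"
  unfolding convex_def
proof (clarify, goal_cases)
  case (1 y z u v)
  have "wnorm P (u *\<^sub>R y + v *\<^sub>R z) \<le> u * wnorm P y + v * wnorm P z"
    using wnorm_triangle[of "u *\<^sub>R y" "v *\<^sub>R z"] 1 by (simp add: wnorm_scaleR)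
  also have "\<dots> \<le> u * 1 + v * 1"
    using 1 by (intro add_mono mult_left_mono) auto
  finally show ?case using 1 by simp
qed

lemma bdd_above_wopnorm: "bdd_above ((\<lambda>y. wnorm P (Q *v y) / wnorm P y) ` (- {0}))"
proof -
  obtain \<kappa> where \<kappa>: "\<kappa> > 0" "\<And>y. wnorm P y \<le> \<kappa> * norm y" by (rule wnorm_le_norm) blast
  obtain \<mu> where \<mu>: "\<mu> > 0" "\<And>y. norm y \<le> \<mu> * wnorm P y" by (rule norm_le_wnorm) blast
  obtain q where q: "q > 0" "\<And>y. norm (Q *v y) \<le> norm y * q"
    using bounded_linear.pos_bounded[OF matrix_vector_mul_bounded_linear] by blast
  show ?thesis
  proof (rule bdd_aboveI2)
    fix y :: "real ^ 'm" assume "y \<in> - {0}"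
    then have pos: "0 < wnorm P y" by (simp add: wnorm_pos)
    have "wnorm P (Q *v y) \<le> \<kappa> * (norm y * q)"
      using \<kappa>(2)[of "Q *v y"] q(2)[of y] \<kappa>(1) by (meson mult_left_mono less_imp_le order_trans)
    also have "\<dots> \<le> \<kappa> * (\<mu> * wnorm P y * q)"
      using \<kappa>(1) q(1) \<mu>(2)[of y] by (intro mult_left_mono mult_right_mono) auto
    finally show "wnorm P (Q *v y) / wnorm P y \<le> \<kappa> * \<mu> * q"
      using pos by (simp add: field_simps)
  qed
qed

lemma wnorm_le_wopnorm: "wnorm P (Q *v y) \<le> wopnorm P Q * wnorm P y"
proof (cases "y = 0")
  case False
  then have "wnorm P (Q *v y) / wnorm P y \<le> wopnorm P Q"
    unfolding wopnorm_def by (intro cSUP_upper bdd_above_wopnorm) auto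
  then show ?thesis using False wnorm_pos[of y] by (simp add: field_simps)
qed simp

lemma wopnorm_nonneg: "0 \<le> wopnorm P Q"
proof -
  have "wnorm P (Q *v axis undefined 1) / wnorm P (axis undefined 1) \<le> wopnorm P Q"
    unfolding wopnorm_def by (intro cSUP_upper bdd_above_wopnorm) (auto simp: axis_eq_0_iff)
  then show ?thesis by (meson divide_nonneg_nonneg order_trans wnorm_nonneg)
qed

end

section \<open>Filippov regularization\<close>

text \<open>The empty set is one of the null sets, and one radius is enough.\<close>

lemma filippov_reg_subset:
  assumes "\<eta> > 0" "\<And>z. z \<in> ball x \<eta> \<Longrightarrow> g t z \<in> S" "closed S" "convex S"
  shows "filippov_reg g t x \<subseteq> S"
proof -
  have "filippov_reg g t x \<subseteq> closure (convex hull (g t ` (ball x \<eta> - {})))"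
    unfolding filippov_reg_def using assms(1) by (intro INF_lower2[of \<eta>] INF_lower2[of "{}"]) auto
  also have "\<dots> \<subseteq> S"
    using assms by (intro closure_minimal hull_minimal) auto
  finally show ?thesis .
qed

lemma convex_filippov_reg: "convex (filippov_reg g t x)"
  unfolding filippov_reg_def by (intro convex_INT convex_closure convex_convex_hull)

text \<open>Near a point of continuity the function takes similar values on a whole ball, which no null set exhausts.
  So values that are approached through points of continuity survive the removal of null sets.\<close>

lemma filippov_reg_memI:
  assumes approx: "\<And>\<eta> e. \<eta> > 0 \<Longrightarrow> e > 0 \<Longrightarrow> \<exists>z\<in>ball x \<eta>. isCont (g t) z \<and> dist (g t z) y < e"
  shows "y \<in> filippov_reg g t x"
  unfolding filippov_reg_def
proof (intro INT_I)
  fix \<eta> :: real and N assume \<eta>: "\<eta> \<in> {0<..}" and N: "N \<in> null_sets (lebesgue :: 'a measure)"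
  have "y \<in> closure (g t ` (ball x \<eta> - N))"
    unfolding closure_approachable
  proof (intro allI impI)
    fix e :: real assume e: "0 < e"
    then obtain z where z: "z \<in> ball x \<eta>" "isCont (g t) z" "dist (g t z) y < e / 2"
      using approx[of \<eta> "e / 2"] \<eta> by auto
    then obtain d where d: "d > 0" "\<And>z'. dist z' z < d \<Longrightarrow> dist (g t z') (g t z) < e / 2"
      using e unfolding continuous_at_eps_delta by (meson half_gt_zero)
    obtain r where r: "r > 0" "ball z r \<subseteq> ball x \<eta>"
      using z(1) open_contains_ball open_ball by metis
    have "ball z (min d r) \<noteq> {}" using d r by auto
    then have "\<not> negligible (ball z (min d r))"
      using open_not_negligible open_ball by blast
    then obtain z' where z': "z' \<in> ball z (min d r)" "z' \<notin> N"
      using N negligible_iff_null_sets negligible_subset by blast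
    then show "\<exists>y'\<in>g t ` (ball x \<eta> - N). dist y' y < e"
    proof (intro bexI[of _ "g t z'"])
      show "dist (g t z') y < e"
        using d(2)[of z'] z(3) z'(1) dist_triangle[of "g t z'" y "g t z"] by (simp add: dist_commute)
      have "z' \<in> ball x \<eta>" using z'(1) r(2) by (meson min.cobounded2 subset_ball subsetD)
      then show "g t z' \<in> g t ` (ball x \<eta> - N)" using z'(2) by blast
    qed
  qed
  then show "y \<in> closure (convex hull g t ` (ball x \<eta> - N))"
    using closure_mono hull_subset by blast
qed

section \<open>The regularized feedback\<close>

locale feedback_law = weight P for P :: "real ^ 'm ^ 'm" +
  fixes B :: "real ^ 'm ^ 'n" and C :: "real ^ 'n ^ 'm" and \<rho> :: real
  assumes CB: "det (C ** B) \<noteq> 0" and \<rho>: "\<rho> > 0"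
begin

definition G :: "real ^ 'm ^ 'm" where "G = matrix_inv (C ** B)"

text \<open>In particular \<open>C\<close> is onto, with \<open>B G\<close> as a right inverse.\<close>

lemma CB_G: "C *v (B *v (G *v q)) = q"
proof -
  have "invertible (C ** B)" using CB by (simp add: invertible_det_nz)
  then have "(C ** B) ** G = mat 1"
    unfolding invertible_def G_def matrix_inv_def by (rule someI2_ex) blast
  then show ?thesis by (simp add: matrix_vector_mul_assoc matrix_mul_assoc)
qed

abbreviation fb :: "real ^ 'n \<Rightarrow> real ^ 'm" where "fb \<equiv> feedback B C P \<rho>"

definition dir :: "real ^ 'n \<Rightarrow> real ^ 'm" where "dir x = (C *v x) /\<^sub>R wnorm P (C *v x)"

lemma fb_dir: "fb x = - \<rho> *\<^sub>R (G *v dir x)"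
  by (simp add: feedback_def dir_def G_def)

lemma wnorm_dir: "wnorm P (dir x) = (if C *v x = 0 then 0 else 1)"
  by (simp add: dir_def wnorm_scaleR)

lemma isCont_fb: "C *v x \<noteq> 0 \<Longrightarrow> isCont fb x"
proof -
  assume "C *v x \<noteq> 0"
  have "isCont (wnorm P) y" for y
    using continuous_wnorm continuous_on_eq_continuous_at[OF open_UNIV] by blast
  then have "isCont (\<lambda>x. wnorm P (C *v x)) x"
    using isCont_o2[OF isCont_matrix_vector[OF continuous_ident]] by blast
  then show ?thesis
    unfolding feedback_def using \<open>C *v x \<noteq> 0\<close>
    by (intro continuous_scaleR continuous_const isCont_matrix_vector continuous_at_within_inverse) auto
qed

lemma fb_bounded: obtains U where "U \<ge> 0" "\<And>q. wnorm P q \<le> 1 \<Longrightarrow> norm (- \<rho> *\<^sub>R (G *v q)) \<le> U"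
proof -
  have "compact ((\<lambda>q. - \<rho> *\<^sub>R (G *v q)) ` {q. wnorm P q \<le> 1})"
    by (intro compact_continuous_image compact_wball continuous_intros matrix_vector_mult_linear_continuous_on)
  then obtain U where "\<And>q. wnorm P q \<le> 1 \<Longrightarrow> norm (- \<rho> *\<^sub>R (G *v q)) \<le> U"
    using compact_imp_bounded by (force simp: bounded_iff)
  then show thesis using that[of "max U 0"] by (simp add: max.coboundedI1)
qed

lemma fb_borel [measurable]: "fb \<in> borel_measurable borel"
  unfolding feedback_def[abs_def] by measurable

text \<open>Both regularized maps are of this form: the present velocity with \<open>D = A\<close>, \<open>E = B\<close>, the remembered
  one with \<open>D = 0\<close>, \<open>E = Bt\<close>.\<close>

definition drift :: "real ^ 'n ^ 'n \<Rightarrow> real ^ 'm ^ 'n \<Rightarrow> real ^ 'n \<Rightarrow> real ^ 'n \<Rightarrow> real ^ 'n" where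
  "drift D E h z = D *v z + E *v fb z + h"

lemma isCont_drift: "C *v x \<noteq> 0 \<Longrightarrow> isCont (drift D E h) x"
  unfolding drift_def
  by (intro continuous_add continuous_const isCont_matrix_vector isCont_fb continuous_ident)

lemma filippov_reg_drift_off_surface:
  assumes "C *v x \<noteq> 0"
  shows "filippov_reg (\<lambda>t. drift D E (h t)) t x = {drift D E (h t) x}"
proof
  show "{drift D E (h t) x} \<subseteq> filippov_reg (\<lambda>t. drift D E (h t)) t x"
    using isCont_drift[OF assms] by (auto intro!: filippov_reg_memI bexI[of _ x])
  have "v = drift D E (h t) x" if v: "v \<in> filippov_reg (\<lambda>t. drift D E (h t)) t x" for v
  proof (rule ccontr)
    assume "v \<noteq> drift D E (h t) x"
    then have e: "0 < dist v (drift D E (h t) x) / 2" by simp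
    then obtain d where d: "d > 0" "\<And>z. dist z x < d \<Longrightarrow> dist (drift D E (h t) z) (drift D E (h t) x) < dist v (drift D E (h t) x) / 2"
      using isCont_drift[OF assms, of D E "h t"] unfolding continuous_at_eps_delta by blast
    have "filippov_reg (\<lambda>t. drift D E (h t)) t x \<subseteq> cball (drift D E (h t) x) (dist v (drift D E (h t) x) / 2)"
      using d by (intro filippov_reg_subset[of d]) (auto simp: dist_commute less_imp_le)
    then have "dist v (drift D E (h t) x) \<le> dist v (drift D E (h t) x) / 2"
      using v by (auto simp: dist_commute)
    then show False using e by simp
  qed
  then show "filippov_reg (\<lambda>t. drift D E (h t)) t x \<subseteq> {drift D E (h t) x}" by blast
qed

text \<open>For \<open>|q| = 1\<close> the point \<open>x\<close> is approached along \<open>x + s w\<close>, where \<open>C w = q\<close>: there the direction of the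
  output is constantly \<open>q\<close>. Every other \<open>q\<close> in the ball is a convex combination of a unit vector and its
  negative.\<close>

lemma filippov_reg_drift_on_surface:
  assumes Cx: "C *v x = 0" and q: "wnorm P q \<le> 1"
  shows "D *v x + E *v (- \<rho> *\<^sub>R (G *v q)) + h t \<in> filippov_reg (\<lambda>t. drift D E (h t)) t x"
proof -
  let ?v = "\<lambda>q. D *v x + E *v (- \<rho> *\<^sub>R (G *v q)) + h t"
  have unit: "?v q \<in> filippov_reg (\<lambda>t. drift D E (h t)) t x" if q: "wnorm P q = 1" for q
  proof (rule filippov_reg_memI)
    fix \<eta> e :: real assume "\<eta> > 0" "e > 0"
    define w where "w = B *v (G *v q)"
    have "((\<lambda>s. x + s *\<^sub>R w) \<longlongrightarrow> x + 0 *\<^sub>R w) (at_right 0)"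
      by (intro tendsto_intros)
    then have 1: "\<forall>\<^sub>F s in at_right 0. dist (x + s *\<^sub>R w) x < \<eta>"
      using \<open>\<eta> > 0\<close> by (auto dest: tendstoD)
    have "((\<lambda>s. ?v q + s *\<^sub>R (D *v w)) \<longlongrightarrow> ?v q + 0 *\<^sub>R (D *v w)) (at_right 0)"
      by (intro tendsto_intros)
    then have 2: "\<forall>\<^sub>F s in at_right 0. dist (?v q + s *\<^sub>R (D *v w)) (?v q) < e"
      using \<open>e > 0\<close> by (auto dest: tendstoD)
    obtain s where s: "s > 0" "dist (x + s *\<^sub>R w) x < \<eta>" "dist (?v q + s *\<^sub>R (D *v w)) (?v q) < e"
      using eventually_happens[OF eventually_conj[OF eventually_at_right_less eventually_conj[OF 1 2]]] by auto
    have Cz: "C *v (x + s *\<^sub>R w) = s *\<^sub>R q"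
      using Cx CB_G by (simp add: w_def matrix_vector_right_distrib matrix_vector_mult_scaleR)
    then have "dir (x + s *\<^sub>R w) = q" using q s(1) by (simp add: dir_def wnorm_scaleR)
    then have "drift D E (h t) (x + s *\<^sub>R w) = ?v q + s *\<^sub>R (D *v w)"
      by (simp add: drift_def fb_dir matrix_vector_right_distrib matrix_vector_mult_scaleR)
    moreover have "C *v (x + s *\<^sub>R w) \<noteq> 0"
      using Cz s(1) q by auto
    ultimately show "\<exists>z\<in>ball x \<eta>. isCont (drift D E (h t)) z \<and> dist (drift D E (h t) z) (?v q) < e"
      using s isCont_drift by (intro bexI[of _ "x + s *\<^sub>R w"]) (auto simp: dist_commute)
  qed
  \<comment> \<open>If \<open>q = 0\<close>, any unit vector will do.\<close>
  define q' where "q' = (if q = 0 then axis undefined 1 else q)"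
  define q1 where "q1 = q' /\<^sub>R wnorm P q'"
  have "q' \<noteq> 0" by (simp add: q'_def axis_eq_0_iff)
  then have q1: "wnorm P q1 = 1" "wnorm P (- q1) = 1"
    using wnorm_scaleR[of "-1" q1] by (auto simp: q1_def wnorm_scaleR)
  have q_q1: "q = wnorm P q *\<^sub>R q1" by (simp add: q1_def q'_def)
  \<comment> \<open>The weight for which \<open>u q1 - (1 - u) q1 = q\<close>.\<close>
  define u where "u = (1 + wnorm P q) / 2"
  have "u *\<^sub>R ?v q1 + (1 - u) *\<^sub>R ?v (- q1) \<in> filippov_reg (\<lambda>t. drift D E (h t)) t x"
    using convexD[OF convex_filippov_reg unit unit, OF q1] q by (simp add: u_def)
  also have "u *\<^sub>R ?v q1 + (1 - u) *\<^sub>R ?v (- q1) = ?v q"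
  proof -
    let ?w = "E *v (G *v q1)"
    have minus: "G *v (- q1) = - (G *v q1)" by (metis linear_neg matrix_vector_mul_linear)
    have v: "?v q1 = (D *v x + h t) - \<rho> *\<^sub>R ?w" "?v (- q1) = (D *v x + h t) + \<rho> *\<^sub>R ?w"
      by (simp_all add: minus matrix_vector_mult_scaleR flip: scaleR_minus_left)
    have vq: "?v q = (D *v x + h t) - (wnorm P q * \<rho>) *\<^sub>R ?w"
      by (subst q_q1) (simp add: matrix_vector_mult_scaleR mult.commute flip: scaleR_minus_left)
    have comb: "u *\<^sub>R (X - \<rho> *\<^sub>R W) + (1 - u) *\<^sub>R (X + \<rho> *\<^sub>R W) = X - ((2 * u - 1) * \<rho>) *\<^sub>R W" for X W :: "real ^ 'n"
      by (simp add: vec_eq_iff algebra_simps)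
    have u: "2 * u - 1 = wnorm P q" by (simp add: u_def add_divide_distrib)
    show ?thesis unfolding v vq comb u by (rule refl)
  qed
  finally show ?thesis .
qed

text \<open>This includes the value \<open>0\<close> of the feedback on the surface, the centre of the ball, and is what allows the feedback
  itself as a measurable selection.\<close>

lemma drift_mem_filippov_reg: "drift D E (h t) x \<in> filippov_reg (\<lambda>t. drift D E (h t)) t x"
proof (cases "C *v x = 0")
  case True
  then have "dir x = 0" by (simp add: dir_def)
  then show ?thesis
    using filippov_reg_drift_on_surface[OF True, of 0 D E h t] by (simp add: drift_def fb_dir)
qed (simp add: filippov_reg_drift_off_surface)

text \<open>Without the term \<open>D z\<close> the values lie in a translate of a compact convex image of the unit ball, wherever \<open>x\<close> is.\<close>

lemma filippov_reg_drift_memory: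
  assumes "v \<in> filippov_reg (\<lambda>t. drift 0 E (h t)) t x"
  obtains q where "wnorm P q \<le> 1" "v = E *v (- \<rho> *\<^sub>R (G *v q)) + h t"
proof -
  let ?f = "\<lambda>q. E *v (- \<rho> *\<^sub>R (G *v q))"
  let ?S = "(\<lambda>y. y + h t) ` ?f ` {q. wnorm P q \<le> 1}"
  have lin: "linear ?f"
    by (intro linear_compose[of "\<lambda>q. - \<rho> *\<^sub>R (G *v q)" "\<lambda>y. E *v y", unfolded o_def] matrix_vector_mul_linear
        linear_compose_scale_right)
  have "filippov_reg (\<lambda>t. drift 0 E (h t)) t x \<subseteq> ?S"
  proof (rule filippov_reg_subset[of 1])
    show "drift 0 E (h t) z \<in> ?S" if "z \<in> ball x 1" for z
      using wnorm_dir[of z] by (auto simp: drift_def fb_dir intro!: image_eqI)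
    have "compact (?f ` {q. wnorm P q \<le> 1})"
      by (intro compact_continuous_image compact_wball linear_continuous_on linear_linear[THEN iffD2] lin)
    then show "closed ?S"
      using closed_translation[OF compact_imp_closed, of _ "h t"] by (simp add: add.commute)
    show "convex ?S"
      using convex_translation[OF convex_linear_image[OF lin convex_wball], of "h t"] by (simp add: add.commute)
  qed simp
  then show thesis using assms that by blast
qed

lemma filippov_reg_drift_bound:
  assumes v: "v \<in> filippov_reg (\<lambda>t. drift D E (h t)) t x"
    and D: "\<And>z. norm (D *v z) \<le> a * norm z" and "0 \<le> a"
    and E: "\<And>z. norm (E *v fb z) \<le> c"
  shows "norm v \<le> a * (norm x + 1) + c + norm (h t)"
proof -
  have "filippov_reg (\<lambda>t. drift D E (h t)) t x \<subseteq> cball 0 (a * (norm x + 1) + c + norm (h t))"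
  proof (rule filippov_reg_subset[of 1])
    fix z assume "z \<in> ball x 1"
    then have "norm z \<le> norm x + 1"
      using norm_triangle_sub[of z x] by (simp add: dist_norm norm_minus_commute)
    then have "norm (D *v z) \<le> a * (norm x + 1)"
      using D[of z] \<open>0 \<le> a\<close> by (meson mult_left_mono order_trans)
    then show "drift D E (h t) z \<in> cball 0 (a * (norm x + 1) + c + norm (h t))"
      using E[of z] norm_triangle_ineq[of "D *v z" "E *v fb z"] norm_triangle_ineq[of "D *v z + E *v fb z" "h t"]
      by (simp add: drift_def)
  qed auto
  then show ?thesis using v by auto
qed

end

section \<open>Borel representatives of the data\<close>

lemma lebesgue_borel_version:
  fixes g :: "'a::euclidean_space \<Rightarrow> 'b::euclidean_space"
  assumes g: "g \<in> borel_measurable lebesgue"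
  obtains g' where "g' \<in> borel_measurable borel" "AE x in lborel. g x = g' x"
proof -
  have "\<exists>h\<in>borel_measurable lborel. AE x in lborel. g x \<bullet> i = h x" for i
    using g by (intro completion_ex_borel_measurable_real) simp
  then obtain h where h: "\<And>i. h i \<in> borel_measurable lborel" "\<And>i. AE x in lborel. g x \<bullet> i = h i x"
    by metis
  show thesis
  proof (rule that)
    show "(\<lambda>x. \<Sum>i\<in>Basis. h i x *\<^sub>R i) \<in> borel_measurable borel"
      using h(1) by (simp cong: measurable_cong_sets)
    have "AE x in lborel. \<forall>i\<in>Basis. g x \<bullet> i = h i x"
      using h(2) by (intro AE_finite_allI) auto
    then show "AE x in lborel. g x = (\<Sum>i\<in>Basis. h i x *\<^sub>R i)"
    proof eventually_elim
      case (elim x)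
      have "g x = (\<Sum>i\<in>Basis. (g x \<bullet> i) *\<^sub>R i)" by (rule euclidean_representation[symmetric])
      then show ?case using elim by simp
    qed
  qed
qed

text \<open>Values beyond the essential bound are taken on a null set and are replaced by \<open>0\<close>, so that the
  representative is bounded everywhere.\<close>

lemma bounded_borel_version:
  fixes g :: "'a::euclidean_space \<Rightarrow> 'b::euclidean_space"
  assumes S: "S \<in> sets borel" and g: "g \<in> borel_measurable (lebesgue_on S)"
    and bd: "AE x in lebesgue_on S. norm (g x) \<le> c"
  obtains g' where "g' \<in> borel_measurable borel" "\<And>x. norm (g' x) \<le> \<bar>c\<bar>"
    "AE x in lborel. x \<in> S \<longrightarrow> g x = g' x"
proof -
  have "(\<lambda>x. if x \<in> S then g x else 0) \<in> borel_measurable lebesgue"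
    using S g by (intro borel_measurable_if_I) auto
  then obtain h where h: "h \<in> borel_measurable borel" "AE x in lborel. (if x \<in> S then g x else 0) = h x"
    by (rule lebesgue_borel_version)
  have bd': "AE x in lborel. x \<in> S \<longrightarrow> norm (g x) \<le> c"
    using bd S by (subst (asm) AE_restrict_space_iff) (auto simp: AE_completion_iff)
  show thesis
  proof (rule that)
    show "(\<lambda>x. if norm (h x) \<le> c then h x else 0) \<in> borel_measurable borel"
      using h(1) by measurable
    show "norm (if norm (h x) \<le> c then h x else 0) \<le> \<bar>c\<bar>" for x by auto
    show "AE x in lborel. x \<in> S \<longrightarrow> g x = (if norm (h x) \<le> c then h x else 0)"
      using h(2) bd' by eventually_elim auto
  qed
qed

lemma esssup_norm_bound:
  assumes "esssup M (\<lambda>x. ereal (norm (g x))) < \<infinity>"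
  obtains c where "AE x in M. norm (g x) \<le> c"
proof -
  have "AE x in M. norm (g x) \<le> \<bar>real_of_ereal (esssup M (\<lambda>x. ereal (norm (g x))))\<bar>"
    using esssup_AE[of "\<lambda>x. ereal (norm (g x))" M]
  proof eventually_elim
    case (elim x)
    then show ?case
      using assms by (cases "esssup M (\<lambda>x. ereal (norm (g x)))") auto
  qed
  then show thesis by (rule that)
qed

lemma L_infinity_borel_version:
  assumes "L_infinity g"
  obtains g' c where "g' \<in> borel_measurable borel" "\<And>t. norm (g' t) \<le> c" "AE t in lborel. g t = g' t"
proof -
  obtain c where c: "AE t in lebesgue. norm (g t) \<le> c"
    using assms unfolding L_infinity_def by (elim conjE esssup_norm_bound)
  have "g \<in> borel_measurable (lebesgue_on UNIV)" "AE t in lebesgue_on UNIV. norm (g t) \<le> c"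
    using assms c unfolding L_infinity_def lebesgue_on_UNIV_eq by blast+
  then obtain g' where "g' \<in> borel_measurable borel" "\<And>t. norm (g' t) \<le> \<bar>c\<bar>" "AE t in lborel. t \<in> UNIV \<longrightarrow> g t = g' t"
    by (rule bounded_borel_version[rotated]) auto
  then show thesis using that by auto
qed

text \<open>The triangle \<open>t0 \<le> \<tau> \<le> t \<le> T\<close> is compact, so the kernel is essentially bounded on it. Its exceptional
  null set in the plane has null sections for almost every \<open>t\<close>. That the representative is jointly Borel
  is needed to integrate over \<open>\<tau>\<close> and then over \<open>t\<close>.\<close>

lemma kernel_borel_version:
  fixes \<Phi> :: "real \<Rightarrow> real \<Rightarrow> 'b::euclidean_space"
  assumes m: "(\<lambda>(t, \<tau>). \<Phi> t \<tau>) \<in> borel_measurable (lebesgue_on kernel_domain)"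
    and b: "locally_ess_bounded_on kernel_domain (\<lambda>(t, \<tau>). \<Phi> t \<tau>)"
  obtains K c where "case_prod K \<in> borel_measurable (borel \<Otimes>\<^sub>M borel)" "\<And>t \<tau>. norm (K t \<tau>) \<le> c"
    "AE t in lebesgue. t \<in> {t0..T} \<longrightarrow> (AE \<tau> in lborel. \<tau> \<in> {t0..t} \<longrightarrow> \<Phi> t \<tau> = K t \<tau>)"
proof -
  let ?S = "{z :: real \<times> real. t0 \<le> snd z \<and> snd z \<le> fst z \<and> fst z \<le> T}"
  have "closed ?S"
    by (intro closed_Collect_conj closed_Collect_le continuous_intros)
  moreover have "bounded ?S"
  proof (rule bounded_subset)
    show "?S \<subseteq> cbox (t0, t0) (T, T)" by (auto simp: cbox_Pair_eq)
  qed (rule bounded_cbox)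
  ultimately have "compact ?S" by (simp add: compact_eq_bounded_closed)
  moreover have sub: "?S \<subseteq> kernel_domain" by (auto simp: kernel_domain_def)
  ultimately have "esssup (lebesgue_on ?S) (\<lambda>z. ereal (norm (case z of (t, \<tau>) \<Rightarrow> \<Phi> t \<tau>))) < \<infinity>"
    using b unfolding locally_ess_bounded_on_def by blast
  then obtain c where c: "AE z in lebesgue_on ?S. norm (case z of (t, \<tau>) \<Rightarrow> \<Phi> t \<tau>) \<le> c"
    by (rule esssup_norm_bound)
  have S: "?S \<in> sets borel" using \<open>closed ?S\<close> by (rule borel_closed)
  have "(\<lambda>(t, \<tau>). \<Phi> t \<tau>) \<in> borel_measurable (lebesgue_on ?S)"
    using m sub S by (elim measurable_restrict_mono) auto
  then obtain K where K: "K \<in> borel_measurable borel" "\<And>z. norm (K z) \<le> \<bar>c\<bar>"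
      "AE z in lborel. z \<in> ?S \<longrightarrow> (case z of (t, \<tau>) \<Rightarrow> \<Phi> t \<tau>) = K z"
    using bounded_borel_version[OF S _ c] by blast
  have "AE z in lborel \<Otimes>\<^sub>M lborel. z \<in> ?S \<longrightarrow> (case z of (t, \<tau>) \<Rightarrow> \<Phi> t \<tau>) = K z"
    using K(3) unfolding lborel_prod .
  from lborel_pair.AE_pair[OF this]
  have ae: "AE t in lebesgue. t \<in> {t0..T} \<longrightarrow> (AE \<tau> in lborel. \<tau> \<in> {t0..t} \<longrightarrow> \<Phi> t \<tau> = curry K t \<tau>)"
    unfolding AE_completion_iff
  proof eventually_elim
    case (elim t)
    then show ?case by (auto elim!: eventually_mono)
  qed
  show thesis
    using K(1,2) ae by (intro that[of "curry K" "\<bar>c\<bar>"]) (auto simp: borel_prod)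
qed

section \<open>The memory term\<close>

lemma aumann_integral_cong:
  "(\<And>\<tau>. \<tau> \<in> S \<Longrightarrow> F \<tau> = F' \<tau>) \<Longrightarrow> aumann_integral S F = aumann_integral S F'"
  unfolding aumann_integral_def by (simp cong: conj_cong imp_cong)

locale closed_loop = feedback_law P B C \<rho>
  for P :: "real ^ 'm ^ 'm" and B :: "real ^ 'm ^ 'n" and C :: "real ^ 'n ^ 'm" and \<rho> :: real +
  fixes A :: "real ^ 'n ^ 'n" and Bt :: "real ^ 'm ^ 'n" and \<Phi> :: "real \<Rightarrow> real \<Rightarrow> real ^ 'n ^ 'n"
    and \<gamma> :: "real \<Rightarrow> real ^ 'm" and p :: "real \<Rightarrow> real ^ 'n" and L :: "real ^ 'm ^ 'm" and t0 M \<delta> :: real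
  assumes \<Phi>_measurable: "(\<lambda>(t, \<tau>). \<Phi> t \<tau>) \<in> borel_measurable (lebesgue_on kernel_domain)"
    and \<Phi>_bounded: "locally_ess_bounded_on kernel_domain (\<lambda>(t, \<tau>). \<Phi> t \<tau>)"
    and \<gamma>: "L_infinity \<gamma>" and p: "L_infinity p"
    and CA: "C ** A = L ** C"
    and L: "neg_semidefinite (transpose L ** P + P ** L)"
    and \<delta>: "\<delta> > 0" and M: "M < 1"
    and memory_gain: "esssup (lebesgue_on {t0..})
           (\<lambda>t. enn2ereal (\<integral>\<^sup>+\<tau>\<in>{t0..t}.
              ennreal (wopnorm P (C ** \<Phi> t \<tau> ** Bt ** matrix_inv (C ** B))) \<partial>lebesgue)) \<le> ereal M"
    and gain: "AE t in lebesgue. t \<ge> t0 \<longrightarrow>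
           ennreal \<rho> \<ge> (ennreal (wnorm P (C *v (B *v \<gamma> t + p t)))
              + (\<integral>\<^sup>+\<tau>\<in>{t0..t}. ennreal (wnorm P ((C ** \<Phi> t \<tau> ** Bt) *v \<gamma> \<tau>)) \<partial>lebesgue)
              + ennreal \<delta>) / ennreal (1 - M)"
begin

definition present :: "real \<Rightarrow> real ^ 'n \<Rightarrow> (real ^ 'n) set" where
  "present = filippov_reg (\<lambda>t. drift A B (B *v \<gamma> t + p t))"

definition past :: "real \<Rightarrow> real ^ 'n \<Rightarrow> (real ^ 'n) set" where
  "past = filippov_reg (\<lambda>t. drift 0 Bt (Bt *v \<gamma> t))"

definition memory :: "(real \<Rightarrow> real ^ 'n) \<Rightarrow> real \<Rightarrow> (real ^ 'n) set" where
  "memory x t = aumann_integral {t0..t} (\<lambda>\<tau>. (*v) (\<Phi> t \<tau>) ` past \<tau> (x \<tau>))"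

abbreviation solution :: "real ^ 'n \<Rightarrow> real set \<Rightarrow> (real \<Rightarrow> real ^ 'n) \<Rightarrow> bool" where
  "solution \<equiv> closed_loop_solution A B Bt C \<Phi> \<gamma> p P \<rho> t0"

lemma solution_iff:
  "solution x0 I x \<longleftrightarrow>
     is_interval I \<and> t0 \<in> I \<and> I \<subseteq> {t0..} \<and>
     (\<forall>a b. {a..b} \<subseteq> I \<longrightarrow> abs_continuous_on {a..b} x) \<and> x t0 = x0 \<and>
     (AE t in lebesgue. t \<in> I \<longrightarrow> (\<exists>v w. v \<in> present t (x t) \<and> w \<in> memory x t \<and>
               (x has_vector_derivative v + w) (at t within I)))"
proof -
  have "(\<lambda>t x. A *v x + B *v (fb x + \<gamma> t) + p t) = (\<lambda>t. drift A B (B *v \<gamma> t + p t))"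
    "(\<lambda>t x. Bt *v (fb x + \<gamma> t)) = (\<lambda>t. drift 0 Bt (Bt *v \<gamma> t))"
    by (auto simp: drift_def matrix_vector_right_distrib fun_eq_iff)
  then show ?thesis
    unfolding closed_loop_solution_def filippov_solution_def present_def past_def memory_def by simp
qed

lemma memory_cong: "(\<And>\<tau>. \<tau> \<in> {t0..t} \<Longrightarrow> x \<tau> = z \<tau>) \<Longrightarrow> memory x t = memory z t"
  unfolding memory_def by (intro aumann_integral_cong) auto

text \<open>The integrand of the memory for a control \<open>u\<close>, with Borel representatives \<open>K\<close> and \<open>g\<close> of \<open>\<Phi>\<close> and \<open>\<gamma>\<close>.\<close>

definition selected :: "(real \<Rightarrow> real \<Rightarrow> real ^ 'n ^ 'n) \<Rightarrow> (real \<Rightarrow> real ^ 'm) \<Rightarrow> (real \<Rightarrow> real ^ 'm) \<Rightarrow> real \<Rightarrow> real \<Rightarrow> real ^ 'n" where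
  "selected K g u t \<tau> = K t \<tau> *v (Bt *v (u \<tau> + g \<tau>))"

text \<open>The feedback, with the value \<open>0\<close> on the surface, is a selection of its own regularization. The
  selection built from Borel representatives is admissible since it is constrained only almost everywhere.\<close>

lemma selected_mem_memory:
  assumes K: "case_prod K \<in> borel_measurable (borel \<Otimes>\<^sub>M borel)" and g: "g \<in> borel_measurable borel"
    and u: "u \<in> borel_measurable borel"
    and bd: "\<And>\<tau>. norm (selected K g u t \<tau>) \<le> c"
    and uz: "\<And>\<tau>. \<tau> \<in> {t0..t} \<Longrightarrow> u \<tau> = fb (z \<tau>)"
    and \<Phi>K: "AE \<tau> in lborel. \<tau> \<in> {t0..t} \<longrightarrow> \<Phi> t \<tau> = K t \<tau>" and \<gamma>g: "AE \<tau> in lborel. \<gamma> \<tau> = g \<tau>"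
  shows "(LINT \<tau>:{t0..t}|lborel. selected K g u t \<tau>) \<in> memory z t"
proof -
  have [measurable]: "K t \<in> borel_measurable borel"
    using measurable_compose[OF _ K, of "\<lambda>\<tau>. (t, \<tau>)" borel] by simp
  note [measurable] = g u
  have [measurable]: "selected K g u t \<in> borel_measurable borel"
    unfolding selected_def[abs_def] by measurable
  have int: "set_integrable lborel {t0..t} (selected K g u t)"
    using bd by (intro set_integrable_bounded_interval[where c = c]) auto
  have m: "(\<lambda>\<tau>. indicator {t0..t} \<tau> *\<^sub>R selected K g u t \<tau>) \<in> borel_measurable lborel"
    by measurable
  have i1: "set_integrable lebesgue {t0..t} (selected K g u t)"
    using int integrable_completion[OF m] by (simp add: set_integrable_def)
  have i2: "(LINT \<tau>:{t0..t}|lebesgue. selected K g u t \<tau>) = (LINT \<tau>:{t0..t}|lborel. selected K g u t \<tau>)"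
    using integral_completion[OF m] by (simp add: set_lebesgue_integral_def)
  have i3: "AE \<tau> in lebesgue. \<tau> \<in> {t0..t} \<longrightarrow> selected K g u t \<tau> \<in> (*v) (\<Phi> t \<tau>) ` past \<tau> (z \<tau>)"
    unfolding AE_completion_iff using \<Phi>K \<gamma>g
  proof eventually_elim
    case (elim \<tau>)
    have "Bt *v (fb (z \<tau>) + \<gamma> \<tau>) \<in> past \<tau> (z \<tau>)"
      using drift_mem_filippov_reg[of 0 Bt "\<lambda>t. Bt *v \<gamma> t" \<tau> "z \<tau>"]
      by (simp add: past_def drift_def matrix_vector_right_distrib)
    then show ?case using elim uz by (auto simp: selected_def)
  qed
  show ?thesis
    unfolding memory_def aumann_integral_def
    by (rule CollectI, rule exI[of _ "selected K g u t"], intro conjI i1 i3 i2[symmetric])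
qed

lemma past_elem:
  assumes "v \<in> past \<tau> y"
  obtains q where "wnorm P q \<le> 1" "v = Bt *v (- \<rho> *\<^sub>R (G *v q) + \<gamma> \<tau>)"
proof -
  obtain q where q: "wnorm P q \<le> 1" "v = Bt *v (- \<rho> *\<^sub>R (G *v q)) + Bt *v \<gamma> \<tau>"
    using assms unfolding past_def by (rule filippov_reg_drift_memory)
  show thesis
    by (rule that[OF q(1)]) (simp only: q(2) matrix_vector_right_distrib)
qed

text \<open>\<open>U\<close> bounds the regularized feedback, and \<open>c\<close> bounds the terms of the velocity other than \<open>A x\<close> and the
  integrand of the memory, everywhere and not only almost everywhere.\<close>

definition representatives :: "real \<Rightarrow> real \<Rightarrow> (real \<Rightarrow> real \<Rightarrow> real ^ 'n ^ 'n) \<Rightarrow> (real \<Rightarrow> real ^ 'm) \<Rightarrow>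
    (real \<Rightarrow> real ^ 'n) \<Rightarrow> real \<Rightarrow> bool" where
  "representatives T U K g p' c \<longleftrightarrow>
     (\<forall>q. wnorm P q \<le> 1 \<longrightarrow> norm (- \<rho> *\<^sub>R (G *v q)) \<le> U) \<and> 0 \<le> c \<and>
     case_prod K \<in> borel_measurable (borel \<Otimes>\<^sub>M borel) \<and> g \<in> borel_measurable borel \<and> p' \<in> borel_measurable borel \<and>
     (AE t in lborel. \<gamma> t = g t) \<and> (AE t in lborel. p t = p' t) \<and>
     (AE t in lebesgue. t \<in> {t0..T} \<longrightarrow> (AE \<tau> in lborel. \<tau> \<in> {t0..t} \<longrightarrow> \<Phi> t \<tau> = K t \<tau>)) \<and>
     (\<forall>t \<tau> y. norm y \<le> U \<longrightarrow> norm (K t \<tau> *v (Bt *v (y + g \<tau>))) \<le> c) \<and>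
     (\<forall>t \<tau> y. norm y \<le> U \<longrightarrow> norm (K t \<tau> *v (Bt *v y)) \<le> c) \<and>
     (\<forall>t. norm (B *v g t + p' t) \<le> c) \<and> (\<forall>y. norm y \<le> U \<longrightarrow> norm (B *v y) \<le> c)"

lemma representativesD:
  assumes "representatives T U K g p' c"
  shows "wnorm P q \<le> 1 \<Longrightarrow> norm (- \<rho> *\<^sub>R (G *v q)) \<le> U" "0 \<le> c"
    "case_prod K \<in> borel_measurable (borel \<Otimes>\<^sub>M borel)" "g \<in> borel_measurable borel" "p' \<in> borel_measurable borel"
    "AE t in lborel. \<gamma> t = g t" "AE t in lborel. p t = p' t"
    "AE t in lebesgue. t \<in> {t0..T} \<longrightarrow> (AE \<tau> in lborel. \<tau> \<in> {t0..t} \<longrightarrow> \<Phi> t \<tau> = K t \<tau>)"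
    "norm y \<le> U \<Longrightarrow> norm (K t \<tau> *v (Bt *v (y + g \<tau>))) \<le> c"
    "norm y \<le> U \<Longrightarrow> norm (K t \<tau> *v (Bt *v y)) \<le> c"
    "norm (B *v g t + p' t) \<le> c" "norm y \<le> U \<Longrightarrow> norm (B *v y) \<le> c"
  using assms unfolding representatives_def by blast+

lemma representatives_mono:
  assumes r: "representatives T U K g p' d" and "d \<le> c"
  shows "representatives T U K g p' c"
  unfolding representatives_def
  by (intro conjI allI impI; (fact representativesD[OF r] | rule order_trans[OF _ \<open>d \<le> c\<close>], erule representativesD[OF r] |
      rule order_trans[OF _ \<open>d \<le> c\<close>], rule representativesD[OF r]))

lemma representatives_exist:
  obtains U K g p' c where "representatives T U K g p' c"
proof -
  obtain U where U: "U \<ge> 0" "\<And>q. wnorm P q \<le> 1 \<Longrightarrow> norm (- \<rho> *\<^sub>R (G *v q)) \<le> U"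
    by (rule fb_bounded) blast
  obtain b where b: "b > 0" "\<And>y. norm (B *v y) \<le> norm y * b"
    using bounded_linear.pos_bounded[OF matrix_vector_mul_bounded_linear] by blast
  obtain bt where bt: "bt > 0" "\<And>y. norm (Bt *v y) \<le> norm y * bt"
    using bounded_linear.pos_bounded[OF matrix_vector_mul_bounded_linear] by blast
  obtain \<kappa> where \<kappa>: "\<kappa> > 0" "\<And>(Q :: real ^ 'n ^ 'n) y. norm (Q *v y) \<le> norm Q * norm y * \<kappa>"
    using bounded_bilinear.pos_bounded[OF bounded_bilinear_matrix_vector] by blast
  obtain g cg where g: "g \<in> borel_measurable borel" "\<And>t. norm (g t) \<le> cg" "AE t in lborel. \<gamma> t = g t"
    by (rule L_infinity_borel_version[OF \<gamma>]) blast
  obtain p' cp where p': "p' \<in> borel_measurable borel" "\<And>t. norm (p' t) \<le> cp" "AE t in lborel. p t = p' t"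
    by (rule L_infinity_borel_version[OF p]) blast
  obtain K k where K: "case_prod K \<in> borel_measurable (borel \<Otimes>\<^sub>M borel)" "\<And>t \<tau>. norm (K t \<tau>) \<le> k"
    "AE t in lebesgue. t \<in> {t0..T} \<longrightarrow> (AE \<tau> in lborel. \<tau> \<in> {t0..t} \<longrightarrow> \<Phi> t \<tau> = K t \<tau>)"
    by (rule kernel_borel_version[OF \<Phi>_measurable \<Phi>_bounded, of t0 T]) blast
  have nonneg: "0 \<le> cg" "0 \<le> cp" "0 \<le> k"
    using order_trans[OF norm_ge_zero g(2)] order_trans[OF norm_ge_zero p'(2)] order_trans[OF norm_ge_zero K(2)] by auto
  define c where "c = k * ((U + cg) * bt) * \<kappa> + (cg * b + cp) + U * b"
  have kern: "norm (K t \<tau> *v (Bt *v y)) \<le> k * ((U + cg) * bt) * \<kappa>" if "norm y \<le> U + cg" for t \<tau> y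
  proof -
    have "norm (K t \<tau> *v (Bt *v y)) \<le> norm (K t \<tau>) * norm (Bt *v y) * \<kappa>" by (rule \<kappa>(2))
    also have "\<dots> \<le> k * (norm y * bt) * \<kappa>"
      using K(2) bt(2) \<kappa>(1) nonneg by (intro mult_right_mono mult_mono) auto
    also have "\<dots> \<le> k * ((U + cg) * bt) * \<kappa>"
      using that bt(1) \<kappa>(1) nonneg by (intro mult_right_mono mult_left_mono) auto
    finally show ?thesis .
  qed
  have parts: "0 \<le> k * ((U + cg) * bt) * \<kappa>" "0 \<le> cg * b + cp" "0 \<le> U * b"
    using nonneg U(1) b(1) bt(1) \<kappa>(1) by auto
  have "representatives T U K g p' c"
    unfolding representatives_def
  proof (intro conjI allI impI)
    show "0 \<le> c" using parts by (simp add: c_def)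
    show "norm (K t \<tau> *v (Bt *v (y + g \<tau>))) \<le> c" if "norm y \<le> U" for t \<tau> y
      using kern[of "y + g \<tau>" t \<tau>] that g(2)[of \<tau>] norm_triangle_ineq[of y "g \<tau>"] parts by (simp add: c_def)
    show "norm (K t \<tau> *v (Bt *v y)) \<le> c" if "norm y \<le> U" for t \<tau> y
      using kern[of y t \<tau>] that nonneg parts by (simp add: c_def)
    show "norm (B *v y) \<le> c" if "norm y \<le> U" for y
      using b(2)[of y] mult_right_mono[OF that, of b] b(1) parts unfolding c_def by linarith
    show "norm (B *v g t + p' t) \<le> c" for t
      using b(2)[of "g t"] mult_right_mono[OF g(2)[of t], of b] b(1) p'(2)[of t] parts
        norm_triangle_ineq[of "B *v g t" "p' t"] unfolding c_def by linarith
  qed (fact U(2) K(1,3) g(1,3) p'(1,3))+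
  then show thesis by (rule that)
qed

text \<open>The slope \<open>onorm ((*v) A)\<close> is the same for all \<open>T\<close>; only the constant \<open>c\<close> grows with \<open>T\<close>.\<close>

lemma velocity_bound:
  "\<exists>c\<ge>0. AE t in lebesgue. t \<in> {t0..T} \<longrightarrow> (\<forall>x v w. v \<in> present t (x t) \<and> w \<in> memory x t \<longrightarrow>
     norm (v + w) \<le> onorm ((*v) A) * norm (x t) + c)"
proof -
  define a where "a = onorm ((*v) A)"
  have a: "0 \<le> a" "\<And>z. norm (A *v z) \<le> a * norm z"
    using onorm_pos_le onorm matrix_vector_mul_bounded_linear by (auto simp: a_def)
  obtain U K g p' d where "representatives T U K g p' d" by (rule representatives_exist)
  note rep = representativesD[OF this]
  note U = rep(1) and d = rep(2) and ae = rep(6-8) and bd = rep(9-12)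
  have Bfb: "norm (B *v fb z) \<le> d" for z
    using bd(4)[OF U[of "dir z"]] wnorm_dir[of z] by (simp add: fb_dir)
  define c where "c = a + d + d + d * \<bar>T - t0\<bar>"
  have "c \<ge> 0" using a d by (simp add: c_def)
  moreover have "AE t in lebesgue. t \<in> {t0..T} \<longrightarrow>
     (\<forall>x v w. v \<in> present t (x t) \<and> w \<in> memory x t \<longrightarrow> norm (v + w) \<le> a * norm (x t) + c)"
    unfolding AE_completion_iff using ae(3)[unfolded AE_completion_iff] ae(1,2)
  proof eventually_elim
    case (elim t)
    show ?case
    proof (intro impI allI, elim conjE)
      fix x v w assume t: "t \<in> {t0..T}" and v: "v \<in> present t (x t)" and w: "w \<in> memory x t"
      have "norm v \<le> a * (norm (x t) + 1) + d + norm (B *v \<gamma> t + p t)"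
        using v a Bfb unfolding present_def by (intro filippov_reg_drift_bound) auto
      also have "norm (B *v \<gamma> t + p t) \<le> d"
        using bd(3)[of t] elim by simp
      finally have nv: "norm v \<le> a * norm (x t) + (a + d + d)"
        by (simp add: algebra_simps)
      obtain f where f: "set_integrable lebesgue {t0..t} f" "w = (LINT \<tau>:{t0..t}|lebesgue. f \<tau>)"
        "AE \<tau> in lebesgue. \<tau> \<in> {t0..t} \<longrightarrow> f \<tau> \<in> (*v) (\<Phi> t \<tau>) ` past \<tau> (x \<tau>)"
        using w unfolding memory_def aumann_integral_def by auto
      have "AE \<tau> in lborel. \<tau> \<in> {t0..t} \<longrightarrow> \<Phi> t \<tau> = K t \<tau>" using elim t by blast
      then have fd: "AE \<tau> in lebesgue. \<tau> \<in> {t0..t} \<longrightarrow> norm (f \<tau>) \<le> d"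
        using f(3) ae(1) unfolding AE_completion_iff
      proof eventually_elim
        case (elim \<tau>)
        show ?case
        proof
          assume \<tau>: "\<tau> \<in> {t0..t}"
          then obtain v' where v': "v' \<in> past \<tau> (x \<tau>)" "f \<tau> = K t \<tau> *v v'" using elim by auto
          then obtain q where "wnorm P q \<le> 1" "v' = Bt *v (- \<rho> *\<^sub>R (G *v q) + g \<tau>)"
            using past_elem[OF v'(1)] elim by (metis (no_types))
          then show "norm (f \<tau>) \<le> d" using bd(1)[OF U] v'(2) by simp
        qed
      qed
      have "norm w \<le> (LINT \<tau>:{t0..t}|lebesgue. norm (f \<tau>))"
        unfolding f(2) by (rule set_integral_norm_bound[OF f(1)])
      also have "\<dots> \<le> (LINT \<tau>:{t0..t}|lebesgue. d)"
        unfolding set_lebesgue_integral_def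
      proof (rule integral_mono_AE)
        show "integrable lebesgue (\<lambda>\<tau>. indicator {t0..t} \<tau> *\<^sub>R norm (f \<tau>))"
          using set_integrable_norm[OF f(1)] by (simp add: set_integrable_def)
        show "integrable lebesgue (\<lambda>\<tau>. indicator {t0..t} \<tau> *\<^sub>R d)"
          by (intro integrable_scaleR_left integrable_real_indicator) (auto simp: emeasure_lborel_Icc_eq)
        show "AE \<tau> in lebesgue. indicator {t0..t} \<tau> *\<^sub>R norm (f \<tau>) \<le> indicator {t0..t} \<tau> *\<^sub>R d"
          using fd by eventually_elim (auto simp: indicator_def)
      qed
      also have "\<dots> = d * (t - t0)"
        using t by (simp add: set_lebesgue_integral_def)
      also have "\<dots> \<le> d * \<bar>T - t0\<bar>"
        using t d by (intro mult_left_mono) auto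
      finally show "norm (v + w) \<le> a * norm (x t) + c"
        using nv norm_triangle_ineq[of v w] by (simp add: c_def)
    qed
  qed
  ultimately show ?thesis unfolding a_def by blast
qed

text \<open>The bounded horizons of \<open>kernel_borel_version\<close> are exhausted by countably many of them.\<close>

lemma kernel_section_borel:
  "AE t in lebesgue. t \<ge> t0 \<longrightarrow> (\<exists>K. K \<in> borel_measurable borel \<and> (AE \<tau> in lborel. \<tau> \<in> {t0..t} \<longrightarrow> \<Phi> t \<tau> = K \<tau>))"
proof -
  have "AE t in lebesgue. t \<in> {t0..t0 + real n} \<longrightarrow>
      (\<exists>K. K \<in> borel_measurable borel \<and> (AE \<tau> in lborel. \<tau> \<in> {t0..t} \<longrightarrow> \<Phi> t \<tau> = K \<tau>))" for n
  proof -
    obtain K where K: "case_prod K \<in> borel_measurable (borel \<Otimes>\<^sub>M borel)"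
      "AE t in lebesgue. t \<in> {t0..t0 + real n} \<longrightarrow> (AE \<tau> in lborel. \<tau> \<in> {t0..t} \<longrightarrow> \<Phi> t \<tau> = K t \<tau>)"
      by (rule kernel_borel_version[OF \<Phi>_measurable \<Phi>_bounded, of t0 "t0 + real n"]) blast
    have "K t \<in> borel_measurable borel" for t
      using measurable_compose[OF _ K(1), of "\<lambda>\<tau>. (t, \<tau>)" borel] by simp
    then show ?thesis using K(2) by (elim eventually_mono) blast
  qed
  then have "AE t in lebesgue. \<forall>n. t \<in> {t0..t0 + real n} \<longrightarrow>
      (\<exists>K. K \<in> borel_measurable borel \<and> (AE \<tau> in lborel. \<tau> \<in> {t0..t} \<longrightarrow> \<Phi> t \<tau> = K \<tau>))"
    by (simp only: AE_all_countable) blast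
  then show ?thesis
  proof eventually_elim
    case (elim t)
    obtain n where "t - t0 \<le> real n" using real_arch_simple by blast
    then have "t0 \<le> t \<Longrightarrow> t \<in> {t0..t0 + real n}" by auto
    then show ?case using elim by blast
  qed
qed

text \<open>Pairing \<open>C w\<close> with \<open>s = C w\<close> in the inner product of \<open>P\<close> turns the norm of the integral into the integral of a
  scalar, which is estimated pointwise by the Cauchy-Schwarz inequality and the form of the remembered
  velocities. The operator norm along the kernel enters through a measurable function \<open>u\<close> below it, because the
  integral of a sum splits only for measurable summands.\<close>

lemma memory_elem_wnorm_bound:
  assumes w: "w \<in> memory x t"
    and N: "(\<integral>\<^sup>+\<tau>\<in>{t0..t}. ennreal (wopnorm P (C ** \<Phi> t \<tau> ** Bt ** G)) \<partial>lebesgue) \<le> ennreal m" and "0 \<le> m"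
    and J: "(\<integral>\<^sup>+\<tau>\<in>{t0..t}. ennreal (wnorm P ((C ** \<Phi> t \<tau> ** Bt) *v \<gamma> \<tau>)) \<partial>lebesgue) = ennreal j" and "0 \<le> j"
    and K: "K \<in> borel_measurable borel" "AE \<tau> in lborel. \<tau> \<in> {t0..t} \<longrightarrow> \<Phi> t \<tau> = K \<tau>"
  shows "wnorm P (C *v w) \<le> \<rho> * m + j"
proof (cases "C *v w = 0")
  case True
  then show ?thesis using \<rho> assms by simp
next
  case False
  define s where "s = C *v w"
  define ws where "ws = wnorm P s"
  have ws: "ws > 0" using False wnorm_pos by (simp add: s_def ws_def)
  obtain g where g[measurable]: "g \<in> borel_measurable borel" and \<gamma>g: "AE \<tau> in lborel. \<gamma> \<tau> = g \<tau>"
    by (rule L_infinity_borel_version[OF \<gamma>]) blast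
  note [measurable] = K(1)
  obtain f where f: "set_integrable lebesgue {t0..t} f" "w = (LINT \<tau>:{t0..t}|lebesgue. f \<tau>)"
    "AE \<tau> in lebesgue. \<tau> \<in> {t0..t} \<longrightarrow> f \<tau> \<in> (*v) (\<Phi> t \<tau>) ` past \<tau> (x \<tau>)"
    using w unfolding memory_def aumann_integral_def by auto
  define T where "T y = (C *v y) \<bullet> (P *v s)" for y
  have T: "bounded_linear T"
    unfolding T_def by (intro bounded_linear_inner_left_comp matrix_vector_mul_bounded_linear)
  define e where "e \<tau> = wnorm P (C *v (K \<tau> *v (Bt *v g \<tau>)))" for \<tau>
  have [measurable]: "e \<in> borel_measurable borel" unfolding e_def[abs_def] by measurable
  define h where "h \<tau> = norm (T (indicator {t0..t} \<tau> *\<^sub>R f \<tau>))" for \<tau>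
  have int: "integrable lebesgue (\<lambda>\<tau>. T (indicator {t0..t} \<tau> *\<^sub>R f \<tau>))"
    using f(1) unfolding set_integrable_def by (rule integrable_bounded_linear[OF T])
  have h_meas: "h \<in> borel_measurable lebesgue"
    unfolding h_def[abs_def] by (rule measurable_compose[OF borel_measurable_integrable[OF int] borel_measurable_norm])
  have e_meas: "e \<in> borel_measurable lebesgue"
    using measurable_completion[of e lborel borel] by simp
  have ind_meas: "(\<lambda>\<tau>. indicator {t0..t} \<tau> :: real) \<in> borel_measurable lebesgue"
    by (intro borel_measurable_indicator) auto
  \<comment> \<open>The pointwise estimate \<open>bound\<close> below, solved for the operator norm.\<close>
  define u where "u \<tau> = max 0 ((h \<tau> - ws * e \<tau>) / (ws * \<rho>)) * indicator {t0..t} \<tau>" for \<tau>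
  have u_meas: "u \<in> borel_measurable lebesgue"
    unfolding u_def[abs_def] using h_meas e_meas ind_meas
    by (intro borel_measurable_times borel_measurable_max borel_measurable_divide borel_measurable_diff borel_measurable_const)
  have bound: "AE \<tau> in lebesgue. \<tau> \<in> {t0..t} \<longrightarrow>
      h \<tau> \<le> ws * (\<rho> * wopnorm P (C ** \<Phi> t \<tau> ** Bt ** G) + e \<tau>)"
    using f(3) K(2) \<gamma>g unfolding AE_completion_iff
  proof eventually_elim
    case (elim \<tau>)
    show ?case
    proof
      assume \<tau>: "\<tau> \<in> {t0..t}"
      then obtain v where v: "v \<in> past \<tau> (x \<tau>)" "f \<tau> = \<Phi> t \<tau> *v v" using elim by auto
      obtain q where q: "wnorm P q \<le> 1" "v = Bt *v (- \<rho> *\<^sub>R (G *v q) + \<gamma> \<tau>)"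
        using past_elem[OF v(1)] by metis
      let ?Q = "C ** \<Phi> t \<tau> ** Bt ** G"
      have eq: "C *v f \<tau> = (- \<rho>) *\<^sub>R (?Q *v q) + C *v (K \<tau> *v (Bt *v g \<tau>))"
        using \<tau> elim
        by (simp only: v q matrix_vector_right_distrib matrix_vector_mult_scaleR matrix_vector_mul_assoc[symmetric])
      have "wnorm P (C *v f \<tau>) \<le> \<rho> * wnorm P (?Q *v q) + e \<tau>"
        using wnorm_triangle[of "(- \<rho>) *\<^sub>R (?Q *v q)" "C *v (K \<tau> *v (Bt *v g \<tau>))"] \<rho>
        unfolding eq e_def wnorm_scaleR by simp
      also have "\<rho> * wnorm P (?Q *v q) \<le> \<rho> * (wopnorm P ?Q * 1)"
        using \<rho> by (intro mult_left_mono order_trans[OF wnorm_le_wopnorm mult_left_mono[OF q(1) wopnorm_nonneg]]) auto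
      finally have "wnorm P (C *v f \<tau>) \<le> \<rho> * wopnorm P ?Q + e \<tau>" by simp
      then have "wnorm P (C *v f \<tau>) * ws \<le> (\<rho> * wopnorm P ?Q + e \<tau>) * ws"
        using ws by (intro mult_right_mono) auto
      moreover have "h \<tau> \<le> wnorm P (C *v f \<tau>) * ws"
        using \<tau> wnorm_Cauchy_Schwarz_abs[of "C *v f \<tau>" s] by (simp add: h_def T_def ws_def)
      ultimately show "h \<tau> \<le> ws * (\<rho> * wopnorm P ?Q + e \<tau>)"
        by (simp add: mult.commute)
    qed
  qed
  have u_le: "(\<integral>\<^sup>+\<tau>. ennreal (u \<tau>) \<partial>lebesgue) \<le> ennreal m"
  proof (rule order_trans[OF nn_integral_mono_AE N])
    show "AE \<tau> in lebesgue. ennreal (u \<tau>) \<le> ennreal (wopnorm P (C ** \<Phi> t \<tau> ** Bt ** G)) * indicator {t0..t} \<tau>"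
      using bound
    proof eventually_elim
      case (elim \<tau>)
      show ?case
      proof (cases "\<tau> \<in> {t0..t}")
        case True
        have "(h \<tau> - ws * e \<tau>) / (ws * \<rho>) \<le> wopnorm P (C ** \<Phi> t \<tau> ** Bt ** G)"
          using elim True ws \<rho> by (simp add: divide_le_eq algebra_simps)
        then show ?thesis
          using True wopnorm_nonneg by (simp add: u_def ennreal_leI)
      qed (simp add: u_def)
    qed
  qed
  have e_int: "(\<integral>\<^sup>+\<tau>. ennreal (indicator {t0..t} \<tau> * e \<tau>) \<partial>lebesgue) = ennreal j"
    unfolding J[symmetric]
  proof (rule nn_integral_cong_AE)
    show "AE \<tau> in lebesgue. ennreal (indicator {t0..t} \<tau> * e \<tau>) =
        ennreal (wnorm P ((C ** \<Phi> t \<tau> ** Bt) *v \<gamma> \<tau>)) * indicator {t0..t} \<tau>"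
      unfolding AE_completion_iff using K(2) \<gamma>g
      by eventually_elim (auto simp: indicator_def e_def matrix_vector_mul_assoc matrix_mul_assoc)
  qed
  have "T w = (LINT \<tau>|lebesgue. T (indicator {t0..t} \<tau> *\<^sub>R f \<tau>))"
    unfolding f(2) set_lebesgue_integral_def
    using f(1) unfolding set_integrable_def by (rule integral_bounded_linear[OF T, symmetric])
  moreover have "T w = ws * ws" by (simp add: T_def ws_def s_def flip: wnorm_square power2_eq_square)
  ultimately have I: "(LINT \<tau>|lebesgue. T (indicator {t0..t} \<tau> *\<^sub>R f \<tau>)) = ws * ws" by simp
  have "ennreal (ws * ws) \<le> (\<integral>\<^sup>+\<tau>. ennreal (h \<tau>) \<partial>lebesgue)"
    using integral_norm_bound_ennreal[OF int] ws unfolding I h_def by simp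
  also have "\<dots> \<le> (\<integral>\<^sup>+\<tau>. ennreal (ws * \<rho>) * ennreal (u \<tau>) + ennreal ws * ennreal (indicator {t0..t} \<tau> * e \<tau>) \<partial>lebesgue)"
  proof (rule nn_integral_mono)
    fix \<tau>
    have e0: "0 \<le> e \<tau>" by (simp add: e_def)
    have "h \<tau> \<le> (ws * \<rho>) * u \<tau> + ws * (indicator {t0..t} \<tau> * e \<tau>)"
    proof (cases "\<tau> \<in> {t0..t}")
      case True
      have "(h \<tau> - ws * e \<tau>) = (ws * \<rho>) * ((h \<tau> - ws * e \<tau>) / (ws * \<rho>))" using ws \<rho> by simp
      also have "\<dots> \<le> (ws * \<rho>) * u \<tau>" using True ws \<rho> by (intro mult_left_mono) (auto simp: u_def)
      finally show ?thesis using True by simp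
    qed (simp add: h_def u_def linear_simps[OF T])
    then have "ennreal (h \<tau>) \<le> ennreal ((ws * \<rho>) * u \<tau> + ws * (indicator {t0..t} \<tau> * e \<tau>))"
      by (rule ennreal_leI)
    also have "\<dots> = ennreal (ws * \<rho>) * ennreal (u \<tau>) + ennreal ws * ennreal (indicator {t0..t} \<tau> * e \<tau>)"
      using ws \<rho> e0 by (simp add: ennreal_mult' ennreal_plus u_def)
    finally show "ennreal (h \<tau>) \<le> ennreal (ws * \<rho>) * ennreal (u \<tau>) + ennreal ws * ennreal (indicator {t0..t} \<tau> * e \<tau>)" .
  qed
  also have "\<dots> = ennreal (ws * \<rho>) * (\<integral>\<^sup>+\<tau>. ennreal (u \<tau>) \<partial>lebesgue)
      + ennreal ws * (\<integral>\<^sup>+\<tau>. ennreal (indicator {t0..t} \<tau> * e \<tau>) \<partial>lebesgue)"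
  proof -
    have "(\<lambda>\<tau>. ennreal (u \<tau>)) \<in> borel_measurable lebesgue"
      "(\<lambda>\<tau>. ennreal (indicator {t0..t} \<tau> * e \<tau>)) \<in> borel_measurable lebesgue"
      using u_meas borel_measurable_times[OF ind_meas e_meas] by (auto intro!: measurable_compose[OF _ measurable_ennreal])
    then show ?thesis
      by (subst nn_integral_add) (auto simp only: nn_integral_cmult intro!: borel_measurable_times_ennreal borel_measurable_const)
  qed
  also have "\<dots> \<le> ennreal (ws * \<rho>) * ennreal m + ennreal ws * ennreal j"
    using u_le e_int by (intro add_mono mult_left_mono) auto
  also have "\<dots> = ennreal (ws * (\<rho> * m + j))"
    using ws \<rho> \<open>0 \<le> m\<close> \<open>0 \<le> j\<close> by (simp add: ennreal_mult[symmetric] ennreal_plus[symmetric] algebra_simps del: ennreal_plus)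
  finally have "ws * ws \<le> ws * (\<rho> * m + j)"
    using ws \<rho> \<open>0 \<le> m\<close> \<open>0 \<le> j\<close> by (subst (asm) ennreal_le_iff) auto
  then show ?thesis using ws by (simp add: ws_def s_def)
qed

text \<open>Memory and disturbance leave at least \<open>\<delta>\<close> of the gain \<open>\<rho>\<close>. Away from the surface the norm of the output
  decays at least at this rate; on the surface, a control within the gain cancels both.\<close>

lemma control_margin:
  "AE t in lebesgue. t \<ge> t0 \<longrightarrow> (\<forall>x w. w \<in> memory x t \<longrightarrow>
     wnorm P (C *v w) + wnorm P (C *v (B *v \<gamma> t + p t)) \<le> \<rho> - \<delta>)"
proof -
  have "AE t in lebesgue_on {t0..}. enn2ereal (\<integral>\<^sup>+\<tau>\<in>{t0..t}.
              ennreal (wopnorm P (C ** \<Phi> t \<tau> ** Bt ** G)) \<partial>lebesgue) \<le> ereal M"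
    using esssup_AE by eventually_elim (use memory_gain in \<open>auto simp: G_def intro: order_trans\<close>)
  then have "AE t in lebesgue. t \<in> {t0..} \<longrightarrow> enn2ereal (\<integral>\<^sup>+\<tau>\<in>{t0..t}.
              ennreal (wopnorm P (C ** \<Phi> t \<tau> ** Bt ** G)) \<partial>lebesgue) \<le> ereal M"
    by (subst (asm) AE_restrict_space_iff) auto
  then show ?thesis
    using gain kernel_section_borel
  proof eventually_elim
    case (elim t)
    show ?case
    proof (intro impI allI)
      fix x w assume t: "t0 \<le> t" and w: "w \<in> memory x t"
      let ?N = "\<integral>\<^sup>+\<tau>\<in>{t0..t}. ennreal (wopnorm P (C ** \<Phi> t \<tau> ** Bt ** G)) \<partial>lebesgue"
      let ?J = "\<integral>\<^sup>+\<tau>\<in>{t0..t}. ennreal (wnorm P ((C ** \<Phi> t \<tau> ** Bt) *v \<gamma> \<tau>)) \<partial>lebesgue"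
      let ?d = "wnorm P (C *v (B *v \<gamma> t + p t))"
      have NM: "enn2ereal ?N \<le> ereal M" using elim t by simp
      then have M0: "0 \<le> M" using order_trans[OF enn2ereal_nonneg NM] by simp
      then have N: "?N \<le> ennreal M" using NM by (simp add: less_eq_ennreal.rep_eq enn2ereal_ennreal)
      have "(ennreal ?d + ?J + ennreal \<delta>) / ennreal (1 - M) \<le> ennreal \<rho>" using elim t by simp
      then have "(ennreal ?d + ?J + ennreal \<delta>) / ennreal (1 - M) * ennreal (1 - M) \<le> ennreal \<rho> * ennreal (1 - M)"
        by (rule mult_right_mono) simp
      also have "(ennreal ?d + ?J + ennreal \<delta>) / ennreal (1 - M) * ennreal (1 - M) = ennreal ?d + ?J + ennreal \<delta>"
        using M by (simp add: ennreal_divide_times)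
      also have "ennreal \<rho> * ennreal (1 - M) = ennreal (\<rho> * (1 - M))"
        using \<rho> M by (simp add: ennreal_mult)
      finally have le: "ennreal ?d + ?J + ennreal \<delta> \<le> ennreal (\<rho> * (1 - M))" .
      then have "?J \<noteq> \<infinity>" by (auto simp: top_unique)
      then obtain j where j: "0 \<le> j" "?J = ennreal j" by (cases ?J) auto
      have dj: "?d + j + \<delta> \<le> \<rho> * (1 - M)"
        using le \<delta> j \<rho> M by (simp add: ennreal_plus[symmetric] del: ennreal_plus)
      obtain K where K: "K \<in> borel_measurable borel" "AE \<tau> in lborel. \<tau> \<in> {t0..t} \<longrightarrow> \<Phi> t \<tau> = K \<tau>"
        using elim t by blast
      have "wnorm P (C *v w) \<le> \<rho> * M + j"
        by (rule memory_elem_wnorm_bound[OF w N M0 j(2,1) K])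
      then show "wnorm P (C *v w) + ?d \<le> \<rho> - \<delta>"
        using dj by (simp add: algebra_simps)
    qed
  qed
qed

end

section \<open>Trajectories\<close>

lemma is_interval_Icc_subset:
  fixes I :: "real set"
  assumes "is_interval I" "u \<in> I" "v \<in> I"
  shows "{u..v} \<subseteq> I"
  using assms unfolding is_interval_1 by (meson atLeastAtMost_iff subsetI)

context closed_loop
begin

definition moves :: "(real \<Rightarrow> real ^ 'n) \<Rightarrow> real \<Rightarrow> bool" where
  "moves x t \<longleftrightarrow> (\<exists>v w. v \<in> present t (x t) \<and> w \<in> memory x t \<and> (x has_vector_derivative v + w) (at t))"

text \<open>A solution on \<open>{t0..T}\<close>, with a Lipschitz condition in place of absolute continuity: the two agree because
  velocities are bounded on bounded sets, and Lipschitz pieces are easier to join. The initial value is left free.\<close>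

definition trajectory :: "real \<Rightarrow> (real \<Rightarrow> real ^ 'n) \<Rightarrow> bool" where
  "trajectory T x \<longleftrightarrow> (\<exists>K. K-lipschitz_on {t0..T} x) \<and> (AE t in lebesgue. t \<in> {t0<..<T} \<longrightarrow> moves x t)"

lemma moves_cong:
  assumes eq: "\<And>s. s \<in> {t0..T} \<Longrightarrow> x s = z s" and t: "t \<in> {t0<..<T}" and x: "moves x t"
  shows "moves z t"
proof -
  have "memory x t = memory z t" using eq t by (intro memory_cong) auto
  moreover have "(z has_vector_derivative D) (at t)" if "(x has_vector_derivative D) (at t)" for D
    using that by (rule has_vector_derivative_transform_within_open[where S = "{t0<..<T}"]) (use eq t in auto)
  moreover have "x t = z t" using eq t by auto
  ultimately show ?thesis using x unfolding moves_def by metis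
qed

lemma trajectory_cong:
  assumes eq: "\<And>s. s \<in> {t0..T} \<Longrightarrow> x s = z s" and x: "trajectory T x"
  shows "trajectory T z"
  unfolding trajectory_def
proof
  show "\<exists>K. K-lipschitz_on {t0..T} z"
    using x lipschitz_on_transform[of _ "{t0..T}" x z] eq unfolding trajectory_def by metis
  have "AE t in lebesgue. t \<in> {t0<..<T} \<longrightarrow> moves x t" using x by (simp add: trajectory_def)
  then show "AE t in lebesgue. t \<in> {t0<..<T} \<longrightarrow> moves z t"
    by eventually_elim (use moves_cong[of T x z, OF eq] in blast)
qed

lemma trajectory_mono:
  assumes x: "trajectory T x" and "S \<le> T"
  shows "trajectory S x"
  unfolding trajectory_def
proof
  obtain K where "K-lipschitz_on {t0..T} x" using x unfolding trajectory_def by blast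
  then have "K-lipschitz_on {t0..S} x" by (rule lipschitz_on_mono) (use \<open>S \<le> T\<close> in auto)
  then show "\<exists>K. K-lipschitz_on {t0..S} x" by blast
  have "AE t in lebesgue. t \<in> {t0<..<T} \<longrightarrow> moves x t" using x by (simp add: trajectory_def)
  then show "AE t in lebesgue. t \<in> {t0<..<S} \<longrightarrow> moves x t"
    by eventually_elim (use \<open>S \<le> T\<close> in auto)
qed

lemma solution_moves:
  assumes "solution x0 I x"
  shows "AE t in lebesgue. t \<in> interior I \<longrightarrow> moves x t"
proof -
  have "AE t in lebesgue. t \<in> I \<longrightarrow> (\<exists>v w. v \<in> present t (x t) \<and> w \<in> memory x t \<and>
               (x has_vector_derivative v + w) (at t within I))"
    using assms unfolding solution_iff by blast
  then show ?thesis
  proof eventually_elim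
    case (elim t)
    show ?case
    proof
      assume t: "t \<in> interior I"
      then have "t \<in> I" using interior_subset by blast
      then obtain v w where "v \<in> present t (x t)" "w \<in> memory x t" "(x has_vector_derivative v + w) (at t within I)"
        using elim by blast
      then show "moves x t"
        unfolding moves_def at_within_interior[OF t] by blast
    qed
  qed
qed

text \<open>Only a bound for \<open>x\<close> near the right end, where \<open>I\<close> may be open, needs an argument. On an interval of length
  \<open>d\<close> with \<open>a * d \<le> 1 / 2\<close> the largest value of \<open>norm (x r)\<close> exceeds that at the left end by at most half of
  itself and a constant.\<close>

lemma solution_lipschitz:
  assumes I: "is_interval I" "t0 \<in> I" "I \<subseteq> {t0..T}" and near: "\<And>e. e > 0 \<Longrightarrow> \<exists>s\<in>I. T - e \<le> s"
    and ac: "\<And>a b. {a..b} \<subseteq> I \<Longrightarrow> abs_continuous_on {a..b} x"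
    and mv: "AE t in lebesgue. t \<in> interior I \<longrightarrow> moves x t"
  obtains K where "K-lipschitz_on I x"
proof -
  define a where "a = onorm ((*v) A)"
  have a: "0 \<le> a" using onorm_pos_le matrix_vector_mul_bounded_linear by (auto simp: a_def)
  obtain c where c: "0 \<le> c" and vel: "AE t in lebesgue. t \<in> {t0..T} \<longrightarrow> (\<forall>x v w. v \<in> present t (x t) \<and> w \<in> memory x t \<longrightarrow>
     norm (v + w) \<le> a * norm (x t) + c)"
    using velocity_bound[of T] unfolding a_def by blast
  have sub: "{u..v} \<subseteq> I" if "u \<in> I" "v \<in> I" for u v
    using is_interval_Icc_subset[OF I(1) that] .
  have vel_x: "AE t in lebesgue. t \<in> interior I \<longrightarrow> (\<exists>D. (x has_vector_derivative D) (at t) \<and> norm D \<le> a * norm (x t) + c)"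
    using mv vel
  proof eventually_elim
    case (elim t)
    show ?case
    proof
      assume t: "t \<in> interior I"
      then have "t \<in> {t0..T}" using interior_subset I(3) by blast
      then show "\<exists>D. (x has_vector_derivative D) (at t) \<and> norm D \<le> a * norm (x t) + c"
        using elim t unfolding moves_def by blast
    qed
  qed
  have incr: "norm (x v - x u) \<le> (a * m + c) * (v - u)"
    if uv: "u \<in> I" "v \<in> I" "u \<le> v" and m: "\<And>t. t \<in> {u..v} \<Longrightarrow> norm (x t) \<le> m" for u v m
  proof (rule abs_continuous_norm_increment_le[OF uv(3) ac[OF sub[OF uv(1,2)]]])
    have int: "{u<..<v} \<subseteq> interior I"
      using sub[OF uv(1,2)] by (intro interior_maximal) auto
    show "AE t in lebesgue. t \<in> {u<..<v} \<longrightarrow> (\<exists>D. (x has_vector_derivative D) (at t) \<and> norm D \<le> a * m + c)"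
      using vel_x
    proof eventually_elim
      case (elim t)
      show ?case
      proof
        assume t: "t \<in> {u<..<v}"
        then obtain D where "(x has_vector_derivative D) (at t)" "norm D \<le> a * norm (x t) + c"
          using elim int by blast
        moreover have "a * norm (x t) \<le> a * m" using m[of t] t a by (intro mult_left_mono) auto
        ultimately show "\<exists>D. (x has_vector_derivative D) (at t) \<and> norm D \<le> a * m + c" by fastforce
      qed
    qed
  qed
  have compact_bound: "\<exists>m. \<forall>t\<in>{u..v}. norm (x t) \<le> m" if "u \<in> I" "v \<in> I" for u v
  proof -
    have "compact (x ` {u..v})"
      using abs_continuous_on_imp_continuous_on[OF ac[OF sub[OF that]]] by (intro compact_continuous_image) auto
    then show ?thesis using compact_imp_bounded by (force simp: bounded_iff)
  qed
  define d where "d = 1 / (2 * (a + 1))"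
  have d: "d > 0" "a * d \<le> 1 / 2" using a by (auto simp: d_def field_simps)
  obtain s where s: "s \<in> I" "T - d \<le> s" using near[OF d(1)] by blast
  obtain m0 where m0: "\<And>t. t \<in> {t0..s} \<Longrightarrow> norm (x t) \<le> m0" using compact_bound[OF I(2) s(1)] by blast
  have s0: "t0 \<le> s" using s I by auto
  have m0_nonneg: "0 \<le> m0" using order_trans[OF norm_ge_zero m0[of t0]] s0 by simp
  define m where "m = 2 * (m0 + c * d)"
  have bound: "norm (x t) \<le> m" if t: "t \<in> I" for t
  proof (cases "t \<le> s")
    case True
    then have "norm (x t) \<le> m0" using t I by (intro m0) auto
    also have "m0 \<le> m" using m0_nonneg c d by (simp add: m_def)
    finally show ?thesis .
  next
    case False
    have "continuous_on {s..t} (\<lambda>r. norm (x r))"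
      using abs_continuous_on_imp_continuous_on[OF ac[OF sub[OF s(1) t]]] by (intro continuous_on_norm)
    then obtain r where r: "r \<in> {s..t}" "\<And>r'. r' \<in> {s..t} \<Longrightarrow> norm (x r') \<le> norm (x r)"
      using continuous_attains_sup[of "{s..t}" "\<lambda>r. norm (x r)"] False by auto
    have rI: "r \<in> I" using r(1) sub[OF s(1) t] by blast
    have "norm (x r - x s) \<le> (a * norm (x r) + c) * (r - s)"
      using r by (intro incr s(1) rI) auto
    also have "\<dots> \<le> (a * norm (x r) + c) * d"
      using rI I(3) s(2) a c by (intro mult_left_mono) auto
    also have "\<dots> \<le> norm (x r) / 2 + c * d"
      using mult_right_mono[OF d(2) norm_ge_zero[of "x r"]] by (simp add: algebra_simps)
    finally have "norm (x r) \<le> norm (x s) + norm (x r) / 2 + c * d"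
      using norm_triangle_sub[of "x r" "x s"] by linarith
    moreover have "norm (x s) \<le> m0" using s0 by (intro m0) auto
    ultimately have "norm (x r) \<le> m" by (simp add: m_def)
    then show ?thesis using r(2)[of t] False by auto
  qed
  have "(a * m + c)-lipschitz_on I x"
  proof (rule lipschitz_onI)
    have m: "0 \<le> m" using m0_nonneg c d by (simp add: m_def)
    then show "0 \<le> a * m + c" using a c by simp
    have 1: "norm (x v - x u) \<le> (a * m + c) * (v - u)" if "u \<in> I" "v \<in> I" "u \<le> v" for u v
      using that sub[OF that(1,2)] bound by (intro incr) auto
    fix u v assume "u \<in> I" "v \<in> I"
    then show "dist (x u) (x v) \<le> (a * m + c) * dist u v"
      using 1[of u v] 1[of v u] by (cases "u \<le> v") (auto simp: dist_norm norm_minus_commute)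
  qed
  then show thesis by (rule that)
qed

lemma trajectory_of_solution:
  assumes sol: "solution x0 I x" and T: "T \<in> I"
  shows "trajectory T x"
proof -
  have I: "is_interval I" "t0 \<in> I" "I \<subseteq> {t0..}" and ac: "\<And>a b. {a..b} \<subseteq> I \<Longrightarrow> abs_continuous_on {a..b} x"
    using sol unfolding solution_iff by blast+
  have sub: "{t0..T} \<subseteq> I" using is_interval_Icc_subset[OF I(1,2) T] .
  have "AE t in lebesgue. t \<in> interior I \<longrightarrow> moves x t" by (rule solution_moves[OF sol])
  then have mv: "AE t in lebesgue. t \<in> interior {t0..T} \<longrightarrow> moves x t"
    by eventually_elim (use interior_mono[OF sub] in blast)
  have "t0 \<le> T" using I T by auto
  obtain K where "K-lipschitz_on {t0..T} x"
  proof (rule solution_lipschitz[of "{t0..T}" T x])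
    show "\<exists>s\<in>{t0..T}. T - e \<le> s" if "e > 0" for e
      using that \<open>t0 \<le> T\<close> by (intro bexI[of _ T]) auto
    show "abs_continuous_on {a..b} x" if "{a..b} \<subseteq> {t0..T}" for a b
      using ac that sub by blast
  qed (use \<open>t0 \<le> T\<close> mv in \<open>auto simp: is_interval_cc\<close>)
  then show ?thesis unfolding trajectory_def using mv by (auto simp: interior_atLeastAtMost_real)
qed

lemma solution_of_trajectory:
  assumes x: "\<And>T. trajectory T x"
  shows "solution (x t0) {t0..} x"
  unfolding solution_iff
proof (intro conjI allI impI)
  show "is_interval {t0..}" by (simp add: is_interval_ci)
  fix a b assume ab: "{a..b} \<subseteq> {t0..}"
  obtain K where K: "K-lipschitz_on {t0..b} x" using x unfolding trajectory_def by blast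
  have "{a..b} \<subseteq> {t0..b}" using ab by auto
  then show "abs_continuous_on {a..b} x"
    using lipschitz_imp_abs_continuous_on[OF lipschitz_on_subset[OF K]] by blast
next
  have "AE t in lebesgue. \<forall>n. t \<in> {t0<..<t0 + real n} \<longrightarrow> moves x t"
    unfolding AE_all_countable using x by (auto simp: trajectory_def)
  moreover have "AE t in lebesgue. t \<noteq> t0" by (rule AE_lebesgue_neq)
  ultimately show "AE t in lebesgue. t \<in> {t0..} \<longrightarrow> (\<exists>v w. v \<in> present t (x t) \<and> w \<in> memory x t \<and>
               (x has_vector_derivative v + w) (at t within {t0..}))"
  proof eventually_elim
    case (elim t)
    show ?case
    proof
      assume t: "t \<in> {t0..}"
      obtain n where "t - t0 < real n" using reals_Archimedean2 by blast
      then have "t \<in> {t0<..<t0 + real n}" using t elim by auto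
      then have "moves x t" using elim by blast
      then show "\<exists>v w. v \<in> present t (x t) \<and> w \<in> memory x t \<and> (x has_vector_derivative v + w) (at t within {t0..})"
        unfolding moves_def using has_vector_derivative_at_within by blast
    qed
  qed
qed auto

text \<open>If \<open>I\<close> is open on the right, the Lipschitz condition provides the limit at the missing endpoint.\<close>

lemma solution_closure:
  assumes sol: "solution x0 I x" and bounded: "bdd_above I"
  obtains T z where "t0 \<le> T" "I \<subseteq> {t0..T}" "trajectory T z" "\<And>t. t \<in> I \<Longrightarrow> z t = x t"
proof -
  have I: "is_interval I" "t0 \<in> I" "I \<subseteq> {t0..}" and ac: "\<And>a b. {a..b} \<subseteq> I \<Longrightarrow> abs_continuous_on {a..b} x"
    using sol unfolding solution_iff by blast+
  define T where "T = Sup I"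
  have IT: "I \<subseteq> {t0..T}" using I bounded by (auto simp: T_def intro: cSup_upper)
  have "t0 \<le> T" using IT I by auto
  have near: "\<exists>s\<in>I. T - e \<le> s" if "e > 0" for e
  proof -
    have "T - e < Sup I" using that by (simp add: T_def)
    then obtain s where "s \<in> I" "T - e < s" using less_cSup_iff[of I "T - e"] I(2) bounded by blast
    then show ?thesis by (intro bexI[of _ s]) auto
  qed
  have "AE t in lebesgue. t \<in> interior I \<longrightarrow> moves x t" by (rule solution_moves[OF sol])
  then obtain K where K: "K-lipschitz_on I x"
    using solution_lipschitz[OF I(1,2) IT near ac] by blast
  obtain z where z: "uniformly_continuous_on (closure I) z" "\<And>t. t \<in> I \<Longrightarrow> x t = z t"
    using uniformly_continuous_on_extension_on_closure[OF lipschitz_on_uniformly_continuous[OF K]] by metis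
  have mem: "t \<in> I" if t: "t \<in> {t0..<T}" for t
  proof -
    obtain s where "s \<in> I" "t \<le> s" using near[of "T - t"] t by auto
    then show ?thesis using is_interval_Icc_subset[OF I(1,2) \<open>s \<in> I\<close>] t by auto
  qed
  have "{t0..T} \<subseteq> closure I"
  proof
    fix t assume t: "t \<in> {t0..T}"
    show "t \<in> closure I"
    proof (cases "t = T")
      case True
      show ?thesis unfolding closure_approachable
      proof (intro allI impI)
        fix e :: real assume "e > 0"
        then obtain s where s: "s \<in> I" "T - e / 2 \<le> s" using near[of "e / 2"] by auto
        then have "dist s t < e" using IT True \<open>e > 0\<close> by (auto simp: dist_real_def)
        then show "\<exists>s\<in>I. dist s t < e" using s by blast
      qed
    next
      case False
      then have "t \<in> I" using t by (intro mem) auto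
      then show ?thesis using closure_subset by blast
    qed
  qed
  moreover have "K-lipschitz_on (closure I) z"
    using z lipschitz_on_transform[OF K] by (intro lipschitz_on_closure uniformly_continuous_imp_continuous) auto
  ultimately have lz: "K-lipschitz_on {t0..T} z" by (blast intro: lipschitz_on_subset)
  have int: "{t0<..<T} \<subseteq> interior I" using mem by (intro interior_maximal) auto
  have "AE t in lebesgue. t \<in> {t0<..<T} \<longrightarrow> moves z t"
    using solution_moves[OF sol]
  proof eventually_elim
    case (elim t)
    show ?case
    proof
      assume t: "t \<in> {t0<..<T}"
      have "moves x t" using elim t int by blast
      then show "moves z t"
        using t z(2) mem by (intro moves_cong[of "(t + T) / 2" x z t]) auto
    qed
  qed
  then have "trajectory T z" using lz by (auto simp: trajectory_def)
  then show thesis using that \<open>t0 \<le> T\<close> IT z(2) by metis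
qed

end

section \<open>Continuation of trajectories\<close>

context closed_loop
begin

lemma trajectory_concat:
  assumes x: "trajectory t1 x" and t: "t0 \<le> t1" "t1 \<le> T" and X: "k-lipschitz_on {t1..T} X" "X t1 = x t1"
    and z: "z = (\<lambda>t. if t \<le> t1 then x t else X t)"
    and mv: "AE t in lebesgue. t \<in> {t1<..<T} \<longrightarrow> (\<exists>v w. v \<in> present t (X t) \<and> w \<in> memory z t \<and>
       (X has_vector_derivative v + w) (at t))"
  shows "trajectory T z"
  unfolding trajectory_def
proof
  obtain K where K: "K-lipschitz_on {t0..t1} x" using x unfolding trajectory_def by blast
  show "\<exists>K. K-lipschitz_on {t0..T} z"
    using lipschitz_on_concat_max[OF K X(1)] X(2) unfolding z by auto
  have "AE t in lebesgue. t \<in> {t0<..<t1} \<longrightarrow> moves x t" using x by (simp add: trajectory_def)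
  moreover have "AE t in lebesgue. t \<noteq> t1" by (rule AE_lebesgue_neq)
  ultimately show "AE t in lebesgue. t \<in> {t0<..<T} \<longrightarrow> moves z t"
    using mv
  proof eventually_elim
    case (elim t)
    show ?case
    proof
      assume tT: "t \<in> {t0<..<T}"
      consider "t < t1" | "t1 < t" using elim(2) by linarith
      then show "moves z t"
      proof cases
        case 1
        then have "moves x t" using elim tT by auto
        then show ?thesis using 1 tT by (intro moves_cong[of t1 x z t]) (auto simp: z)
      next
        case 2
        then obtain v w where vw: "v \<in> present t (X t)" "w \<in> memory z t" "(X has_vector_derivative v + w) (at t)"
          using elim tT by auto
        have "(z has_vector_derivative v + w) (at t)"
          by (rule has_vector_derivative_transform_within_open[OF vw(3), where S = "{t1<..}"]) (use 2 in \<open>auto simp: z\<close>)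
        then show ?thesis using vw 2 unfolding moves_def z by auto
      qed
    qed
  qed
qed

text \<open>The feedback along \<open>x\<close> up to the time \<open>t1\<close> and \<open>0\<close> afterwards. Clamping \<open>\<tau>\<close> to \<open>{t0..t1}\<close> makes
  this a Borel function on the whole line although \<open>x\<close> is known only there.\<close>

definition frozen :: "(real \<Rightarrow> real ^ 'n) \<Rightarrow> real \<Rightarrow> real \<Rightarrow> real ^ 'm" where
  "frozen x t1 \<tau> = (if \<tau> \<le> t1 then fb (x (max t0 (min \<tau> t1))) else 0)"

lemma continuous_clamp:
  fixes x :: "real \<Rightarrow> 'a::topological_space"
  assumes "a \<le> b" "continuous_on {a..b} x"
  shows "continuous_on UNIV (\<lambda>\<tau>. x (max a (min \<tau> b)))"
  by (rule continuous_on_compose2[OF assms(2)]) (use assms(1) in \<open>auto intro!: continuous_intros\<close>)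

lemma trajectory_continuous: "trajectory T x \<Longrightarrow> continuous_on {t0..T} x"
  unfolding trajectory_def using lipschitz_on_continuous_on by blast

lemma frozen_borel:
  assumes "t0 \<le> t1" "trajectory t1 x"
  shows "frozen x t1 \<in> borel_measurable borel"
proof -
  have [measurable]: "(\<lambda>\<tau>. x (max t0 (min \<tau> t1))) \<in> borel_measurable borel"
    by (rule borel_measurable_continuous_onI[OF continuous_clamp[OF assms(1) trajectory_continuous[OF assms(2)]]])
  show ?thesis unfolding frozen_def[abs_def] by measurable
qed

lemma fb_ball: "\<exists>q. wnorm P q \<le> 1 \<and> fb z = - \<rho> *\<^sub>R (G *v q)"
  using wnorm_dir[of z] fb_dir[of z] by (intro exI[of _ "dir z"]) auto

lemma frozen_ball: "\<exists>q. wnorm P q \<le> 1 \<and> frozen x t1 \<tau> = - \<rho> *\<^sub>R (G *v q)"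
  using fb_ball[of "x (max t0 (min \<tau> t1))"] by (cases "\<tau> \<le> t1") (auto simp: frozen_def intro: exI[of _ 0])

lemma selected_borel:
  assumes [measurable]: "case_prod K \<in> borel_measurable (borel \<Otimes>\<^sub>M borel)" "g \<in> borel_measurable borel"
    "u \<in> borel_measurable borel"
  shows "(\<lambda>s. LINT \<tau>:{t0..s}|lborel. selected K g u s \<tau>) \<in> borel_measurable borel"
    "selected K g u s \<in> borel_measurable borel"
proof -
  have "case_prod (selected K g u) \<in> borel_measurable (borel \<Otimes>\<^sub>M borel)"
    unfolding selected_def[abs_def] split_def by measurable
  then show "(\<lambda>s. LINT \<tau>:{t0..s}|lborel. selected K g u s \<tau>) \<in> borel_measurable borel"
    by (rule borel_measurable_volterra_integral)
  from measurable_compose[OF _ \<open>case_prod (selected K g u) \<in> _\<close>, of "\<lambda>\<tau>. (s, \<tau>)" borel]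
  show "selected K g u s \<in> borel_measurable borel" by simp
qed

text \<open>Both ways of continuing a trajectory beyond \<open>t1\<close> see the past as the given function \<open>m\<close> of time, the
  memory produced by the control \<open>frozen x t1\<close>. It already contains the disturbance remembered after
  \<open>t1\<close>, so that only the control remembered after \<open>t1\<close> has to be added.\<close>

lemma frozen_memory:
  assumes x: "trajectory t1 x" and t1: "t0 \<le> t1" and h: "0 \<le> h"
  obtains U K g p' m c where "representatives (t1 + h) U K g p' c" "m \<in> borel_measurable borel" "\<And>s. norm (m s) \<le> c"
    "\<And>s. s \<in> {t1..t1 + h} \<Longrightarrow> m s = (LINT \<tau>:{t0..s}|lborel. selected K g (frozen x t1) s \<tau>)"
proof -
  obtain U K g p' d where rd: "representatives (t1 + h) U K g p' d" by (rule representatives_exist)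
  note rep = representativesD[OF rd]
  note U = rep(1) and d = rep(2) and K = rep(3) and g = rep(4) and bd = rep(9-12)
  note [measurable] = K g frozen_borel[OF t1 x]
  have frU: "norm (frozen x t1 \<tau>) \<le> U" for \<tau>
    using frozen_ball[of x t1 \<tau>] U by metis
  define m where "m s = (if s \<in> {t1..t1 + h} then LINT \<tau>:{t0..s}|lborel. selected K g (frozen x t1) s \<tau> else 0)" for s
  have m_borel: "m \<in> borel_measurable borel"
    using selected_borel(1)[OF K g frozen_borel[OF t1 x]] unfolding m_def[abs_def] by measurable
  have m_bound: "norm (m s) \<le> d * (t1 + h - t0)" for s
  proof (cases "s \<in> {t1..t1 + h}")
    case True
    have "norm (m s) \<le> d * (s - t0)"
      using True t1 bd(1)[OF frU] selected_borel(2)[OF K g frozen_borel[OF t1 x]]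
      unfolding m_def by (auto simp: selected_def intro!: norm_set_integral_interval_le)
    also have "\<dots> \<le> d * (t1 + h - t0)" using True d by (intro mult_left_mono) auto
    finally show ?thesis .
  qed (use d t1 h in \<open>auto simp: m_def\<close>)
  define c where "c = d + d * (t1 + h - t0)"
  have "0 \<le> d * (t1 + h - t0)" using d t1 h by simp
  then have dc: "d \<le> c" "d * (t1 + h - t0) \<le> c" using d by (auto simp: c_def)
  show thesis
  proof (rule that)
    show "representatives (t1 + h) U K g p' c" using rd dc(1) by (rule representatives_mono)
    show "norm (m s) \<le> c" for s using m_bound dc(2) by (rule order_trans)
    show "m s = (LINT \<tau>:{t0..s}|lborel. selected K g (frozen x t1) s \<tau>)" if "s \<in> {t1..t1 + h}" for s
      using that by (simp add: m_def)
  qed (rule m_borel)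
qed

text \<open>The trajectory follows the feedback until it meets the surface or the time \<open>t1 + h\<close> is reached. A start on
  the surface is allowed: the phase then ends at once.\<close>

lemma regular_phase:
  assumes x: "trajectory t1 x" and t1: "t0 \<le> t1" and h: "0 \<le> h" "onorm ((*v) A) * h \<le> 1 / 2"
  obtains T z where "t1 \<le> T" "T \<le> t1 + h" "trajectory T z" "\<And>t. t \<in> {t0..t1} \<Longrightarrow> z t = x t"
    "T = t1 + h \<or> C *v z T = 0"
proof -
  obtain U K g p' m c where "representatives (t1 + h) U K g p' c" and m_borel: "m \<in> borel_measurable borel"
    and m_bound: "\<And>s. norm (m s) \<le> c"
    and m_eq: "\<And>s. s \<in> {t1..t1 + h} \<Longrightarrow> m s = (LINT \<tau>:{t0..s}|lborel. selected K g (frozen x t1) s \<tau>)"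
    by (rule frozen_memory[OF x t1 h(1)]) blast
  note rep = representativesD[OF this(1)]
  note U = rep(1) and c = rep(2) and K = rep(3) and g = rep(4) and p' = rep(5) and ae = rep(6-8) and bd = rep(9-12)
  note [measurable] = K g p' m_borel frozen_borel[OF t1 x]
  have fbU: "norm (fb z) \<le> U" and frU: "norm (frozen x t1 \<tau>) \<le> U" for z \<tau>
    using fb_ball[of z] frozen_ball[of x t1 \<tau>] U by metis+
  define c' where "c' = c + c + c"
  define f where "f s v = A *v v + B *v fb v + (B *v g s + p' s) + m s" for s v
  define k where "k s \<tau> v = K s \<tau> *v (Bt *v fb v)" for s \<tau> v
  interpret V: volterra f k t1 "t1 + h" "onorm ((*v) A)" c' "x t1"
  proof
    show "case_prod f \<in> borel_measurable (borel \<Otimes>\<^sub>M borel)"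
      unfolding f_def[abs_def] split_def by measurable
    have [measurable]: "(\<lambda>q :: real \<times> real \<times> (real ^ 'n). K (fst q) (fst (snd q))) \<in> borel_measurable (borel \<Otimes>\<^sub>M borel \<Otimes>\<^sub>M borel)"
      using measurable_compose[OF _ K, of "\<lambda>q. (fst q, fst (snd q))" "borel \<Otimes>\<^sub>M borel \<Otimes>\<^sub>M borel"] by simp
    show "(\<lambda>(s, \<tau>, v). k s \<tau> v) \<in> borel_measurable (borel \<Otimes>\<^sub>M borel \<Otimes>\<^sub>M borel)"
      unfolding k_def[abs_def] split_def by measurable
    show "norm (k s \<tau> v) \<le> c'" for s \<tau> v
      using bd(2)[OF fbU[of v], of s \<tau>] c unfolding k_def c'_def by linarith
    show "norm (f s v) \<le> onorm ((*v) A) * norm v + c'" for s v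
      using norm_triangle_ineq[of "A *v v + B *v fb v + (B *v g s + p' s)" "m s"]
        norm_triangle_ineq[of "A *v v + B *v fb v" "B *v g s + p' s"] norm_triangle_ineq[of "A *v v" "B *v fb v"]
        onorm[OF matrix_vector_mul_bounded_linear, of A v] bd(3)[of s] bd(4)[OF fbU[of v]] m_bound[of s]
      unfolding f_def c'_def by linarith
    show "0 \<le> onorm ((*v) A)" by (rule onorm_pos_le[OF matrix_vector_mul_bounded_linear])
  qed (use h in auto)
  obtain X where X: "V.speed-lipschitz_on UNIV X" "X t1 = x t1"
    and dX: "\<And>T. T \<le> t1 + h \<Longrightarrow> (\<And>s \<sigma>. s \<in> {t1<..<T} \<Longrightarrow> isCont (f s) (X s) \<and> isCont (k \<sigma> s) (X s)) \<Longrightarrow>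
       AE t in lebesgue. t \<in> {t1<..<T} \<longrightarrow>
         (X has_vector_derivative (f t (X t) + (LINT \<tau>:{t1..t}|lborel. k t \<tau> (X \<tau>)))) (at t)"
    by (rule V.delayed_peano) blast
  have X_cont: "continuous_on UNIV X" using X(1) by (rule lipschitz_on_continuous_on)
  have [measurable]: "X \<in> borel_measurable borel" by (rule borel_measurable_continuous_onI[OF X_cont])
  obtain T where T: "t1 \<le> T" "T \<le> t1 + h" "\<And>s. s \<in> {t1<..<T} \<Longrightarrow> C *v X s \<noteq> 0" "T = t1 + h \<or> C *v X T = 0"
  proof (cases "\<exists>s\<in>{t1..t1 + h}. C *v X s = 0")
    case True
    let ?Z = "{s \<in> {t1..t1 + h}. C *v X s = 0}"
    have "continuous_on UNIV (\<lambda>s. C *v X s)"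
      by (rule continuous_on_compose2[OF matrix_vector_mult_linear_continuous_on X_cont]) auto
    then have "closed {s. C *v X s = 0}"
      by (intro closed_Collect_eq continuous_on_const)
    moreover have "?Z = {t1..t1 + h} \<inter> {s. C *v X s = 0}" by auto
    ultimately have "compact ?Z" by (metis compact_Icc compact_Int_closed)
    then obtain T where T: "T \<in> ?Z" "\<And>s. s \<in> ?Z \<Longrightarrow> T \<le> s"
      using compact_attains_inf[of ?Z] True by blast
    show thesis
    proof (rule that[of T])
      show "C *v X s \<noteq> 0" if "s \<in> {t1<..<T}" for s
        using T(2)[of s] T(1) that by auto
    qed (use T(1) in auto)
  next
    case False
    then show thesis using h by (intro that[of "t1 + h"]) auto
  qed
  define z where "z = (\<lambda>t. if t \<le> t1 then x t else X t)"
  define u where "u \<tau> = (if \<tau> \<le> t1 then frozen x t1 \<tau> else fb (X \<tau>))" for \<tau>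
  have u_borel [measurable]: "u \<in> borel_measurable borel"
    unfolding u_def[abs_def] by measurable
  have uU: "norm (u \<tau>) \<le> U" for \<tau> by (simp add: u_def frU fbU)
  have uz: "u \<tau> = fb (z \<tau>)" if "t0 \<le> \<tau>" for \<tau>
    using that by (auto simp: u_def z_def frozen_def)
  \<comment> \<open>The memory before and after \<open>t1\<close> adds up to that of the control \<open>u\<close>.\<close>
  have split: "m t + (LINT \<tau>:{t1..t}|lborel. k t \<tau> (X \<tau>)) = (LINT \<tau>:{t0..t}|lborel. selected K g u t \<tau>)"
    if t: "t \<in> {t1<..<t1 + h}" for t
  proof -
    have i1: "set_integrable lborel {t0..t} (selected K g (frozen x t1) t)"
      using selected_borel(2)[OF K g frozen_borel[OF t1 x]] bd(1)[OF frU]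
      by (intro set_integrable_bounded_interval[where c = c]) (auto simp: selected_def)
    have kb: "(\<lambda>\<tau>. k t \<tau> (X \<tau>)) \<in> borel_measurable borel"
      using V.memory_borel[of X t 0] by simp
    have i2: "set_integrable lborel {t1..t} (\<lambda>\<tau>. k t \<tau> (X \<tau>))"
      using kb V.k_bound by (intro set_integrable_bounded_interval[where c = c']) auto
    have "m t = (LINT \<tau>:{t0..t}|lborel. selected K g (frozen x t1) t \<tau>)" using t by (intro m_eq) auto
    then have "m t + (LINT \<tau>:{t1..t}|lborel. k t \<tau> (X \<tau>)) =
        (\<integral>\<tau>. indicator {t0..t} \<tau> *\<^sub>R selected K g (frozen x t1) t \<tau> + indicator {t1..t} \<tau> *\<^sub>R k t \<tau> (X \<tau>) \<partial>lborel)"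
      using i1 i2 unfolding set_lebesgue_integral_def set_integrable_def
      by (simp add: Bochner_Integration.integral_add)
    also have "\<dots> = (\<integral>\<tau>. indicator {t0..t} \<tau> *\<^sub>R selected K g u t \<tau> \<partial>lborel)"
    proof (rule integral_cong_AE)
      show "AE \<tau> in lborel. indicator {t0..t} \<tau> *\<^sub>R selected K g (frozen x t1) t \<tau> + indicator {t1..t} \<tau> *\<^sub>R k t \<tau> (X \<tau>)
          = indicator {t0..t} \<tau> *\<^sub>R selected K g u t \<tau>"
        using AE_lborel_singleton[of t1]
      proof eventually_elim
        case (elim \<tau>)
        then consider "\<tau> < t1" | "t1 < \<tau>" by linarith
        then show ?case
        proof cases
          case 1
          then show ?thesis by (simp add: selected_def u_def)
        next
          case 2
          then have "\<tau> \<in> {t0..t} \<longleftrightarrow> \<tau> \<in> {t1..t}" using t1 by auto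
          moreover have "selected K g (frozen x t1) t \<tau> + k t \<tau> (X \<tau>) = selected K g u t \<tau>"
            using 2 by (simp add: selected_def u_def frozen_def k_def matrix_vector_right_distrib)
          ultimately show ?thesis by (cases "\<tau> \<in> {t1..t}") auto
        qed
      qed
    qed (use selected_borel(2)[OF K g frozen_borel[OF t1 x]] selected_borel(2)[OF K g u_borel] kb in \<open>auto intro!: borel_measurable_add borel_measurable_scaleR borel_measurable_indicator\<close>)
    finally show ?thesis by (simp add: set_lebesgue_integral_def)
  qed
  have "AE t in lebesgue. t \<in> {t1<..<T} \<longrightarrow>
         (X has_vector_derivative (f t (X t) + (LINT \<tau>:{t1..t}|lborel. k t \<tau> (X \<tau>)))) (at t)"
  proof (rule dX[OF T(2)])
    fix s \<sigma> assume "s \<in> {t1<..<T}"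
    then have cont: "isCont fb (X s)" using T(3) by (intro isCont_fb) auto
    show "isCont (f s) (X s) \<and> isCont (k \<sigma> s) (X s)"
      unfolding f_def k_def by (intro conjI continuous_add continuous_const isCont_matrix_vector cont continuous_ident)
  qed
  then have mv: "AE t in lebesgue. t \<in> {t1<..<T} \<longrightarrow> (\<exists>v w. v \<in> present t (X t) \<and> w \<in> memory z t \<and>
       (X has_vector_derivative v + w) (at t))"
    using ae(1,2)[folded AE_completion_iff[where M = lborel]] ae(3)
  proof eventually_elim
    case (elim t)
    show ?case
    proof
      assume t: "t \<in> {t1<..<T}"
      let ?w = "LINT \<tau>:{t0..t}|lborel. selected K g u t \<tau>"
      have "drift A B (B *v \<gamma> t + p t) (X t) \<in> present t (X t)"
        unfolding present_def by (rule drift_mem_filippov_reg)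
      moreover have "?w \<in> memory z t"
      proof (rule selected_mem_memory[OF K g u_borel])
        show "norm (selected K g u t \<tau>) \<le> c" for \<tau> using bd(1)[OF uU] by (simp add: selected_def)
        show "AE \<tau> in lborel. \<tau> \<in> {t0..t} \<longrightarrow> \<Phi> t \<tau> = K t \<tau>" using elim(4) t t1 T by auto
      qed (use uz ae(1) in auto)
      moreover have "f t (X t) + (LINT \<tau>:{t1..t}|lborel. k t \<tau> (X \<tau>)) = drift A B (B *v \<gamma> t + p t) (X t) + ?w"
        using split[of t] t T elim(2,3) by (simp add: f_def drift_def algebra_simps)
      ultimately show "\<exists>v w. v \<in> present t (X t) \<and> w \<in> memory z t \<and> (X has_vector_derivative v + w) (at t)"
        using elim(1) t by metis
    qed
  qed
  show thesis
  proof (rule that[OF T(1,2)])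
    show "trajectory T z"
      using lipschitz_on_subset[OF X(1)] by (intro trajectory_concat[OF x t1 T(1) _ X(2) z_def mv]) auto
    show "T = t1 + h \<or> C *v z T = 0"
      using T(1,4) X(2) by (cases "T = t1") (auto simp: z_def)
  qed (simp add: z_def)
qed

text \<open>Subtracting \<open>B G C\<close> times the forcing leaves the part of it that \<open>C\<close> annihilates. For the equation with this
  projected forcing the output satisfies \<open>y' = C A x = L y\<close> and starts at \<open>0\<close>, so it stays \<open>0\<close>; on a short interval this needs
  no exponential. The subtracted part is the effect of a control that \<open>control_margin\<close> shows to be
  admissible.\<close>

lemma sliding_phase:
  assumes x: "trajectory t1 x" and t1: "t0 \<le> t1" and h: "0 \<le> h" "onorm ((*v) A) * h \<le> 1 / 2" "onorm ((*v) L) * h \<le> 1 / 2"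
    and Cx: "C *v x t1 = 0"
  obtains z where "trajectory (t1 + h) z" "\<And>t. t \<in> {t0..t1} \<Longrightarrow> z t = x t"
proof -
  obtain U K g p' m c where "representatives (t1 + h) U K g p' c" and m_borel: "m \<in> borel_measurable borel"
    and m_bound: "\<And>s. norm (m s) \<le> c"
    and m_eq: "\<And>s. s \<in> {t1..t1 + h} \<Longrightarrow> m s = (LINT \<tau>:{t0..s}|lborel. selected K g (frozen x t1) s \<tau>)"
    by (rule frozen_memory[OF x t1 h(1)]) blast
  note rep = representativesD[OF this(1)]
  note U = rep(1) and c = rep(2) and K = rep(3) and g = rep(4) and p' = rep(5) and ae = rep(6-8) and bd = rep(9-12)
  note [measurable] = K g p' m_borel frozen_borel[OF t1 x]
  have frU: "norm (frozen x t1 \<tau>) \<le> U" for \<tau>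
    using frozen_ball[of x t1 \<tau>] U by metis
  \<comment> \<open>The projection along the range of \<open>B\<close> onto the kernel of \<open>C\<close>.\<close>
  define proj where "proj y = y - B *v (G *v (C *v y))" for y
  have C_proj: "C *v proj y = 0" for y by (simp add: proj_def matrix_vector_mult_diff_distrib CB_G)
  have proj: "bounded_linear proj"
    unfolding proj_def by (intro bounded_linear_sub bounded_linear_ident bounded_linear_compose[OF matrix_vector_mul_bounded_linear] matrix_vector_mul_bounded_linear)
  obtain \<pi> where \<pi>: "\<pi> > 0" "\<And>y. norm (proj y) \<le> norm y * \<pi>"
    using bounded_linear.pos_bounded[OF proj] by blast
  define E where "E s = B *v g s + p' s + m s" for s
  define c' where "c' = (c + c) * \<pi>"
  have E_bound: "norm (proj (E s)) \<le> c'" for s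
  proof -
    have "norm (E s) \<le> c + c"
      using bd(3)[of s] m_bound[of s] norm_triangle_ineq[of "B *v g s + p' s" "m s"] unfolding E_def by linarith
    then show ?thesis using \<pi>(2)[of "E s"] \<pi>(1) unfolding c'_def by (meson less_imp_le mult_right_mono order_trans)
  qed
  define f where "f s v = A *v v + proj (E s)" for s v
  define k where "k s \<tau> v = (0 :: real ^ 'n)" for s \<tau> :: real and v :: "real ^ 'n"
  interpret V: volterra f k t1 "t1 + h" "onorm ((*v) A)" c' "x t1"
  proof
    show "case_prod f \<in> borel_measurable (borel \<Otimes>\<^sub>M borel)"
      unfolding f_def[abs_def] E_def proj_def split_def by measurable
    show "(\<lambda>(s, \<tau>, v). k s \<tau> v) \<in> borel_measurable (borel \<Otimes>\<^sub>M borel \<Otimes>\<^sub>M borel)"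
      unfolding k_def[abs_def] split_def by measurable
    show "norm (k s \<tau> v) \<le> c'" for s \<tau> v
      using order_trans[OF norm_ge_zero E_bound] by (simp add: k_def)
    show "norm (f s v) \<le> onorm ((*v) A) * norm v + c'" for s v
      using norm_triangle_ineq[of "A *v v" "proj (E s)"] onorm[OF matrix_vector_mul_bounded_linear, of A v] E_bound[of s]
      unfolding f_def by linarith
    show "0 \<le> onorm ((*v) A)" by (rule onorm_pos_le[OF matrix_vector_mul_bounded_linear])
  qed (use h in auto)
  obtain X where X: "V.speed-lipschitz_on UNIV X" "X t1 = x t1"
    and dX: "\<And>T. T \<le> t1 + h \<Longrightarrow> (\<And>s \<sigma>. s \<in> {t1<..<T} \<Longrightarrow> isCont (f s) (X s) \<and> isCont (k \<sigma> s) (X s)) \<Longrightarrow>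
       AE t in lebesgue. t \<in> {t1<..<T} \<longrightarrow>
         (X has_vector_derivative (f t (X t) + (LINT \<tau>:{t1..t}|lborel. k t \<tau> (X \<tau>)))) (at t)"
    by (rule V.delayed_peano) blast
  have "AE t in lebesgue. t \<in> {t1<..<t1 + h} \<longrightarrow>
         (X has_vector_derivative (f t (X t) + (LINT \<tau>:{t1..t}|lborel. k t \<tau> (X \<tau>)))) (at t)"
  proof (rule dX[OF order_refl])
    fix s \<sigma>
    show "isCont (f s) (X s) \<and> isCont (k \<sigma> s) (X s)"
      unfolding f_def k_def by (intro conjI continuous_add continuous_const isCont_matrix_vector continuous_ident)
  qed
  then have deriv: "AE t in lebesgue. t \<in> {t1<..<t1 + h} \<longrightarrow> (X has_vector_derivative A *v X t + proj (E t)) (at t)"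
    by (simp add: k_def f_def set_lebesgue_integral_def)
  define y where "y t = C *v X t" for t
  have y0: "y t = 0" if t: "t \<in> {t1..t1 + h}" for t
  proof -
    have "continuous_on {t1..t1 + h} (\<lambda>t. norm (y t))"
      unfolding y_def using lipschitz_on_continuous_on[OF X(1)]
      by (intro continuous_on_norm continuous_on_compose2[OF matrix_vector_mult_linear_continuous_on[of UNIV]])
        (auto intro: continuous_on_subset)
    then obtain r where r: "r \<in> {t1..t1 + h}" "\<And>s. s \<in> {t1..t1 + h} \<Longrightarrow> norm (y s) \<le> norm (y r)"
      using continuous_attains_sup[of "{t1..t1 + h}" "\<lambda>t. norm (y t)"] t by auto
    let ?l = "onorm ((*v) L)"
    have l: "0 \<le> ?l" by (rule onorm_pos_le[OF matrix_vector_mul_bounded_linear])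
    have "norm (y r - y t1) \<le> (?l * norm (y r)) * (r - t1)"
    proof (rule abs_continuous_norm_increment_le)
      have "abs_continuous_on {t1..r} X"
        using lipschitz_imp_abs_continuous_on[OF lipschitz_on_subset[OF X(1)]] by blast
      then show "abs_continuous_on {t1..r} y"
        using onorm[OF matrix_vector_mul_bounded_linear, of C]
        by (elim abs_continuous_on_lipschitz_image) (simp add: y_def flip: matrix_vector_mult_diff_distrib)
      show "AE t in lebesgue. t \<in> {t1<..<r} \<longrightarrow> (\<exists>D. (y has_vector_derivative D) (at t) \<and> norm D \<le> ?l * norm (y r))"
        using deriv
      proof eventually_elim
        case (elim s)
        show ?case
        proof
          assume s: "s \<in> {t1<..<r}"
          then have "(X has_vector_derivative A *v X s + proj (E s)) (at s)" using elim r(1) by auto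
          then have "(y has_vector_derivative C *v (A *v X s + proj (E s))) (at s)"
            unfolding y_def by (rule bounded_linear.has_vector_derivative[OF matrix_vector_mul_bounded_linear])
          moreover have "C *v (A *v X s + proj (E s)) = L *v y s"
            using CA by (simp add: matrix_vector_right_distrib C_proj y_def matrix_vector_mul_assoc)
          moreover have "norm (L *v y s) \<le> ?l * norm (y r)"
            using onorm[OF matrix_vector_mul_bounded_linear, of L "y s"] mult_left_mono[OF r(2)[of s] l] s r(1) by auto
          ultimately show "\<exists>D. (y has_vector_derivative D) (at s) \<and> norm D \<le> ?l * norm (y r)" by auto
        qed
      qed
    qed (use r in auto)
    also have "\<dots> \<le> (?l * norm (y r)) * h" using r(1) l by (intro mult_left_mono) auto
    also have "\<dots> \<le> norm (y r) / 2"
      using mult_right_mono[OF h(3) norm_ge_zero[of "y r"]] by (simp add: algebra_simps)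
    finally have "norm (y r) \<le> 0" using X(2) Cx by (simp add: y_def)
    then show ?thesis using r(2)[OF t] by simp
  qed
  define z where "z = (\<lambda>t. if t \<le> t1 then x t else X t)"
  have uz: "frozen x t1 \<tau> = fb (z \<tau>)" if "\<tau> \<in> {t0..t1 + h}" for \<tau>
  proof (cases "\<tau> \<le> t1")
    case False
    then have "C *v z \<tau> = 0" using y0[of \<tau>] that by (simp add: z_def y_def)
    then show ?thesis using False by (simp add: frozen_def fb_dir dir_def)
  qed (use that in \<open>auto simp: frozen_def z_def\<close>)
  have mv: "AE t in lebesgue. t \<in> {t1<..<t1 + h} \<longrightarrow> (\<exists>v w. v \<in> present t (X t) \<and> w \<in> memory z t \<and>
       (X has_vector_derivative v + w) (at t))"
    using deriv ae(1,2)[folded AE_completion_iff[where M = lborel]] ae(3) control_margin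
  proof eventually_elim
    case (elim t)
    show ?case
    proof
      assume t: "t \<in> {t1<..<t1 + h}"
      have mt: "m t = (LINT \<tau>:{t0..t}|lborel. selected K g (frozen x t1) t \<tau>)" using t by (intro m_eq) auto
      have w: "m t \<in> memory z t"
        unfolding mt
      proof (rule selected_mem_memory[OF K g frozen_borel[OF t1 x]])
        show "norm (selected K g (frozen x t1) t \<tau>) \<le> c" for \<tau> using bd(1)[OF frU] by (simp add: selected_def)
        show "AE \<tau> in lborel. \<tau> \<in> {t0..t} \<longrightarrow> \<Phi> t \<tau> = K t \<tau>" using elim(4) t t1 by auto
      qed (use uz ae(1) t in auto)
      define e where "e = B *v \<gamma> t + p t"
      have Ee: "E t = e + m t" using elim by (simp add: E_def e_def)
      \<comment> \<open>The control cancelling the part of the forcing that would move the trajectory off the surface.\<close>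
      define q where "q = (C *v E t) /\<^sub>R \<rho>"
      have "wnorm P (C *v E t) \<le> wnorm P (C *v e) + wnorm P (C *v m t)"
        unfolding Ee matrix_vector_right_distrib by (rule wnorm_triangle)
      also have "\<dots> \<le> \<rho> - \<delta>" using elim(5) t t1 w by (auto simp: e_def add.commute)
      finally have "wnorm P q \<le> 1" using \<rho> \<delta> by (simp add: q_def wnorm_scaleR field_simps)
      moreover have "C *v X t = 0" using y0[of t] t by (simp add: y_def)
      ultimately have v: "A *v X t + B *v (- \<rho> *\<^sub>R (G *v q)) + e \<in> present t (X t)"
        unfolding present_def e_def by (intro filippov_reg_drift_on_surface)
      have "B *v (- \<rho> *\<^sub>R (G *v q)) = - (B *v (G *v (C *v E t)))"
        using \<rho> by (simp add: q_def matrix_vector_mult_scaleR linear_neg[OF matrix_vector_mul_linear])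
      then have "A *v X t + proj (E t) = (A *v X t + B *v (- \<rho> *\<^sub>R (G *v q)) + e) + m t"
        by (simp add: proj_def Ee)
      then show "\<exists>v w. v \<in> present t (X t) \<and> w \<in> memory z t \<and> (X has_vector_derivative v + w) (at t)"
        using v w elim(1) t by metis
    qed
  qed
  show thesis
  proof (rule that)
    show "trajectory (t1 + h) z"
      using lipschitz_on_subset[OF X(1)] h by (intro trajectory_concat[OF x t1 _ _ X(2) z_def mv]) auto
  qed (simp add: z_def)
qed

text \<open>If the regular phase ends early, a sliding phase of full length takes over.\<close>

lemma trajectory_extend_step:
  assumes h: "0 < h" "onorm ((*v) A) * h \<le> 1 / 2" "onorm ((*v) L) * h \<le> 1 / 2"
    and x: "trajectory t1 x" and t1: "t0 \<le> t1"
  shows "\<exists>z. trajectory (t1 + h) z \<and> (\<forall>t\<in>{t0..t1}. z t = x t)"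
proof -
  obtain T z where z: "t1 \<le> T" "T \<le> t1 + h" "trajectory T z" "\<And>t. t \<in> {t0..t1} \<Longrightarrow> z t = x t"
    "T = t1 + h \<or> C *v z T = 0"
    using regular_phase[OF x t1 less_imp_le[OF h(1)] h(2)] by blast
  show ?thesis
  proof (cases "T = t1 + h")
    case True
    then show ?thesis using z by blast
  next
    case False
    then have "C *v z T = 0" using z by blast
    then obtain z' where z': "trajectory (T + h) z'" "\<And>t. t \<in> {t0..T} \<Longrightarrow> z' t = z t"
      using sliding_phase[OF z(3) _ less_imp_le[OF h(1)] h(2,3)] t1 z(1) by (metis order_trans)
    have "trajectory (t1 + h) z'"
      using z'(1) by (rule trajectory_mono) (use z in auto)
    moreover have "z' t = x t" if "t \<in> {t0..t1}" for t
      using z'(2)[of t] z(4)[OF that] that z(1) by auto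
    ultimately show ?thesis by blast
  qed
qed

text \<open>Steps of a fixed length, each an extension of the previous one, are glued together.\<close>

theorem trajectory_extend:
  assumes x: "trajectory T x" and T: "t0 \<le> T"
  obtains z where "\<And>T'. trajectory T' z" "\<And>t. t \<in> {t0..T} \<Longrightarrow> z t = x t"
proof -
  let ?a = "onorm ((*v) A)" and ?l = "onorm ((*v) L)"
  have al: "0 \<le> ?a" "0 \<le> ?l" using onorm_pos_le[OF matrix_vector_mul_bounded_linear] by auto
  \<comment> \<open>Short enough for both phases, and independent of the state.\<close>
  define h where "h = 1 / (2 * (?a + ?l + 1))"
  have h: "0 < h" "?a * h \<le> 1 / 2" "?l * h \<le> 1 / 2" using al by (auto simp: h_def field_simps)
  have "\<exists>F. \<forall>n. trajectory (T + real n * h) (F n) \<and> (\<forall>t\<in>{t0..T + real n * h}. F (Suc n) t = F n t) \<and> F 0 = x"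
  proof -
    have "\<exists>F. \<forall>n. (trajectory (T + real n * h) (F n) \<and> (n = 0 \<longrightarrow> F n = x)) \<and> (\<forall>t\<in>{t0..T + real n * h}. F (Suc n) t = F n t)"
    proof (rule dependent_nat_choice)
      show "\<exists>z. trajectory (T + real 0 * h) z \<and> (0 = 0 \<longrightarrow> z = x)" using x by auto
      fix z n assume z: "trajectory (T + real n * h) z \<and> (n = 0 \<longrightarrow> z = x)"
      have "t0 \<le> T + real n * h" using T h(1) by (simp add: add_increasing2)
      from trajectory_extend_step[OF h conjunct1[OF z] this]
      obtain z' where "trajectory (T + real n * h + h) z'" "\<forall>t\<in>{t0..T + real n * h}. z' t = z t" by blast
      moreover have "T + real n * h + h = T + real (Suc n) * h" by (simp add: algebra_simps)
      ultimately show "\<exists>z'. (trajectory (T + real (Suc n) * h) z' \<and> (Suc n = 0 \<longrightarrow> z' = x)) \<and>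
          (\<forall>t\<in>{t0..T + real n * h}. z' t = z t)" by auto
    qed
    then show ?thesis by blast
  qed
  then obtain F where F: "\<And>n. trajectory (T + real n * h) (F n)"
      "\<And>n t. t \<in> {t0..T + real n * h} \<Longrightarrow> F (Suc n) t = F n t" "F 0 = x"
    by blast
  have stable: "F (n + j) t = F n t" if "t \<in> {t0..T + real n * h}" for n j t
  proof (induction j)
    case (Suc j)
    have "real n * h \<le> real (n + j) * h" using h(1) by (intro mult_right_mono) auto
    then show ?case using F(2)[of t "n + j"] that Suc by auto
  qed simp
  define N where "N t = nat \<lceil>(t - T) / h\<rceil>" for t
  define z where "z t = F (N t) t" for t
  have N: "t \<le> T + real (N t) * h" for t
  proof -
    have "(t - T) / h \<le> real (N t)" unfolding N_def by linarith
    then show ?thesis using h(1) by (simp add: field_simps)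
  qed
  have z_eq: "z t = F n t" if t: "t \<in> {t0..T + real n * h}" for n t
  proof -
    have "z t = F (N t + n) t" unfolding z_def using t N by (intro stable[symmetric]) auto
    also have "\<dots> = F n t" using stable[OF t, of "N t"] by (simp add: add.commute)
    finally show ?thesis .
  qed
  show thesis
  proof (rule that)
    fix T'
    have "trajectory T' (F (N T'))" using F(1) N by (rule trajectory_mono)
    then show "trajectory T' z"
      by (rule trajectory_cong[rotated]) (use z_eq N[of T'] in \<open>auto intro: sym\<close>)
  next
    fix t assume "t \<in> {t0..T}"
    then show "z t = x t" using z_eq[of t 0] F(3) by simp
  qed
qed

end

section \<open>Decay of the output\<close>

context closed_loop
begin

text \<open>The norm is differentiable away from \<open>0\<close>, as the square root of a positive quadratic form.\<close>

lemma Lyapunov_derivative: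
  assumes y: "(y has_vector_derivative y') (at t)" and nz: "y t \<noteq> 0"
  shows "((\<lambda>s. wnorm P (y s)) has_real_derivative (y t \<bullet> (P *v y')) / wnorm P (y t)) (at t)"
proof -
  have "((\<lambda>s. P *v y s) has_vector_derivative P *v y') (at t)"
    by (rule bounded_linear.has_vector_derivative[OF matrix_vector_mul_bounded_linear y])
  from bounded_bilinear.has_vector_derivative[OF bounded_bilinear_inner y this]
  have "((\<lambda>s. y s \<bullet> (P *v y s)) has_real_derivative 2 * (y t \<bullet> (P *v y'))) (at t)"
    using form_sym[of y' "y t"] by (simp add: has_real_derivative_iff_has_vector_derivative)
  moreover have pos: "0 < y t \<bullet> (P *v y t)"
    using nz P by (simp add: pos_definite_def)
  ultimately have "((\<lambda>s. sqrt (y s \<bullet> (P *v y s))) has_real_derivative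
      inverse (sqrt (y t \<bullet> (P *v y t))) / 2 * (2 * (y t \<bullet> (P *v y')))) (at t)"
    by (intro DERIV_chain2[OF DERIV_real_sqrt])
  then show ?thesis by (simp add: wnorm_def field_simps)
qed

lemma L_dissipative: "y \<bullet> (P *v (L *v y)) \<le> 0"
proof -
  have "y \<bullet> ((transpose L ** P + P ** L) *v y) \<le> 0" using L by (simp add: neg_semidefinite_def)
  moreover have "y \<bullet> ((transpose L ** P + P ** L) *v y) = y \<bullet> (transpose L *v (P *v y)) + y \<bullet> (P *v (L *v y))"
    by (simp add: matrix_vector_mult_add_rdistrib inner_add_right matrix_vector_mul_assoc)
  moreover have "y \<bullet> (transpose L *v (P *v y)) = y \<bullet> (P *v (L *v y))"
    using form_sym[of "L *v y" y] by (metis dot_lmul_matrix inner_commute transpose_matrix_vector)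
  ultimately show ?thesis by simp
qed

lemma output_decay:
  assumes x: "trajectory T x"
  shows "AE t in lebesgue. t \<in> {t0<..<T} \<and> wnorm P (C *v x t) \<noteq> 0 \<longrightarrow>
     (\<exists>D. ((\<lambda>s. wnorm P (C *v x s)) has_real_derivative D) (at t) \<and> D \<le> - \<delta>)"
proof -
  have "AE t in lebesgue. t \<in> {t0<..<T} \<longrightarrow> moves x t" using x by (simp add: trajectory_def)
  then show ?thesis using control_margin
  proof eventually_elim
    case (elim t)
    show ?case
    proof (intro impI, elim conjE)
      assume t: "t \<in> {t0<..<T}" and nz: "wnorm P (C *v x t) \<noteq> 0"
      define y where "y = C *v x t"
      have y: "y \<noteq> 0" using nz by (simp add: y_def)
      define n where "n = wnorm P y"
      have n: "n > 0" using y wnorm_pos by (simp add: n_def)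
      define e where "e = C *v (B *v \<gamma> t + p t)"
      obtain v w where v: "v \<in> present t (x t)" and w: "w \<in> memory x t" and dx: "(x has_vector_derivative v + w) (at t)"
        using elim(1) t unfolding moves_def by blast
      have v_eq: "v = drift A B (B *v \<gamma> t + p t) (x t)"
        using v y filippov_reg_drift_off_surface[of "x t"] by (simp add: present_def y_def)
      have "((\<lambda>s. C *v x s) has_vector_derivative C *v (v + w)) (at t)"
        by (rule bounded_linear.has_vector_derivative[OF matrix_vector_mul_bounded_linear dx])
      from Lyapunov_derivative[OF this] y
      have D: "((\<lambda>s. wnorm P (C *v x s)) has_real_derivative (y \<bullet> (P *v (C *v (v + w)))) / n) (at t)"
        by (simp add: y_def n_def)
      have "C *v (A *v x t) = L *v y" using CA by (simp add: y_def matrix_vector_mul_assoc)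
      then have "C *v (v + w) = L *v y - \<rho> *\<^sub>R (y /\<^sub>R n) + (C *v w + e)"
        by (simp add: v_eq drift_def fb_dir e_def matrix_vector_right_distrib matrix_vector_mult_scaleR CB_G
            dir_def y_def n_def flip: scaleR_minus_left)
      then have "y \<bullet> (P *v (C *v (v + w))) = y \<bullet> (P *v (L *v y)) - \<rho> * (n\<^sup>2 / n) + y \<bullet> (P *v (C *v w + e))"
        by (simp add: matrix_vector_right_distrib matrix_vector_mult_diff_distrib matrix_vector_mult_scaleR
            inner_add_right inner_diff_right n_def wnorm_square divide_inverse mult.commute)
      also have "\<dots> \<le> 0 - \<rho> * n + n * (\<rho> - \<delta>)"
      proof -
        have "y \<bullet> (P *v (C *v w + e)) \<le> n * wnorm P (C *v w + e)"
          unfolding n_def by (rule wnorm_Cauchy_Schwarz)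
        also have "\<dots> \<le> n * (wnorm P (C *v w) + wnorm P e)"
          using n by (intro mult_left_mono wnorm_triangle) auto
        also have "\<dots> \<le> n * (\<rho> - \<delta>)"
          using elim(2) t w n by (intro mult_left_mono) (auto simp: e_def)
        finally show ?thesis using L_dissipative[of y] n by (simp add: power2_eq_square)
      qed
      also have "\<dots> = - \<delta> * n" by (simp add: algebra_simps)
      finally have "(y \<bullet> (P *v (C *v (v + w)))) / n \<le> - \<delta>" using n by (simp add: divide_le_eq)
      then show "\<exists>D. ((\<lambda>s. wnorm P (C *v x s)) has_real_derivative D) (at t) \<and> D \<le> - \<delta>"
        using D by blast
    qed
  qed
qed

lemma output_abs_continuous:
  assumes x: "trajectory T x" and uv: "t0 \<le> u" "v \<le> T"
  shows "abs_continuous_on {u..v} (\<lambda>t. wnorm P (C *v x t))"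
proof -
  obtain K where K: "K-lipschitz_on {t0..T} x" using x unfolding trajectory_def by blast
  have sub: "{u..v} \<subseteq> {t0..T}" using uv by auto
  obtain \<kappa> where \<kappa>: "\<kappa> > 0" "\<And>y. wnorm P y \<le> \<kappa> * norm y" by (rule wnorm_le_norm) blast
  obtain c where c: "c > 0" "\<And>y. norm (C *v y) \<le> norm y * c"
    using bounded_linear.pos_bounded[OF matrix_vector_mul_bounded_linear] by blast
  show ?thesis
  proof (rule abs_continuous_on_lipschitz_image[OF lipschitz_imp_abs_continuous_on[OF lipschitz_on_subset[OF K sub]], where c = "\<kappa> * c"])
    fix s t
    have diff: "wnorm P (C *v x s) \<le> wnorm P (C *v x t) + \<kappa> * c * norm (x s - x t)" for s t
    proof -
      have "wnorm P (C *v x s) \<le> wnorm P (C *v x t) + wnorm P (C *v (x s - x t))"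
        using wnorm_triangle[of "C *v x t" "C *v (x s - x t)"] by (simp add: matrix_vector_mult_diff_distrib)
      also have "wnorm P (C *v (x s - x t)) \<le> \<kappa> * (norm (x s - x t) * c)"
        using \<kappa>(2)[of "C *v (x s - x t)"] mult_left_mono[OF c(2)[of "x s - x t"] less_imp_le[OF \<kappa>(1)]] by linarith
      finally show ?thesis by (simp add: mult_ac)
    qed
    show "norm (wnorm P (C *v x s) - wnorm P (C *v x t)) \<le> \<kappa> * c * norm (x s - x t)"
      using diff[of s t] diff[of t s] by (simp add: abs_le_iff norm_minus_commute)
  qed
qed

lemma output_decrease:
  assumes x: "trajectory v x" and uv: "t0 \<le> u" "u \<le> v" and nz: "\<And>t. t \<in> {u<..<v} \<Longrightarrow> C *v x t \<noteq> 0"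
  shows "wnorm P (C *v x v) \<le> wnorm P (C *v x u) - \<delta> * (v - u)"
proof -
  have "wnorm P (C *v x v) - wnorm P (C *v x u) \<le> (- \<delta>) * (v - u)"
  proof (rule abs_continuous_on_increment_le[OF uv(2) output_abs_continuous[OF x uv(1) order_refl]])
    have "AE t in lebesgue. t \<noteq> u \<and> t \<noteq> v"
      using AE_lebesgue_neq[of u] AE_lebesgue_neq[of v] by eventually_elim simp
    then show "AE t in lebesgue. t \<in> {u..v} \<longrightarrow>
        (\<exists>D. ((\<lambda>t. wnorm P (C *v x t)) has_real_derivative D) (at t within {u..v}) \<and> D \<le> - \<delta>)"
      using output_decay[OF x]
    proof eventually_elim
      case (elim t)
      show ?case
      proof
        assume "t \<in> {u..v}"
        then have "t \<in> {u<..<v}" using elim(1) by auto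
        then obtain D where "((\<lambda>s. wnorm P (C *v x s)) has_real_derivative D) (at t)" "D \<le> - \<delta>"
          using elim(2) uv(1) nz[of t] by auto
        then show "\<exists>D. ((\<lambda>t. wnorm P (C *v x t)) has_real_derivative D) (at t within {u..v}) \<and> D \<le> - \<delta>"
          using has_field_derivative_at_within by blast
      qed
    qed
  qed
  then show ?thesis by simp
qed

text \<open>After the last zero before a time with nonzero output, the norm of the output would decrease from \<open>0\<close>.\<close>

lemma output_vanishes:
  assumes x: "\<And>T. trajectory T x"
  shows "\<exists>T\<in>{t0..t0 + wnorm P (C *v x t0) / \<delta>}. \<forall>t\<ge>T. C *v x t = 0"
proof -
  let ?s = "t0 + wnorm P (C *v x t0) / \<delta>"
  have s: "t0 \<le> ?s" using \<delta> by simp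
  have "\<exists>T\<in>{t0..?s}. C *v x T = 0"
  proof (rule ccontr)
    assume "\<not> ?thesis"
    then have nz: "C *v x t \<noteq> 0" if "t \<in> {t0..?s}" for t using that by blast
    have "wnorm P (C *v x ?s) \<le> wnorm P (C *v x t0) - \<delta> * (?s - t0)"
      by (rule output_decrease[OF x order_refl s]) (use nz in auto)
    also have "\<dots> = 0" using \<delta> by simp
    finally have "wnorm P (C *v x ?s) = 0" using wnorm_nonneg[of "C *v x ?s"] by linarith
    then show False using nz[of ?s] s by simp
  qed
  then obtain T where T: "T \<in> {t0..?s}" "C *v x T = 0" by blast
  have "C *v x t = 0" if t: "T \<le> t" for t
  proof (rule ccontr)
    assume nz: "C *v x t \<noteq> 0"
    let ?Z = "{r \<in> {T..t}. C *v x r = 0}"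
    have "continuous_on {T..t} (\<lambda>r. C *v x r)"
      by (rule continuous_on_compose2[OF matrix_vector_mult_linear_continuous_on[of UNIV]
          continuous_on_subset[OF trajectory_continuous[OF x]]]) (use T in auto)
    then have "closed ?Z"
      using continuous_closed_preimage_constant[of "{T..t}"] by (simp add: closed_atLeastAtMost)
    then have "compact ({T..t} \<inter> ?Z)" by (rule compact_Int_closed[OF compact_Icc])
    moreover have "{T..t} \<inter> ?Z = ?Z" by auto
    ultimately have "compact ?Z" by simp
    moreover have "T \<in> ?Z" using T t by simp
    ultimately obtain r where r: "r \<in> ?Z" "\<And>s. s \<in> ?Z \<Longrightarrow> s \<le> r"
      using compact_attains_sup[of ?Z] by blast
    have "r < t" using r(1) nz by (cases "r = t") auto
    have "wnorm P (C *v x t) \<le> wnorm P (C *v x r) - \<delta> * (t - r)"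
    proof (rule output_decrease[OF x])
      show "C *v x s \<noteq> 0" if "s \<in> {r<..<t}" for s
        using r(2)[of s] r(1) that by auto
    qed (use r(1) T in auto)
    also have "\<dots> < 0" using r(1) \<delta> \<open>r < t\<close> by simp
    finally show False using wnorm_nonneg[of "C *v x t"] by linarith
  qed
  then show ?thesis using T(1) by blast
qed

end

section \<open>Finite-time stabilization\<close>

context closed_loop
begin

lemma solution_exists: "\<exists>x. solution x0 {t0..} x"
proof -
  have "0-lipschitz_on {t0..t0} (\<lambda>_. x0)" by (auto intro: lipschitz_onI)
  then have "trajectory t0 (\<lambda>_. x0)" unfolding trajectory_def by auto
  then obtain z where z: "\<And>T. trajectory T z" "\<And>t. t \<in> {t0..t0} \<Longrightarrow> z t = x0"
    by (rule trajectory_extend[OF _ order_refl]) blast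
  show ?thesis using solution_of_trajectory[OF z(1)] z(2)[of t0] by auto
qed

lemma solution_extends:
  assumes sol: "solution x0 I x"
  shows "\<exists>z. solution x0 {t0..} z \<and> (\<forall>t\<in>I. z t = x t)"
proof (cases "bdd_above I")
  case True
  have t0: "t0 \<in> I" "x t0 = x0" using sol unfolding solution_iff by auto
  obtain T y where y: "t0 \<le> T" "I \<subseteq> {t0..T}" "trajectory T y" "\<And>t. t \<in> I \<Longrightarrow> y t = x t"
    using solution_closure[OF sol True] by blast
  obtain z where z: "\<And>T. trajectory T z" "\<And>t. t \<in> {t0..T} \<Longrightarrow> z t = y t"
    using trajectory_extend[OF y(3,1)] by blast
  have "z t = x t" if "t \<in> I" for t using y(2,4) z(2) that by auto
  then show ?thesis using solution_of_trajectory[OF z(1)] t0 by auto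
next
  case False
  have I: "is_interval I" "t0 \<in> I" "I \<subseteq> {t0..}" using sol unfolding solution_iff by auto
  have "I = {t0..}"
  proof (rule subset_antisym[OF I(3)], rule subsetI)
    fix t assume t: "t \<in> {t0..}"
    obtain s where "s \<in> I" "t \<le> s" using False unfolding bdd_above_def by (meson linear)
    then show "t \<in> I" using is_interval_Icc_subset[OF I(1,2) \<open>s \<in> I\<close>] t by auto
  qed
  then show ?thesis using sol by blast
qed

lemma trajectory_of_global_solution:
  assumes "solution x0 {t0..} x"
  shows "trajectory T x"
  using trajectory_of_solution[OF assms, of "max t0 T"] by (rule trajectory_mono) auto

lemma global_output_decay:
  assumes "solution x0 {t0..} x"
  shows "AE t in lebesgue. t \<ge> t0 \<and> wnorm P (C *v x t) \<noteq> 0 \<longrightarrow>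
            (\<exists>D. ((\<lambda>s. wnorm P (C *v x s)) has_real_derivative D) (at t) \<and> D \<le> - \<delta>)"
proof -
  have "AE t in lebesgue. \<forall>n. t \<in> {t0<..<t0 + real n} \<and> wnorm P (C *v x t) \<noteq> 0 \<longrightarrow>
            (\<exists>D. ((\<lambda>s. wnorm P (C *v x s)) has_real_derivative D) (at t) \<and> D \<le> - \<delta>)"
    unfolding AE_all_countable using output_decay[OF trajectory_of_global_solution[OF assms]] by blast
  moreover have "AE t in lebesgue. t \<noteq> t0" by (rule AE_lebesgue_neq)
  ultimately show ?thesis
  proof eventually_elim
    case (elim t)
    obtain n where "t - t0 < real n" using reals_Archimedean2 by blast
    then have "t0 \<le> t \<Longrightarrow> t \<in> {t0<..<t0 + real n}" using elim by auto
    then show ?case using elim(1) by blast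
  qed
qed

end

theorem theorem20:
  fixes A :: "real ^ 'n ^ 'n"
    and B Bt :: "real ^ 'm ^ 'n"
    and C :: "real ^ 'n ^ 'm"
    and \<Phi> :: "real \<Rightarrow> real \<Rightarrow> real ^ 'n ^ 'n"
    and \<gamma> :: "real \<Rightarrow> real ^ 'm"
    and p :: "real \<Rightarrow> real ^ 'n"
    and L P :: "real ^ 'm ^ 'm"
    and t0 \<rho> M \<delta> :: real
  assumes "det (C ** B) \<noteq> 0"
    and "(\<lambda>(t, \<tau>). \<Phi> t \<tau>) \<in> borel_measurable (lebesgue_on kernel_domain)"
    and "locally_ess_bounded_on kernel_domain (\<lambda>(t, \<tau>). \<Phi> t \<tau>)"
    and "L_infinity \<gamma>"
    and "L_infinity p"
    and "\<rho> > 0"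
    and "C ** A = L ** C"
    and "pos_definite P"
    and "neg_semidefinite (transpose L ** P + P ** L)"
    and "\<delta> > 0"
    and "esssup (lebesgue_on {t0..})
           (\<lambda>t. enn2ereal (\<integral>\<^sup>+\<tau>\<in>{t0..t}.
              ennreal (wopnorm P (C ** \<Phi> t \<tau> ** Bt ** matrix_inv (C ** B))) \<partial>lebesgue)) \<le> ereal M"
    and "M < 1"
    and "AE t in lebesgue. t \<ge> t0 \<longrightarrow>
           ennreal \<rho> \<ge> (ennreal (wnorm P (C *v (B *v \<gamma> t + p t)))
              + (\<integral>\<^sup>+\<tau>\<in>{t0..t}. ennreal (wnorm P ((C ** \<Phi> t \<tau> ** Bt) *v \<gamma> \<tau>)) \<partial>lebesgue)
              + ennreal \<delta>) / ennreal (1 - M)"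
  shows "\<forall>x0.
      (\<exists>x. closed_loop_solution A B Bt C \<Phi> \<gamma> p P \<rho> t0 x0 {t0..} x)
    \<and> (\<forall>I x. closed_loop_solution A B Bt C \<Phi> \<gamma> p P \<rho> t0 x0 I x \<longrightarrow>
         (\<exists>z. closed_loop_solution A B Bt C \<Phi> \<gamma> p P \<rho> t0 x0 {t0..} z \<and> (\<forall>t\<in>I. z t = x t)))
    \<and> (\<forall>x. closed_loop_solution A B Bt C \<Phi> \<gamma> p P \<rho> t0 x0 {t0..} x \<longrightarrow>
         (AE t in lebesgue. t \<ge> t0 \<and> wnorm P (C *v x t) \<noteq> 0 \<longrightarrow>
            (\<exists>D. ((\<lambda>s. wnorm P (C *v x s)) has_real_derivative D) (at t) \<and> D \<le> - \<delta>))
       \<and> (\<exists>T\<in>{t0..t0 + wnorm P (C *v x t0) / \<delta>}. \<forall>t\<ge>T. C *v x t = 0))"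
proof -
  interpret closed_loop P B C \<rho> A Bt \<Phi> \<gamma> p L t0 M \<delta>
    by unfold_locales (fact assms)+
  show ?thesis
    by (intro allI conjI impI)
      (fact solution_exists, erule solution_extends, erule global_output_decay,
        rule output_vanishes, erule trajectory_of_global_solution)
qed

end
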